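(* Let $f:\mathbb{R}\to\mathbb{R}$ and the real sequence $(a_k)_{k\in\mathbb{Z}}$ satisfy: (H1) $f\in C^2(\mathbb{R})$, $f(0)=f(1)=0$, $f'(0)<0$, $f'(1)<0$, and, with $F(u)=\int_0^u f(s)\,ds$, $F(1)=0$ and $F(u)\neq 0$ for all $u\in(0,1)$; (H2) $\sum_{k=-\infty}^{\infty}a_k=0$, $a_0<0$, $a_k=a_{-k}$ for all $k$, and $\sum_{k\ge 1}|a_k|k^2<\infty$. Let $u_0$ be a heteroclinic solution of $u''+f(u)=0$ on $\mathbb{R}$ with $\lim_{z\to-\infty}u_0(z)=0$ and $\lim_{z\to\infty}u_0(z)=1$. Then there exist constants $\epsilon_0>0$ and $C>0$ such that for every $\epsilon\in(0,\epsilon_0)$ there exists a solution $u_\epsilon$ of $$u''(z)-\epsilon\sum_{k=-\infty}^{\infty}a_k u(z-k)+f(u(z))=0,\qquad z\in\mathbb{R},$$ such that $$\|u_\epsilon-u_0\|_{H^2(\mathbb{R})}\le C\epsilon,$$ where $C$ is independent of $\epsilon$.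
   Context: All functions are real-valued. Under (H1), it is a known fact that the equation $u''+f(u)=0$ has a solution $u_0$ with limits $0$ at $-\infty$ and $1$ at $+\infty$, unique up to translation; $u_0$ denotes one fixed such solution. $H^2(\mathbb{R})$ is the usual Sobolev space. *)

theory Defs
  imports "HOL-Analysis.Analysis"
begin

definition C2 :: "(real \<Rightarrow> real) \<Rightarrow> bool" where
  "C2 f \<longleftrightarrow> (\<forall>x. f differentiable (at x)) \<and> (\<forall>x. deriv f differentiable (at x)) \<and>
     continuous_on UNIV (deriv (deriv f))"

definition potential :: "(real \<Rightarrow> real) \<Rightarrow> real \<Rightarrow> real" where
  "potential f u = (LBINT s=0..u. f s)"

definition bistable_balanced :: "(real \<Rightarrow> real) \<Rightarrow> bool" where
  "bistable_balanced f \<longleftrightarrow>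
     C2 f \<and> f 0 = 0 \<and> f 1 = 0 \<and> deriv f 0 < 0 \<and> deriv f 1 < 0 \<and>
     potential f 1 = 0 \<and> (\<forall>u\<in>{0<..<1}. potential f u \<noteq> 0)"

text \<open>
  The sum over all integers is unconditional; by the symmetry and moment conditions below the
  family is absolutely summable, so every mode of summation gives the same value.
\<close>

definition coupling_coeffs :: "(int \<Rightarrow> real) \<Rightarrow> bool" where
  "coupling_coeffs a \<longleftrightarrow>
     (a has_sum 0) UNIV \<and> a 0 < 0 \<and> (\<forall>k. a k = a (- k)) \<and>
     (\<lambda>k. \<bar>a k\<bar> * (real_of_int k)\<^sup>2) summable_on {1..}"

definition heteroclinic :: "(real \<Rightarrow> real) \<Rightarrow> (real \<Rightarrow> real) \<Rightarrow> bool" where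
  "heteroclinic f u \<longleftrightarrow>
     C2 u \<and> (\<forall>z. deriv (deriv u) z + f (u z) = 0) \<and>
     (u \<longlongrightarrow> 0) at_bot \<and> (u \<longlongrightarrow> 1) at_top"

text \<open>
  Summability is required explicitly because \<open>infsum\<close> is \<open>0\<close> on families that are not summable.
\<close>

definition nonlocal_solution ::
    "(real \<Rightarrow> real) \<Rightarrow> (int \<Rightarrow> real) \<Rightarrow> real \<Rightarrow> (real \<Rightarrow> real) \<Rightarrow> bool" where
  "nonlocal_solution f a \<epsilon> u \<longleftrightarrow>
     C2 u \<and>
     (\<forall>z. (\<lambda>k. a k * u (z - of_int k)) summable_on UNIV \<and>
          deriv (deriv u) z - \<epsilon> * (\<Sum>\<^sub>\<infinity>k\<in>UNIV. a k * u (z - of_int k)) + f (u z) = 0)"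

definition test_function :: "(real \<Rightarrow> real) \<Rightarrow> bool" where
  "test_function \<phi> \<longleftrightarrow>
     (\<forall>n x. (deriv ^^ n) \<phi> differentiable (at x)) \<and> compact (closure {x. \<phi> x \<noteq> 0})"

definition locally_integrable :: "(real \<Rightarrow> real) \<Rightarrow> bool" where
  "locally_integrable v \<longleftrightarrow> (\<forall>K. compact K \<longrightarrow> set_integrable lborel K v)"

definition has_weak_deriv :: "(real \<Rightarrow> real) \<Rightarrow> (real \<Rightarrow> real) \<Rightarrow> bool" where
  "has_weak_deriv v g \<longleftrightarrow>
     locally_integrable v \<and> locally_integrable g \<and>
     (\<forall>\<phi>. test_function \<phi> \<longrightarrow> (LBINT x. v x * deriv \<phi> x) = - (LBINT x. g x * \<phi> x))"

definition in_L2 :: "(real \<Rightarrow> real) \<Rightarrow> bool" where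
  "in_L2 v \<longleftrightarrow> v \<in> borel_measurable lborel \<and> integrable lborel (\<lambda>x. (v x)\<^sup>2)"

definition L2_norm :: "(real \<Rightarrow> real) \<Rightarrow> real" where
  "L2_norm v = sqrt (LBINT x. (v x)\<^sup>2)"

text \<open>
  \<open>has_H2_norm v N\<close> says that \<open>v\<close> belongs to \<open>H\<^sup>2(\<real>)\<close> and has norm \<open>N\<close>. The relational form avoids
  choosing a representative of the weak derivatives, which are unique only almost everywhere;
  \<open>N\<close> does not depend on the representatives.
\<close>

definition has_H2_norm :: "(real \<Rightarrow> real) \<Rightarrow> real \<Rightarrow> bool" where
  "has_H2_norm v N \<longleftrightarrow>
     (\<exists>g h. has_weak_deriv v g \<and> has_weak_deriv g h \<and> in_L2 v \<and> in_L2 g \<and> in_L2 h \<and>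
        N = sqrt ((L2_norm v)\<^sup>2 + (L2_norm g)\<^sup>2 + (L2_norm h)\<^sup>2))"

end

theory Submission
  imports Defs
begin

text \<open>
  Write \<open>\<phi> = u\<^sub>0'\<close> and look for \<open>u = u\<^sub>0 + v\<close>. Since \<open>a\<close> is symmetric with sum \<open>0\<close>, the coupling is
  \<open>N u(z) = \<Sum>n. b n * (u(z + n) + u(z - n) - 2 u(z))\<close> with \<open>b n = a n\<close>, and the equation becomes
  \<open>v'' + f'(u\<^sub>0) v = g(v)\<close> with \<open>g(v) = \<epsilon> N(u\<^sub>0 + v) - (f(u\<^sub>0 + v) - f(u\<^sub>0) - f'(u\<^sub>0) v)\<close>. The linear operator on
  the left annihilates \<open>\<phi>\<close>, so a bounded solution exists only if the right-hand side is orthogonal to \<open>\<phi>\<close>.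
  The argument is a Lyapunov-Schmidt reduction in which the orthogonality comes for free.

  \<^emph>\<open>Linear part.\<close> The energy identity \<open>\<phi>\<^sup>2 = - 2 F(u\<^sub>0)\<close> makes the front increasing, and near either end
  \<open>\<phi>\<close> is comparable with the distance of \<open>u\<^sub>0\<close> to the equilibrium and decays exponentially
  (\<open>exponential_end\<close>). Putting \<open>v = \<phi> w\<close> turns \<open>v'' + f'(u\<^sub>0) v = h\<close> into \<open>(\<phi>\<^sup>2 w')' = \<phi> h\<close>, which two
  integrations solve. If \<open>h\<close> is orthogonal to \<open>\<phi>\<close> this solution and its derivative are bounded by
  the supremum of \<open>h\<close> (\<open>solve_sup_bound\<close>). Since \<open>f'(u\<^sub>0)\<close> is negative at both ends, testing the equation
  with a smoothed sign of \<open>v\<close> also bounds the integral of \<open>\<bar>v\<bar>\<close> (\<open>solve_L1_bound\<close>). For general \<open>g\<close> the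
  equation is solved with \<open>g - \<mu> \<phi>\<close>, where the multiplier \<open>\<mu>\<close> enforces the orthogonality.

  \<^emph>\<open>Fixed point.\<close> The forcing \<open>N u\<^sub>0\<close> is bounded and integrable, because the absolute second difference at
  distance \<open>n\<close> of an increasing function with values between \<open>0\<close> and \<open>1\<close> has integral at most \<open>2 n\<close>. The set of
  continuous \<open>v\<close> with both \<open>sup \<bar>v\<bar>\<close> and \<open>\<integral> \<bar>v\<bar>\<close> at most \<open>r\<close> is complete for the supremum distance; for
  small \<open>\<epsilon>\<close> and \<open>r\<close> a suitable multiple of \<open>\<epsilon>\<close> the solution map preserves it and is a contraction
  (\<open>projected_solution\<close>).

  \<^emph>\<open>The multiplier vanishes.\<close> For the resulting \<open>u\<close> the equation holds up to the term \<open>\<mu> \<phi>\<close>. Multiply by \<open>u'\<close> and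
  integrate. The local terms contribute \<open>F(1) - F(0) = 0\<close>. The nonlocal term contributes \<open>0\<close> as well:
  \<open>u'(z) (u(z + n) + u(z - n) - 2 u(z))\<close> is the derivative of an expression that vanishes at both
  ends. What remains is \<open>\<mu> \<integral> \<phi> u' = 0\<close>, and the integral is positive because \<open>u'\<close> is uniformly close to
  \<open>\<phi>\<close>. Hence \<open>\<mu> = 0\<close> (\<open>multiplier_vanishes\<close>).

  \<^emph>\<open>Norm.\<close> The bounds on \<open>v\<close> of order \<open>\<epsilon>\<close> in the supremum and in the integral give \<open>\<integral> v\<^sup>2 \<le> r\<^sup>2\<close>; the equation
  transfers both to \<open>v''\<close>, and an integration by parts gives \<open>v'\<close>.
\<close>

section \<open>Integrals over the line and weak derivatives\<close>

lemma has_integral_derivative: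
  fixes F F' :: "real \<Rightarrow> real"
  assumes "a \<le> b" "\<And>x. (F has_real_derivative F' x) (at x)"
  shows "(F' has_integral (F b - F a)) {a..b}"
  by (rule fundamental_theorem_of_calculus)
     (use assms in \<open>auto simp: has_real_derivative_iff_has_vector_derivative[symmetric]
        intro: has_field_derivative_at_within\<close>)

lemma integrable_on_interval:
  fixes g :: "real \<Rightarrow> real"
  assumes "continuous_on UNIV g"
  shows "g integrable_on {a..b}"
  by (rule integrable_continuous_interval) (rule continuous_on_subset[OF assms], simp)

text \<open>
  The interval integral is oriented, so this is an antiderivative on the whole line, negative arguments included.
\<close>
definition primitive :: "(real \<Rightarrow> real) \<Rightarrow> real \<Rightarrow> real" where
  "primitive g x = (LBINT y=0..x. g y)"

lemma primitive_0 [simp]: "primitive g 0 = 0"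
  unfolding primitive_def by (simp add: zero_ereal_def)

lemma DERIV_primitive:
  assumes "continuous_on UNIV g"
  shows "(primitive g has_real_derivative g x) (at x)"
proof -
  let ?r = "\<bar>x\<bar> + 1"
  have "((\<lambda>u. LBINT y=0..u. g y) has_vector_derivative (g x)) (at x within {-?r..?r})"
    using interval_integral_FTC2[of "-?r" 0 ?r g x] continuous_on_subset[OF assms]
    by (auto simp: zero_ereal_def)
  moreover have "at x within {-?r..?r} = at x"
    by (rule at_within_interior) auto
  ultimately show ?thesis
    unfolding has_real_derivative_iff_has_vector_derivative primitive_def[abs_def] by simp
qed

lemma DERIV_primitive_shift [derivative_intros]:
  assumes "continuous_on UNIV g" "(h has_real_derivative d) (at x within A)"
  shows "((\<lambda>x. primitive g (h x)) has_real_derivative (g (h x) * d)) (at x within A)"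
  using DERIV_chain2[OF DERIV_primitive[OF assms(1)] assms(2)] by simp

lemma DERIV_imp_continuous:
  assumes "\<And>x. (F has_real_derivative F' x) (at x)"
  shows "continuous_on UNIV F"
  using assms DERIV_continuous_on by blast

lemma integral_eq_primitive_diff:
  assumes "continuous_on UNIV g" "a \<le> b"
  shows "integral {a..b} g = primitive g b - primitive g a"
  using has_integral_derivative[OF assms(2) DERIV_primitive[OF assms(1)]] by (rule integral_unique)

lemma primitive_unique:
  assumes "\<And>x. (F has_real_derivative g x) (at x)" "F 0 = 0" "continuous_on UNIV g"
  shows "primitive g = F"
proof
  fix x
  have "((\<lambda>x. primitive g x - F x) has_real_derivative 0) (at x)" for x
    using DERIV_diff[OF DERIV_primitive[OF assms(3)] assms(1)] by simp
  then have "primitive g x - F x = primitive g 0 - F 0"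
    by (intro DERIV_const_ratio_const DERIV_isconst_all) auto
  then show "primitive g x = F x" using assms(2) by simp
qed

lemma primitive_mono_nonneg:
  assumes "continuous_on UNIV g" "\<And>x. 0 \<le> g x" "a \<le> b"
  shows "primitive g a \<le> primitive g b"
  by (rule DERIV_nonneg_imp_nondecreasing[OF assms(3)]) (use DERIV_primitive[OF assms(1)] assms(2) in blast)

lemma monotone_bounded_limits:
  fixes g :: "real \<Rightarrow> real"
  assumes mono: "\<And>x y. x \<le> y \<Longrightarrow> g x \<le> g y" and b: "\<And>x. \<bar>g x\<bar> \<le> B"
  shows "\<exists>l. (g \<longlongrightarrow> l) at_bot" "\<exists>l. (g \<longlongrightarrow> l) at_top"
proof -
  have bdd: "bdd_above (range g)" "bdd_below (range g)"
    using b by (auto intro!: bdd_aboveI[of _ B] bdd_belowI[of _ "-B"] simp: abs_le_iff minus_le_iff)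
  have "(g \<longlongrightarrow> Sup (range g)) at_top"
  proof (rule increasing_tendsto)
    fix x assume "x < Sup (range g)"
    then obtain y where "x < g y" using less_cSup_iff[OF _ bdd(1)] by auto
    then show "\<forall>\<^sub>F n in at_top. x < g n"
      unfolding eventually_at_top_linorder using mono by (meson less_le_trans)
  qed (use cSup_upper[OF _ bdd(1)] in auto)
  then show "\<exists>l. (g \<longlongrightarrow> l) at_top" by blast
  have "(g \<longlongrightarrow> Inf (range g)) at_bot"
  proof (rule decreasing_tendsto)
    fix x assume "Inf (range g) < x"
    then obtain y where "g y < x" using cInf_less_iff[OF _ bdd(2)] by auto
    then show "\<forall>\<^sub>F n in at_bot. g n < x"
      unfolding eventually_at_bot_linorder using mono by (meson le_less_trans)
  qed (use cInf_lower[OF _ bdd(2)] in auto)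
  then show "\<exists>l. (g \<longlongrightarrow> l) at_bot" by blast
qed

text \<open>
  A function with bounded derivative that does not tend to \<open>0\<close> is large on infinitely many intervals of a fixed length, and each of them contributes a fixed amount to the integral of its square.
\<close>
lemma tendsto_zero_at_top_of_integral_bound:
  fixes w :: "real \<Rightarrow> real"
  assumes d: "\<And>x. (w has_real_derivative w' x) (at x)" and B: "\<And>x. \<bar>w' x\<bar> \<le> B"
    and I: "\<And>R. 0 \<le> R \<Longrightarrow> integral {-R..R} (\<lambda>x. (w x)\<^sup>2) \<le> I"
  shows "(w \<longlongrightarrow> 0) at_top"
proof (rule tendstoI)
  fix e :: real assume e: "e > 0"
  have cw: "continuous_on UNIV (\<lambda>x. (w x)\<^sup>2)"
    by (intro continuous_intros DERIV_imp_continuous[OF d])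
  let ?P = "primitive (\<lambda>x. (w x)\<^sup>2)"
  have mono: "?P a \<le> ?P b" if "a \<le> b" for a b
    by (rule primitive_mono_nonneg[OF cw _ that]) simp
  have bd: "\<bar>?P x\<bar> \<le> I" for x
  proof -
    have "?P \<bar>x\<bar> - ?P (- \<bar>x\<bar>) \<le> I"
      using I[of "\<bar>x\<bar>"] by (simp add: integral_eq_primitive_diff[OF cw])
    moreover have "?P (- \<bar>x\<bar>) \<le> ?P x" "?P x \<le> ?P \<bar>x\<bar>" "?P (- \<bar>x\<bar>) \<le> ?P 0" "?P 0 \<le> ?P \<bar>x\<bar>"
      by (rule mono, simp)+
    ultimately show ?thesis by (simp add: abs_le_iff)
  qed
  obtain l where lim: "(?P \<longlongrightarrow> l) at_top" using monotone_bounded_limits(2)[of ?P, OF mono bd] by blast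
  have B0: "0 \<le> B" using B[of 0] by linarith
  (* On a window of length h the function changes by at most e / 2. *)
  define h where "h = e / (2 * (B + 1))"
  have h: "h > 0" "B * h \<le> e / 2" using e B0 by (auto simp: h_def field_simps)
  have "((\<lambda>x. ?P (x + h)) \<longlongrightarrow> l) at_top"
    by (rule filterlim_compose[OF lim])
       (auto intro!: filterlim_at_top_mono[OF filterlim_ident] eventuallyI simp: less_imp_le[OF h(1)])
  from tendsto_diff[OF this lim] have "((\<lambda>x. ?P (x + h) - ?P x) \<longlongrightarrow> 0) at_top" by simp
  moreover have "h * (e / 2)\<^sup>2 > 0" using h e by simp
  ultimately have "\<forall>\<^sub>F x in at_top. ?P (x + h) - ?P x < h * (e / 2)\<^sup>2"
    by (rule order_tendstoD(2))
  then show "\<forall>\<^sub>F x in at_top. dist (w x) 0 < e"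
  proof eventually_elim
    case (elim x)
    obtain z where z: "x < z" "z < x + h" "?P (x + h) - ?P x = (x + h - x) * (w z)\<^sup>2"
      using MVT2[of x "x + h" ?P "\<lambda>x. (w x)\<^sup>2"] DERIV_primitive[OF cw] h(1) by auto
    obtain y where y: "w z - w x = (z - x) * w' y"
      using MVT2[OF z(1), of w w'] d by auto
    have "\<bar>(z - x) * w' y\<bar> \<le> h * B"
      unfolding abs_mult by (intro mult_mono) (use z B h in auto)
    then have 1: "\<bar>w z - w x\<bar> \<le> e / 2" using y h by (simp add: mult.commute)
    have "(w z)\<^sup>2 < (e / 2)\<^sup>2" using elim z h by simp
    then have "\<bar>w z\<bar> < e / 2" using e by (intro power2_less_imp_less[of "\<bar>w z\<bar>"]) auto
    then show ?case using 1 unfolding dist_real_def by linarith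
  qed
qed

lemma integral_reflect_symmetric:
  fixes g :: "real \<Rightarrow> real"
  shows "integral {-R..R} (\<lambda>x. g (-x)) = integral {-R..R} g"
  using Henstock_Kurzweil_Integration.integral_reflect_real[of R "-R" g] by simp

lemma tendsto_zero_at_bot_of_integral_bound:
  fixes w :: "real \<Rightarrow> real"
  assumes d: "\<And>x. (w has_real_derivative w' x) (at x)" and B: "\<And>x. \<bar>w' x\<bar> \<le> B"
    and I: "\<And>R. 0 \<le> R \<Longrightarrow> integral {-R..R} (\<lambda>x. (w x)\<^sup>2) \<le> I"
  shows "(w \<longlongrightarrow> 0) at_bot"
proof -
  have "((\<lambda>x. w (- x)) \<longlongrightarrow> 0) at_top"
  proof (rule tendsto_zero_at_top_of_integral_bound[where w' = "\<lambda>x. - w' (-x)"])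
    show "((\<lambda>x. w (- x)) has_real_derivative - w' (- x)) (at x)" for x
      using DERIV_chain2[OF d DERIV_minus[OF DERIV_ident]] by simp
    show "integral {-R..R} (\<lambda>x. (w (-x))\<^sup>2) \<le> I" if "0 \<le> R" for R
      using I[OF that] integral_reflect_symmetric[of R "\<lambda>x. (w x)\<^sup>2"] by simp
  qed (use B in auto)
  then show ?thesis by (simp add: filterlim_at_bot_mirror)
qed

lemma integral_series:
  fixes f :: "nat \<Rightarrow> real \<Rightarrow> real"
  assumes c: "\<And>n. continuous_on {a..b} (f n)"
    and M: "\<And>n x. x \<in> {a..b} \<Longrightarrow> \<bar>f n x\<bar> \<le> M n" "summable M"
  shows "(\<lambda>n. integral {a..b} (f n)) sums integral {a..b} (\<lambda>x. \<Sum>n. f n x)"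
proof -
  have u: "uniform_limit {a..b} (\<lambda>n x. \<Sum>i<n. f i x) (\<lambda>x. \<Sum>i. f i x) sequentially"
    by (rule Weierstrass_m_test[OF _ M(2)]) (use M in auto)
  obtain I J where IJ: "\<And>n. ((\<lambda>x. \<Sum>i<n. f i x) has_integral I n) {a..b}"
    "((\<lambda>x. \<Sum>n. f n x) has_integral J) {a..b}" "I \<longlonglongrightarrow> J"
    by (rule uniform_limit_integral[OF u]) (auto intro!: continuous_intros c)
  have "I = (\<lambda>n. \<Sum>i<n. integral {a..b} (f i))"
  proof
    fix n show "I n = (\<Sum>i<n. integral {a..b} (f i))"
      using integral_unique[OF IJ(1)[of n]]
      by (subst (asm) integral_sum) (auto intro!: integrable_continuous_interval c)
  qed
  then show ?thesis using IJ(2,3) unfolding sums_def by (simp add: integral_unique)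
qed

text \<open>
  Monotone convergence over the intervals \<open>[-i, i]\<close>. It lets all estimates below be made on compact intervals.
\<close>
lemma integrable_of_integral_bound:
  fixes w :: "real \<Rightarrow> real"
  assumes c: "continuous_on UNIV w" and nn: "\<And>x. 0 \<le> w x"
    and I: "\<And>R. 0 \<le> R \<Longrightarrow> integral {-R..R} w \<le> I"
  shows "integrable lborel w" "(LBINT x. w x) \<le> I"
proof -
  let ?f = "\<lambda>i::nat. \<lambda>x. indicator {-real i..real i} x * w x"
  have int: "integrable lborel (?f i)" for i
    using borel_integrable_compact[of "{-real i..real i}" w] continuous_on_subset[OF c] by simp
  have val: "(LBINT x. ?f i x) = integral {-real i..real i} w" for i
    using set_borel_integral_eq_integral(2)[of "{-real i..real i}" w] int[of i]
    by (simp add: set_integrable_def set_lebesgue_integral_def)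
  have mono: "mono (\<lambda>i. ?f i x)" for x
    by (auto simp: mono_def indicator_def nn)
  have "incseq (\<lambda>i. LBINT x. ?f i x)"
    by (auto simp: incseq_def intro!: integral_mono int mono[THEN monoD])
  then obtain l where l: "(\<lambda>i. LBINT x. ?f i x) \<longlonglongrightarrow> l"
    using incseq_convergent[of "\<lambda>i. LBINT x. ?f i x" I] I val by (metis of_nat_0_le_iff)
  have conv: "(\<lambda>i. ?f i x) \<longlonglongrightarrow> w x" for x
  proof (rule tendsto_eventually)
    obtain k where "\<bar>x\<bar> \<le> real k" using real_arch_simple by blast
    then have "?f i x = w x" if "i \<ge> k" for i
    proof -
      have "\<bar>x\<bar> \<le> real i" using that \<open>\<bar>x\<bar> \<le> real k\<close> by linarith
      then have "x \<in> {-real i..real i}" by auto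
      then show ?thesis by simp
    qed
    then show "\<forall>\<^sub>F i in sequentially. ?f i x = w x"
      unfolding eventually_sequentially by blast
  qed
  have m: "w \<in> borel_measurable lborel"
    using borel_measurable_continuous_onI[OF c] by simp
  have "has_bochner_integral lborel w l"
    by (rule has_bochner_integral_monotone_convergence[OF int _ _ l m]) (use mono conv in auto)
  moreover have "l \<le> I"
    by (rule LIMSEQ_le_const2[OF l]) (use val I in auto)
  ultimately show "integrable lborel w" and "(LBINT x. w x) \<le> I"
    by (auto simp: has_bochner_integral_iff)
qed

lemma LBINT_eq_integral_of_support:
  fixes w :: "real \<Rightarrow> real"
  assumes c: "continuous_on UNIV w" and z: "\<And>x. x \<notin> {a..b} \<Longrightarrow> w x = 0"
  shows "(LBINT x. w x) = integral {a..b} w" "integrable lborel w"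
proof -
  have eq: "(\<lambda>x. indicator {a..b} x * w x) = w"
    using z by (auto simp: indicator_def fun_eq_iff)
  have int: "integrable lborel (\<lambda>x. indicator {a..b} x * w x)"
    using borel_integrable_compact[of "{a..b}" w] continuous_on_subset[OF c] by simp
  then show "(LBINT x. w x) = integral {a..b} w" "integrable lborel w"
    using set_borel_integral_eq_integral(2)[of "{a..b}" w]
    by (simp_all add: set_integrable_def set_lebesgue_integral_def eq)
qed

lemma locally_integrable_continuous:
  "continuous_on UNIV v \<Longrightarrow> locally_integrable v"
  unfolding locally_integrable_def set_integrable_def
  using borel_integrable_compact continuous_on_subset by blast

text \<open>
  Integration by parts on an interval containing the support of the test function.
\<close>
lemma has_weak_deriv_of_C1:
  assumes d: "\<And>x. (v has_real_derivative g x) (at x)" and cg: "continuous_on UNIV g"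
  shows "has_weak_deriv v g"
  unfolding has_weak_deriv_def
proof (intro conjI allI impI)
  have cv: "continuous_on UNIV v" by (rule DERIV_imp_continuous[OF d])
  then show "locally_integrable v" "locally_integrable g"
    using cg locally_integrable_continuous by auto
  fix \<phi> assume t: "test_function \<phi>"
  have "\<And>x. (deriv ^^ 0) \<phi> differentiable (at x)" "\<And>x. (deriv ^^ 1) \<phi> differentiable (at x)"
    using t unfolding test_function_def by blast+
  then have d1: "\<phi> differentiable (at x)" and d2: "deriv \<phi> differentiable (at x)" for x by auto
  have dp: "(\<phi> has_real_derivative deriv \<phi> x) (at x)" for x
    using d1 DERIV_deriv_iff_real_differentiable by blast
  have cp: "continuous_on UNIV \<phi>" by (rule DERIV_imp_continuous[OF dp])
  have cdp: "continuous_on UNIV (deriv \<phi>)"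
    using d2 by (meson continuous_at_imp_continuous_on differentiable_imp_continuous_within)
  let ?K = "closure {x. \<phi> x \<noteq> 0}"
  have "bounded ?K" using t unfolding test_function_def by (blast intro: compact_imp_bounded)
  then obtain r where r: "\<And>x. x \<in> ?K \<Longrightarrow> \<bar>x\<bar> \<le> r" unfolding bounded_iff by auto
  define R where "R = max r 0 + 1"
  have z: "\<phi> x = 0" if "\<bar>x\<bar> > r" for x
    using r[of x] that closure_subset[of "{x. \<phi> x \<noteq> 0}"] by fastforce
  have zd: "deriv \<phi> x = 0" if "\<bar>x\<bar> > r" for x
  proof -
    have "(\<phi> has_real_derivative 0) (at x)"
    proof (rule has_field_derivative_transform_within_open[of "\<lambda>_. 0"])
      show "open {x. r < \<bar>x\<bar>}" by (intro open_Collect_less continuous_intros)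
    qed (use that z in auto)
    then show ?thesis by (rule DERIV_imp_deriv)
  qed
  have out: "\<bar>x\<bar> > r" if "x \<notin> {-R..R}" for x using that by (auto simp: R_def)
  have 1: "(LBINT x. v x * deriv \<phi> x) = integral {-R..R} (\<lambda>x. v x * deriv \<phi> x)"
    by (rule LBINT_eq_integral_of_support) (auto intro!: continuous_intros cv cdp simp: zd out)
  have 2: "(LBINT x. g x * \<phi> x) = integral {-R..R} (\<lambda>x. g x * \<phi> x)"
    by (rule LBINT_eq_integral_of_support) (auto intro!: continuous_intros cg cp simp: z out)
  have "((\<lambda>x. v x * deriv \<phi> x + g x * \<phi> x) has_integral (v R * \<phi> R - v (-R) * \<phi> (-R))) {-R..R}"
    by (rule has_integral_derivative)
       (auto simp: R_def intro!: derivative_eq_intros d dp)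
  moreover have "\<phi> R = 0" "\<phi> (-R) = 0" by (rule z, simp add: R_def)+
  ultimately have "integral {-R..R} (\<lambda>x. v x * deriv \<phi> x + g x * \<phi> x) = 0"
    by (simp add: integral_unique)
  moreover have "integral {-R..R} (\<lambda>x. v x * deriv \<phi> x + g x * \<phi> x) =
      integral {-R..R} (\<lambda>x. v x * deriv \<phi> x) + integral {-R..R} (\<lambda>x. g x * \<phi> x)"
    by (rule integral_add) (intro integrable_on_interval continuous_intros cv cdp cg cp)+
  ultimately show "(LBINT x. v x * deriv \<phi> x) = - (LBINT x. g x * \<phi> x)" using 1 2 by simp
qed

section \<open>The nonlocal operator\<close>

definition second_diff :: "nat \<Rightarrow> (real \<Rightarrow> real) \<Rightarrow> real \<Rightarrow> real" where
  "second_diff n u z = u (z + real n) + u (z - real n) - 2 * u z"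

text \<open>
  The coupling, folded to nonnegative indices by its symmetry. The zero sum of the coefficients
  is built into the second differences.
\<close>
definition nonlocal :: "(nat \<Rightarrow> real) \<Rightarrow> (real \<Rightarrow> real) \<Rightarrow> real \<Rightarrow> real" where
  "nonlocal b u z = (\<Sum>n. b n * second_diff n u z)"

lemma has_sum_int_split:
  fixes g :: "int \<Rightarrow> real"
  assumes p: "summable (\<lambda>n. \<bar>g (int (Suc n))\<bar>)" and m: "summable (\<lambda>n. \<bar>g (- int (Suc n))\<bar>)"
  shows "(g has_sum (g 0 + (\<Sum>n. g (int (Suc n)) + g (- int (Suc n))))) UNIV"
proof -
  let ?P = "range (\<lambda>n. int (Suc n))" and ?M = "range (\<lambda>n. - int (Suc n))"
  have "((\<lambda>n. g (int (Suc n))) has_sum (\<Sum>n. g (int (Suc n)))) UNIV"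
    by (rule norm_summable_imp_has_sum[OF _ summable_sums[OF summable_rabs_cancel[OF p]]]) (use p in simp)
  then have 1: "(g has_sum (\<Sum>n. g (int (Suc n)))) ?P"
    by (subst has_sum_reindex) (auto simp: o_def inj_on_def)
  have "((\<lambda>n. g (- int (Suc n))) has_sum (\<Sum>n. g (- int (Suc n)))) UNIV"
    by (rule norm_summable_imp_has_sum[OF _ summable_sums[OF summable_rabs_cancel[OF m]]]) (use m in simp)
  then have 2: "(g has_sum (\<Sum>n. g (- int (Suc n)))) ?M"
    by (subst has_sum_reindex) (auto simp: o_def inj_on_def)
  have 3: "(g has_sum (g 0)) {0}" using has_sum_finite[of "{0}" g] by simp
  have "(g has_sum (g 0 + ((\<Sum>n. g (int (Suc n))) + (\<Sum>n. g (- int (Suc n)))))) ({0} \<union> (?P \<union> ?M))"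
    by (intro has_sum_Un_disjoint 1 2 3) auto
  moreover have "k \<in> {0} \<union> (?P \<union> ?M)" for k :: int
  proof -
    have "k = 0 \<or> k = int (Suc (nat (k - 1))) \<or> k = - int (Suc (nat (- k - 1)))" by auto
    then show ?thesis by blast
  qed
  then have "{0} \<union> (?P \<union> ?M) = UNIV" by auto
  ultimately show ?thesis
    using suminf_add[OF summable_rabs_cancel[OF p] summable_rabs_cancel[OF m]] by simp
qed

context
  fixes a :: "int \<Rightarrow> real"
  assumes coeffs: "coupling_coeffs a"
begin

lemma coupling_second_moment: "summable (\<lambda>n. \<bar>a (int n)\<bar> * (real n)\<^sup>2)"
proof -
  have "(\<lambda>k. \<bar>a k\<bar> * (real_of_int k)\<^sup>2) summable_on {1..}"
    using coeffs by (simp add: coupling_coeffs_def)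
  moreover have "{1..} = range (\<lambda>n. int (Suc n))"
  proof -
    have "k \<in> range (\<lambda>n. int (Suc n))" if "1 \<le> k" for k :: int
      using that by (intro image_eqI[of _ _ "nat (k - 1)"]) auto
    then show ?thesis by auto
  qed
  ultimately have "(\<lambda>n. \<bar>a (int (Suc n))\<bar> * (real (Suc n))\<^sup>2) summable_on UNIV"
    by (simp add: summable_on_reindex o_def inj_on_def del: of_nat_Suc)
  then have "summable (\<lambda>n. \<bar>a (int (Suc n))\<bar> * (real (Suc n))\<^sup>2)"
    by (rule summable_on_imp_summable)
  then show ?thesis by (subst (asm) summable_Suc_iff)
qed

lemma coupling_first_moment: "summable (\<lambda>n. \<bar>a (int n)\<bar> * real n)"
proof (rule summable_comparison_test'[OF coupling_second_moment, of 0])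
  fix n :: nat
  have "real n \<le> (real n)\<^sup>2" by (cases n) (auto simp: power2_eq_square)
  then show "norm (\<bar>a (int n)\<bar> * real n) \<le> \<bar>a (int n)\<bar> * (real n)\<^sup>2"
    by (simp add: mult_left_mono)
qed

lemma coupling_summable: "summable (\<lambda>n. \<bar>a (int n)\<bar>)"
proof (rule summable_comparison_test'[OF coupling_first_moment, of 1])
  fix n :: nat assume "1 \<le> n"
  then show "norm \<bar>a (int n)\<bar> \<le> \<bar>a (int n)\<bar> * real n"
    using mult_left_mono[of 1 "real n" "\<bar>a (int n)\<bar>"] by simp
qed

text \<open>
  The coefficient \<open>a 0\<close> equals minus twice the sum of the others; this is what completes each pair of shifts to a second difference.
\<close>
lemma coupling_has_sum_nonlocal:
  assumes U: "\<And>x. \<bar>u x\<bar> \<le> U"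
  shows "((\<lambda>k. a k * u (z - of_int k)) has_sum nonlocal (\<lambda>n. a (int n)) u z) UNIV"
proof -
  have sym: "a (- k) = a k" for k using coeffs by (simp add: coupling_coeffs_def)
  have s: "summable (\<lambda>n. \<bar>a (int (Suc n))\<bar>)"
    using coupling_summable by (subst summable_Suc_iff)
  then have s': "summable (\<lambda>n. a (int (Suc n)))" by (rule summable_rabs_cancel)
  have "(a has_sum (a 0 + (\<Sum>n. a (int (Suc n)) + a (- int (Suc n))))) UNIV"
    by (rule has_sum_int_split) (use s sym in \<open>simp_all del: of_nat_Suc\<close>)
  then have "a 0 + (\<Sum>n. a (int (Suc n)) + a (- int (Suc n))) = 0"
    using coeffs unfolding coupling_coeffs_def by (blast intro: has_sum_unique)
  then have a0: "a 0 = - (2 * (\<Sum>n. a (int (Suc n))))"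
    unfolding sym using suminf_mult[OF s', of 2] by simp
  have U0: "0 \<le> U" using U[of 0] by linarith
  have dom: "summable (\<lambda>n. \<bar>a (int (Suc n)) * w n\<bar>)" if "\<And>n. \<bar>w n\<bar> \<le> U" for w
    by (rule summable_comparison_test'[OF summable_mult2[OF s, of U], of 0])
       (auto simp: abs_mult intro!: mult_left_mono that)
  let ?g = "\<lambda>k. a k * u (z - of_int k)"
  let ?h = "\<lambda>n. a (int (Suc n)) * u (z - real (Suc n)) + a (int (Suc n)) * u (z + real (Suc n))"
  have d1: "summable (\<lambda>n. a (int (Suc n)) * u (z - real (Suc n)))"
    and d2: "summable (\<lambda>n. a (int (Suc n)) * u (z + real (Suc n)))"
    by (rule summable_rabs_cancel, rule dom, rule U)+
  have "summable (\<lambda>n. \<bar>?g (int (Suc n))\<bar>)" "summable (\<lambda>n. \<bar>?g (- int (Suc n))\<bar>)"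
    unfolding sym by (rule dom, rule U)+
  then have "(?g has_sum (?g 0 + (\<Sum>n. ?g (int (Suc n)) + ?g (- int (Suc n))))) UNIV"
    using has_sum_int_split[of ?g] by blast
  also have "(\<lambda>n. ?g (int (Suc n)) + ?g (- int (Suc n))) = ?h"
    by (subst sym) (simp add: fun_eq_iff algebra_simps)
  also have "?g 0 + (\<Sum>n. ?h n) = (\<Sum>n. ?h n + - 2 * u z * a (int (Suc n)))"
    using suminf_add[OF summable_add[OF d1 d2] summable_mult[OF s', of "- 2 * u z"]]
      suminf_mult[OF s', of "- 2 * u z"] by (simp add: a0 ac_simps del: of_nat_Suc)
  also have "\<dots> = (\<Sum>n. a (int (Suc n)) * second_diff (Suc n) u z)"
    by (intro suminf_cong) (simp add: second_diff_def algebra_simps)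
  also have "\<dots> = nonlocal (\<lambda>n. a (int n)) u z"
    unfolding nonlocal_def
  proof (subst suminf_split_head)
    have "summable (\<lambda>n. ?h n + - 2 * u z * a (int (Suc n)))"
      by (intro summable_add d1 d2 summable_mult s')
    also have "(\<lambda>n. ?h n + - 2 * u z * a (int (Suc n))) = (\<lambda>n. a (int (Suc n)) * second_diff (Suc n) u z)"
      by (simp add: second_diff_def algebra_simps)
    finally show "summable (\<lambda>n. a (int n) * second_diff n u z)"
      by (subst (asm) summable_Suc_iff)
  qed (simp add: second_diff_def)
  finally show ?thesis .
qed

end

lemma second_diff_add: "second_diff n (\<lambda>x. u x + v x) z = second_diff n u z + second_diff n v z"
  by (simp add: second_diff_def)

lemma abs_second_diff_le:
  assumes "\<And>x. \<bar>u x\<bar> \<le> U"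
  shows "\<bar>second_diff n u z\<bar> \<le> 4 * U"
  using assms[of "z + real n"] assms[of "z - real n"] assms[of z] by (simp add: second_diff_def)

lemma abs_mult_second_diff_le:
  assumes "\<And>x. \<bar>u x\<bar> \<le> U"
  shows "\<bar>c * second_diff n u z\<bar> \<le> \<bar>c\<bar> * (4 * U)"
  unfolding abs_mult by (rule mult_left_mono[OF abs_second_diff_le[OF assms]]) simp_all

lemma continuous_second_diff:
  assumes "continuous_on UNIV u" shows "continuous_on A (second_diff n u)"
  unfolding second_diff_def[abs_def]
  by (intro continuous_intros continuous_on_compose2[OF assms]) auto

context
  fixes b :: "nat \<Rightarrow> real"
  assumes b: "summable (\<lambda>n. \<bar>b n\<bar>)"
begin

lemma summable_nonlocal:
  assumes "\<And>x. \<bar>u x\<bar> \<le> U"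
  shows "summable (\<lambda>n. \<bar>b n * second_diff n u z\<bar>)"
  by (rule summable_comparison_test'[OF summable_mult2[OF b, of "4 * U"], of 0])
     (unfold real_norm_def abs_idempotent, rule abs_mult_second_diff_le[OF assms])

lemma nonlocal_add:
  assumes "\<And>x. \<bar>u x\<bar> \<le> U" "\<And>x. \<bar>v x\<bar> \<le> V"
  shows "nonlocal b (\<lambda>x. u x + v x) z = nonlocal b u z + nonlocal b v z"
  unfolding nonlocal_def second_diff_add ring_distribs
  by (rule suminf_add[symmetric])
     (rule summable_rabs_cancel, rule summable_nonlocal, rule assms)+

lemma abs_nonlocal_le:
  assumes "\<And>x. \<bar>u x\<bar> \<le> U"
  shows "\<bar>nonlocal b u z\<bar> \<le> 4 * (\<Sum>n. \<bar>b n\<bar>) * U"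
proof -
  have "\<bar>nonlocal b u z\<bar> \<le> (\<Sum>n. \<bar>b n * second_diff n u z\<bar>)"
    unfolding nonlocal_def by (rule summable_rabs[OF summable_nonlocal[OF assms]])
  also have "\<dots> \<le> (\<Sum>n. \<bar>b n\<bar> * (4 * U))"
    by (intro suminf_le summable_nonlocal[OF assms] summable_mult2 b)
       (rule abs_mult_second_diff_le[OF assms])
  also have "\<dots> = 4 * (\<Sum>n. \<bar>b n\<bar>) * U"
    using suminf_mult2[OF b, of "4 * U"] by simp
  finally show ?thesis .
qed

lemma continuous_nonlocal:
  assumes "\<And>x. \<bar>u x\<bar> \<le> U" "continuous_on UNIV u"
  shows "continuous_on UNIV (nonlocal b u)"
proof -
  have "uniform_limit UNIV (\<lambda>n x. \<Sum>i<n. b i * second_diff i u x) (\<lambda>x. \<Sum>i. b i * second_diff i u x) sequentially"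
    by (rule Weierstrass_m_test[OF _ summable_mult2[OF b, of "4 * U"]])
       (unfold real_norm_def, rule abs_mult_second_diff_le[OF assms(1)])
  then have "continuous_on UNIV (\<lambda>x. \<Sum>i. b i * second_diff i u x)"
    by (rule uniform_limit_theorem[rotated])
       (simp, intro always_eventually allI continuous_intros continuous_second_diff assms(2))
  then show ?thesis unfolding nonlocal_def[abs_def] .
qed

lemma integral_abs_nonlocal_le:
  assumes U: "\<And>x. \<bar>u x\<bar> \<le> U" and cu: "continuous_on UNIV u"
    and c: "\<And>n. integral {-R..R} (\<lambda>z. \<bar>second_diff n u z\<bar>) \<le> c n"
    and s: "summable (\<lambda>n. \<bar>b n\<bar> * c n)"
  shows "integral {-R..R} (\<lambda>z. \<bar>nonlocal b u z\<bar>) \<le> (\<Sum>n. \<bar>b n\<bar> * c n)"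
proof -
  have m: "\<bar>\<bar>b n * second_diff n u x\<bar>\<bar> \<le> \<bar>b n\<bar> * (4 * U)" for n x
    unfolding abs_idempotent by (rule abs_mult_second_diff_le[OF U])
  have int: "(\<lambda>n. integral {-R..R} (\<lambda>z. \<bar>b n * second_diff n u z\<bar>)) sums
      integral {-R..R} (\<lambda>z. \<Sum>n. \<bar>b n * second_diff n u z\<bar>)"
    by (rule integral_series[OF _ m summable_mult2[OF b]])
       (intro continuous_intros continuous_second_diff cu)
  have cs: "continuous_on UNIV (\<lambda>z. \<Sum>n. \<bar>b n * second_diff n u z\<bar>)"
  proof (rule uniform_limit_theorem[rotated])
    show "uniform_limit UNIV (\<lambda>n z. \<Sum>i<n. \<bar>b i * second_diff i u z\<bar>)
        (\<lambda>z. \<Sum>n. \<bar>b n * second_diff n u z\<bar>) sequentially"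
      by (rule Weierstrass_m_test[OF _ summable_mult2[OF b, of "4 * U"]]) (unfold real_norm_def, rule m)
  qed (simp, intro always_eventually allI continuous_intros continuous_second_diff cu)
  have "integral {-R..R} (\<lambda>z. \<bar>nonlocal b u z\<bar>) \<le> integral {-R..R} (\<lambda>z. \<Sum>n. \<bar>b n * second_diff n u z\<bar>)"
  proof (rule integral_le)
    show "\<bar>nonlocal b u z\<bar> \<le> (\<Sum>n. \<bar>b n * second_diff n u z\<bar>)" for z
      unfolding nonlocal_def by (rule summable_rabs[OF summable_nonlocal[OF U]])
  qed (intro integrable_on_interval continuous_intros continuous_nonlocal[OF U cu] cs)+
  also have "\<dots> = (\<Sum>n. integral {-R..R} (\<lambda>z. \<bar>b n * second_diff n u z\<bar>))"
    using int by (simp add: sums_iff)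
  also have "\<dots> \<le> (\<Sum>n. \<bar>b n\<bar> * c n)"
  proof (rule suminf_le[OF _ sums_summable[OF int] s])
    fix n show "integral {-R..R} (\<lambda>z. \<bar>b n * second_diff n u z\<bar>) \<le> \<bar>b n\<bar> * c n"
      using mult_left_mono[OF c, of "\<bar>b n\<bar>"] by (simp add: abs_mult)
  qed
  finally show ?thesis .
qed

end

lemma integral_shift:
  fixes v :: "real \<Rightarrow> real"
  assumes "continuous_on UNIV v" "a \<le> b"
  shows "integral {a..b} (\<lambda>z. v (z + h)) = primitive v (b + h) - primitive v (a + h)"
  by (rule integral_unique, rule has_integral_derivative[OF assms(2)])
     (auto intro!: derivative_eq_intros assms)

lemma integral_abs_second_diff_le:
  assumes cv: "continuous_on UNIV v" and r: "\<And>R. 0 \<le> R \<Longrightarrow> integral {-R..R} (\<lambda>z. \<bar>v z\<bar>) \<le> r"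
    and R: "0 \<le> R"
  shows "integral {-R..R} (\<lambda>z. \<bar>second_diff n v z\<bar>) \<le> 4 * r"
proof -
  let ?w = "\<lambda>z. \<bar>v z\<bar>" and ?P = "primitive (\<lambda>z. \<bar>v z\<bar>)"
  have cw: "continuous_on UNIV ?w" by (intro continuous_intros cv)
  have cs: "continuous_on UNIV (\<lambda>z. ?w (z + h))" for h
    by (rule continuous_on_compose2[OF cw]) (auto intro: continuous_intros)
  have mono: "?P x \<le> ?P y" if "x \<le> y" for x y
    by (rule primitive_mono_nonneg[OF cw _ that]) simp
  have shift: "integral {-R..R} (\<lambda>z. ?w (z + h)) \<le> r" for h
  proof -
    have "integral {-R..R} (\<lambda>z. ?w (z + h)) = ?P (R + h) - ?P (- R + h)"
      using integral_shift[OF cw, of "-R" R h] R by simp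
    also have "\<dots> \<le> ?P (R + \<bar>h\<bar>) - ?P (- (R + \<bar>h\<bar>))"
      by (intro diff_mono mono) auto
    also have "\<dots> = integral {-(R + \<bar>h\<bar>)..R + \<bar>h\<bar>} ?w"
      by (subst integral_eq_primitive_diff[OF cw]) (use R in auto)
    also have "\<dots> \<le> r" by (rule r) (use R in simp)
    finally show ?thesis .
  qed
  have "integral {-R..R} (\<lambda>z. \<bar>second_diff n v z\<bar>) \<le>
      integral {-R..R} (\<lambda>z. ?w (z + real n) + ?w (z + - real n) + 2 * ?w (z + 0))"
  proof (rule integral_le)
    show "\<bar>second_diff n v z\<bar> \<le> ?w (z + real n) + ?w (z + - real n) + 2 * ?w (z + 0)" for z
      by (simp add: second_diff_def)
  qed (intro integrable_on_interval continuous_intros continuous_second_diff cv cs)+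
  also have "\<dots> = integral {-R..R} (\<lambda>z. ?w (z + real n)) + integral {-R..R} (\<lambda>z. ?w (z + - real n))
      + 2 * integral {-R..R} (\<lambda>z. ?w (z + 0))"
    by (subst integral_add integral_mult_right; (intro integrable_on_interval continuous_intros cs)?)+
       (rule refl)
  also have "\<dots> \<le> r + r + 2 * r"
    by (intro add_mono mult_left_mono shift) auto
  finally show ?thesis by simp
qed

text \<open>
  The second difference of a nondecreasing function is dominated by \<open>u(z + n) - u(z - n)\<close>, and the
  integral of this difference telescopes into integrals over two windows of length \<open>2 n\<close>. This makes the
  forcing by the front integrable although the front itself is not.
\<close>
lemma integral_abs_second_diff_monotone_le:
  assumes cu: "continuous_on UNIV u" and mono: "\<And>x y. x \<le> y \<Longrightarrow> u x \<le> u y"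
    and u01: "\<And>x. 0 \<le> u x" "\<And>x. u x \<le> 1" and R: "0 \<le> R"
  shows "integral {-R..R} (\<lambda>z. \<bar>second_diff n u z\<bar>) \<le> 2 * real n"
proof -
  have cs: "continuous_on UNIV (\<lambda>z. u (z + h))" for h
    by (rule continuous_on_compose2[OF cu]) (auto intro: continuous_intros)
  have "integral {-R..R} (\<lambda>z. \<bar>second_diff n u z\<bar>) \<le>
      integral {-R..R} (\<lambda>z. u (z + real n) - u (z + - real n))"
  proof (rule integral_le)
    show "\<bar>second_diff n u z\<bar> \<le> u (z + real n) - u (z + - real n)" for z
      using mono[of z "z + real n"] mono[of "z - real n" z] by (simp add: second_diff_def)
  qed (intro integrable_on_interval continuous_intros continuous_second_diff cu cs)+
  also have "\<dots> = integral {-R..R} (\<lambda>z. u (z + real n)) - integral {-R..R} (\<lambda>z. u (z + - real n))"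
    by (rule integral_diff) (intro integrable_on_interval cs)+
  also have "\<dots> = (primitive u (R + real n) - primitive u (R - real n))
      - (primitive u (- R + real n) - primitive u (- R - real n))"
    using R integral_shift[OF cu, of "-R" R "real n"] integral_shift[OF cu, of "-R" R "- real n"] by simp
  also have "\<dots> \<le> 2 * real n - 0"
  proof (rule diff_mono)
    have "primitive u (R + real n) - (R + real n) \<le> primitive u (R - real n) - (R - real n)"
      by (rule DERIV_nonpos_imp_nonincreasing[of "R - real n" "R + real n" "\<lambda>x. primitive u x - x"])
         (use DERIV_diff[OF DERIV_primitive[OF cu] DERIV_ident] u01(2) in \<open>auto simp: le_diff_eq intro!: exI\<close>)
    then show "primitive u (R + real n) - primitive u (R - real n) \<le> 2 * real n" by simp
    show "0 \<le> primitive u (- R + real n) - primitive u (- R - real n)"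
      using primitive_mono_nonneg[OF cu u01(1), of "- R - real n" "- R + real n"] by simp
  qed
  finally show ?thesis by simp
qed

section \<open>The heteroclinic profile\<close>

text \<open>
  Turns estimates near the two ends into constants valid along the whole profile.
\<close>
lemma bounded_above_of_ends:
  fixes g :: "real \<Rightarrow> real"
  assumes c: "continuous_on UNIV g" and t: "\<forall>\<^sub>F x in at_top. g x \<le> B1" and b: "\<forall>\<^sub>F x in at_bot. g x \<le> B2"
  shows "\<exists>B>0. \<forall>x. g x \<le> B"
proof -
  obtain T where T: "\<And>x. x \<ge> T \<Longrightarrow> g x \<le> B1" using t unfolding eventually_at_top_linorder by blast
  obtain S where S: "\<And>x. x \<le> S \<Longrightarrow> g x \<le> B2" using b unfolding eventually_at_bot_linorder by blast
  have "bounded (g ` {S..T})"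
    by (intro compact_imp_bounded compact_continuous_image continuous_on_subset[OF c]) auto
  then obtain B where B: "\<And>x. x \<in> {S..T} \<Longrightarrow> \<bar>g x\<bar> \<le> B"
    unfolding bounded_iff real_norm_def by blast
  have "g x \<le> max B1 (max B2 (max B 1))" for x
    using T[of x] S[of x] B[of x] by (cases "x \<le> S"; cases "x \<ge> T") auto
  moreover have "max B1 (max B2 (max B 1)) > 0" by simp
  ultimately show ?thesis by blast
qed

text \<open>
  If \<open>w\<close> converges, its increments over unit intervals tend to \<open>0\<close>, so the derivative is small at some
  point of every late unit interval.
\<close>
lemma limit_of_square_derivative:
  fixes w :: "real \<Rightarrow> real"
  assumes d: "\<And>x. (w has_real_derivative w' x) (at x)"
    and l: "(w \<longlongrightarrow> L) at_top" and e: "((\<lambda>x. (w' x)\<^sup>2) \<longlongrightarrow> E) at_top"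
  shows "E = 0"
proof (rule ccontr)
  assume "E \<noteq> 0"
  then have E: "\<bar>E\<bar> / 2 > 0" by simp
  have "((\<lambda>x. w (x + 1)) \<longlongrightarrow> L) at_top"
    by (rule filterlim_compose[OF l])
       (auto intro!: filterlim_at_top_mono[OF filterlim_ident])
  from tendsto_diff[OF this l] have "((\<lambda>x. (w (x + 1) - w x)\<^sup>2) \<longlongrightarrow> 0) at_top"
    using tendsto_power[of "\<lambda>x. w (x + 1) - w x" 0 at_top 2] by simp
  then have 1: "\<forall>\<^sub>F x in at_top. (w (x + 1) - w x)\<^sup>2 < \<bar>E\<bar> / 2"
    using E by (rule order_tendstoD(2))
  have 2: "\<forall>\<^sub>F x in at_top. dist ((w' x)\<^sup>2) E < \<bar>E\<bar> / 2"
    using tendstoD[OF e E] .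
  obtain X where X: "\<And>x. x \<ge> X \<Longrightarrow> (w (x + 1) - w x)\<^sup>2 < \<bar>E\<bar> / 2 \<and> dist ((w' x)\<^sup>2) E < \<bar>E\<bar> / 2"
    using eventually_conj[OF 1 2] unfolding eventually_at_top_linorder by blast
  obtain z where z: "X < z" "z < X + 1" "w (X + 1) - w X = (X + 1 - X) * w' z"
    using MVT2[of X "X + 1" w w'] d by auto
  have "(w' z)\<^sup>2 < \<bar>E\<bar> / 2" using X[of X] z by simp
  moreover have "\<bar>(w' z)\<^sup>2 - E\<bar> < \<bar>E\<bar> / 2" using X[of z] z by (simp add: dist_real_def)
  ultimately show False using zero_le_power2[of "w' z"] by linarith
qed

text \<open>
  Near its limit the orbit \<open>w'' = \<gamma>(w)\<close> behaves as for the linear rate \<open>\<gamma>(s) = \<mu> s\<close>. The quantity \<open>p\<^sup>2 - k w\<^sup>2\<close>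
  tends to \<open>0\<close> and is eventually nonincreasing for \<open>k = \<mu> / 2\<close> and nondecreasing for \<open>k = 2 \<mu>\<close>, so its sign is
  known. The lemma serves both ends of the front, with \<open>w = 1 - u\<close> on the right and, after reflection,
  \<open>w = u\<close> on the left.
\<close>
lemma exponential_end:
  fixes w p \<gamma> :: "real \<Rightarrow> real"
  assumes dw: "\<And>x. (w has_real_derivative - p x) (at x)"
    and dp: "\<And>x. (p has_real_derivative - \<gamma> (w x)) (at x)"
    and d\<gamma>: "(\<gamma> has_real_derivative \<mu>) (at 0)" and \<gamma>0: "\<gamma> 0 = 0" and \<mu>: "\<mu> > 0"
    and pos: "\<And>x. w x > 0" "\<And>x. p x > 0"
    and lim: "(w \<longlongrightarrow> 0) at_top" "(p \<longlongrightarrow> 0) at_top"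
  shows "\<exists>c>0. \<forall>\<^sub>F x in at_top. c * w x \<le> p x \<and> c * p x \<le> \<gamma> (w x)"
proof -
  have "((\<lambda>h. (\<gamma> h - \<gamma> 0) / (h - 0)) \<longlongrightarrow> \<mu>) (at 0)"
    using d\<gamma> by (simp add: has_field_derivative_iff)
  then have "((\<lambda>h. \<gamma> h / h) \<longlongrightarrow> \<mu>) (at 0)" by (simp add: \<gamma>0)
  moreover have "filterlim w (at 0) at_top"
    unfolding filterlim_at using lim(1) pos(1) by (auto simp: less_imp_neq[OF pos(1), symmetric])
  ultimately have "((\<lambda>x. \<gamma> (w x) / w x) \<longlongrightarrow> \<mu>) at_top" by (rule filterlim_compose)
  then have "\<forall>\<^sub>F x in at_top. \<gamma> (w x) / w x > \<mu> / 2 \<and> \<gamma> (w x) / w x < 2 * \<mu>"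
    using \<mu> by (intro eventually_conj order_tendstoD[of "\<lambda>x. \<gamma> (w x) / w x" \<mu> at_top]) auto
  then obtain S where S': "\<And>x. x \<ge> S \<Longrightarrow> \<gamma> (w x) / w x > \<mu> / 2 \<and> \<gamma> (w x) / w x < 2 * \<mu>"
    unfolding eventually_at_top_linorder by blast
  have S: "\<mu> / 2 * w x \<le> \<gamma> (w x)" "\<gamma> (w x) \<le> 2 * \<mu> * w x" if "x \<ge> S" for x
    using S'[OF that] pos(1)[of x] by (auto simp: field_simps)
  have lim2: "((\<lambda>x. (p x)\<^sup>2 - k * (w x)\<^sup>2) \<longlongrightarrow> 0) at_top" for k
    using tendsto_diff[OF tendsto_power[OF lim(2), of 2] tendsto_mult[OF tendsto_const tendsto_power[OF lim(1), of 2], of k]]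
    by simp
  have der: "((\<lambda>x. (p x)\<^sup>2 - k * (w x)\<^sup>2) has_real_derivative 2 * p x * (k * w x - \<gamma> (w x))) (at x)" for k x
    by (rule derivative_eq_intros dw dp refl | simp add: algebra_simps)+
  have lo: "(p x)\<^sup>2 - \<mu> / 2 * (w x)\<^sup>2 \<ge> 0" if x: "x \<ge> S" for x
  proof (rule tendsto_upperbound[OF lim2])
    have "(p y)\<^sup>2 - \<mu> / 2 * (w y)\<^sup>2 \<le> (p x)\<^sup>2 - \<mu> / 2 * (w x)\<^sup>2" if y: "y \<ge> x" for y
    proof (rule DERIV_nonpos_imp_nonincreasing[OF y])
      fix t assume "x \<le> t" "t \<le> y"
      then have "2 * p t * (\<mu> / 2 * w t - \<gamma> (w t)) \<le> 0"
        using S(1)[of t] pos(2)[of t] x by (intro mult_nonneg_nonpos) auto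
      then show "\<exists>z. ((\<lambda>x. (p x)\<^sup>2 - \<mu> / 2 * (w x)\<^sup>2) has_real_derivative z) (at t) \<and> z \<le> 0"
        using der by blast
    qed
    then show "\<forall>\<^sub>F y in at_top. (p y)\<^sup>2 - \<mu> / 2 * (w y)\<^sup>2 \<le> (p x)\<^sup>2 - \<mu> / 2 * (w x)\<^sup>2"
      unfolding eventually_at_top_linorder by blast
  qed simp
  have hi: "(p x)\<^sup>2 - 2 * \<mu> * (w x)\<^sup>2 \<le> 0" if x: "x \<ge> S" for x
  proof (rule tendsto_lowerbound[OF lim2])
    have "(p y)\<^sup>2 - 2 * \<mu> * (w y)\<^sup>2 \<ge> (p x)\<^sup>2 - 2 * \<mu> * (w x)\<^sup>2" if y: "y \<ge> x" for y
    proof (rule DERIV_nonneg_imp_nondecreasing[OF y])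
      fix t assume "x \<le> t" "t \<le> y"
      then have "2 * p t * (2 * \<mu> * w t - \<gamma> (w t)) \<ge> 0"
        using S(2)[of t] pos(2)[of t] x by (intro mult_nonneg_nonneg) auto
      then show "\<exists>z. ((\<lambda>x. (p x)\<^sup>2 - 2 * \<mu> * (w x)\<^sup>2) has_real_derivative z) (at t) \<and> 0 \<le> z"
        using der by blast
    qed
    then show "\<forall>\<^sub>F y in at_top. (p x)\<^sup>2 - 2 * \<mu> * (w x)\<^sup>2 \<le> (p y)\<^sup>2 - 2 * \<mu> * (w y)\<^sup>2"
      unfolding eventually_at_top_linorder by blast
  qed simp
  define a b where "a = sqrt (\<mu> / 2)" and "b = sqrt (2 * \<mu>)"
  have ab: "a > 0" "b > 0" "a\<^sup>2 = \<mu> / 2" "b\<^sup>2 = 2 * \<mu>" using \<mu> by (auto simp: a_def b_def)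
  define c where "c = min a (\<mu> / (2 * b))"
  have c: "c > 0" using ab \<mu> by (simp add: c_def)
  have "c * w x \<le> p x \<and> c * p x \<le> \<gamma> (w x)" if x: "x \<ge> S" for x
  proof
    have "(a * w x)\<^sup>2 \<le> (p x)\<^sup>2" using lo[OF x] unfolding power_mult_distrib ab(3) by simp
    then have "a * w x \<le> p x" using less_imp_le[OF pos(2)] by (rule power2_le_imp_le)
    moreover have "c * w x \<le> a * w x" using pos(1)[of x] by (simp add: c_def mult_right_mono)
    ultimately show "c * w x \<le> p x" by simp
    have "(p x)\<^sup>2 \<le> (b * w x)\<^sup>2" using hi[OF x] unfolding power_mult_distrib ab(4) by simp
    then have "p x \<le> b * w x" by (rule power2_le_imp_le) (use pos(1)[of x] ab in simp)
    then have "\<mu> / (2 * b) * p x \<le> \<mu> / (2 * b) * (b * w x)" using \<mu> ab by (intro mult_left_mono) auto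
    also have "\<dots> = \<mu> / 2 * w x" using ab by simp
    also have "\<dots> \<le> \<gamma> (w x)" by (rule S(1)[OF x])
    finally have "\<mu> / (2 * b) * p x \<le> \<gamma> (w x)" .
    moreover have "c * p x \<le> \<mu> / (2 * b) * p x" using pos(2)[of x] by (intro mult_right_mono) (auto simp: c_def)
    ultimately show "c * p x \<le> \<gamma> (w x)" by simp
  qed
  then show ?thesis using c unfolding eventually_at_top_linorder by blast
qed

lemma potential_eq_primitive: "potential f = primitive f"
  by (simp add: fun_eq_iff potential_def primitive_def)

locale standing_wave =
  fixes f u :: "real \<Rightarrow> real"
  assumes bistable: "bistable_balanced f" and het: "heteroclinic f u"
begin

abbreviation "\<phi> \<equiv> deriv u"

lemma DERIV_f: "(f has_real_derivative deriv f x) (at x)"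
  and DERIV_f': "(deriv f has_real_derivative deriv (deriv f) x) (at x)"
  and continuous_f'': "continuous_on UNIV (deriv (deriv f))"
  using bistable by (auto simp: bistable_balanced_def C2_def DERIV_deriv_iff_real_differentiable)

lemmas continuous_f = DERIV_imp_continuous[OF DERIV_f]
lemmas continuous_f' = DERIV_imp_continuous[OF DERIV_f']

lemma DERIV_u: "(u has_real_derivative \<phi> x) (at x)"
  using het by (auto simp: heteroclinic_def C2_def DERIV_deriv_iff_real_differentiable)

lemma DERIV_\<phi>: "(\<phi> has_real_derivative - f (u x)) (at x)"
proof -
  have "(\<phi> has_real_derivative deriv \<phi> x) (at x)"
    using het by (auto simp: heteroclinic_def C2_def DERIV_deriv_iff_real_differentiable)
  moreover have "deriv \<phi> x + f (u x) = 0" using het by (simp add: heteroclinic_def)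
  then have "deriv \<phi> x = - f (u x)" by linarith
  ultimately show ?thesis by simp
qed

lemmas continuous_u = DERIV_imp_continuous[OF DERIV_u]
lemmas continuous_\<phi> = DERIV_imp_continuous[OF DERIV_\<phi>]

lemma u_at_bot: "(u \<longlongrightarrow> 0) at_bot" and u_at_top: "(u \<longlongrightarrow> 1) at_top"
  using het by (auto simp: heteroclinic_def)

lemma f_zeros: "f 0 = 0" "f 1 = 0" and f'_zeros: "deriv f 0 < 0" "deriv f 1 < 0"
  and F1: "primitive f 1 = 0" and F_ne: "\<And>s. 0 < s \<Longrightarrow> s < 1 \<Longrightarrow> primitive f s \<noteq> 0"
  using bistable by (auto simp: bistable_balanced_def potential_eq_primitive)

lemma F_tendsto: "(primitive f \<longlongrightarrow> primitive f c) (nhds c)"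
  using DERIV_isCont[OF DERIV_primitive[OF continuous_f]] by (simp add: continuous_at tendsto_at_iff_tendsto_nhds)

text \<open>
  The energy is constant; its value follows from the limit at \<open>+\<infinity>\<close>, where \<open>F(u)\<close> tends to \<open>F(1) = 0\<close> and \<open>\<phi>\<close> comes arbitrarily close to \<open>0\<close>.
\<close>
lemma energy: "(\<phi> x)\<^sup>2 = - 2 * primitive f (u x)"
proof -
  let ?E = "\<lambda>x. (\<phi> x)\<^sup>2 + 2 * primitive f (u x)"
  have "(?E has_real_derivative 0) (at x)" for x
    by (rule derivative_eq_intros DERIV_\<phi> DERIV_u continuous_f refl | simp)+
  then have const: "?E x = ?E 0" for x by (intro DERIV_isconst_all) auto
  have "((\<lambda>x. primitive f (u x)) \<longlongrightarrow> 0) at_top"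
    using filterlim_compose[OF F_tendsto u_at_top] F1 by simp
  from tendsto_diff[OF tendsto_const[of "?E 0"] tendsto_mult[OF tendsto_const[of 2] this]]
  have "((\<lambda>x. ?E 0 - 2 * primitive f (u x)) \<longlongrightarrow> ?E 0) at_top" by simp
  moreover have "(\<lambda>x. ?E 0 - 2 * primitive f (u x)) = (\<lambda>x. (\<phi> x)\<^sup>2)"
    using const by (metis add_diff_cancel_right')
  ultimately have "?E 0 = 0"
    using limit_of_square_derivative[OF DERIV_u u_at_top] by simp
  then show ?thesis using const[of x] by simp
qed

lemma u_bounded: "\<exists>U>0. \<forall>x. \<bar>u x\<bar> \<le> U"
proof (rule bounded_above_of_ends)
  show "\<forall>\<^sub>F x in at_top. \<bar>u x\<bar> \<le> 2"
    using order_tendstoD(2)[OF tendsto_rabs[OF u_at_top], of 2] by (auto elim: eventually_mono)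
  show "\<forall>\<^sub>F x in at_bot. \<bar>u x\<bar> \<le> 2"
    using order_tendstoD(2)[OF tendsto_rabs[OF u_at_bot], of 2] by (auto elim: eventually_mono)
qed (intro continuous_intros continuous_u)

lemma f_lipschitz_bounded:
  assumes "0 \<le> U"
  shows "\<exists>L\<ge>0. \<forall>s t. \<bar>s\<bar> \<le> U \<longrightarrow> \<bar>t\<bar> \<le> U \<longrightarrow> \<bar>f s - f t\<bar> \<le> L * \<bar>s - t\<bar>"
proof -
  have "bounded (deriv f ` {-U..U})"
    by (intro compact_imp_bounded compact_continuous_image continuous_on_subset[OF continuous_f']) auto
  then obtain L where L: "\<And>x. x \<in> {-U..U} \<Longrightarrow> \<bar>deriv f x\<bar> \<le> L"
    unfolding bounded_iff real_norm_def by blast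
  have L0: "0 \<le> L" using L[of 0] assms by auto
  have "\<bar>f s - f t\<bar> \<le> L * \<bar>s - t\<bar>" if "\<bar>s\<bar> \<le> U" "\<bar>t\<bar> \<le> U" for s t
    using field_differentiable_bound[of "{-U..U}" f "deriv f" L s t] that L
      has_field_derivative_at_within[OF DERIV_f] by (auto simp: abs_le_iff)
  then show ?thesis using L0 by blast
qed

text \<open>
  An orbit of zero energy that reaches an equilibrium at a finite point has velocity \<open>0\<close> there and so
  stays there. Uniqueness is proved by a Gronwall argument for \<open>\<phi>\<^sup>2 + (u - c)\<^sup>2\<close> in both directions.
\<close>
lemma constant_of_touching:
  assumes c: "f c = 0" "primitive f c = 0" and x0: "u x0 = c"
  shows "u x = c"
proof -
  obtain U where U: "U > 0" "\<And>x. \<bar>u x\<bar> \<le> U" using u_bounded by blast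
  obtain L where L: "L \<ge> 0" "\<And>s t. \<bar>s\<bar> \<le> U \<Longrightarrow> \<bar>t\<bar> \<le> U \<Longrightarrow> \<bar>f s - f t\<bar> \<le> L * \<bar>s - t\<bar>"
    using f_lipschitz_bounded[of U] U by auto
  let ?y = "\<lambda>x. (\<phi> x)\<^sup>2 + (u x - c)\<^sup>2" and ?y' = "\<lambda>x. 2 * \<phi> x * (u x - c - f (u x))"
  let ?K = "L + 1"
  have dy: "(?y has_real_derivative ?y' x) (at x)" for x
    by (rule derivative_eq_intros DERIV_\<phi> DERIV_u refl | simp add: algebra_simps)+
  have bd: "\<bar>?y' x\<bar> \<le> ?K * ?y x" for x
  proof -
    have "\<bar>f (u x)\<bar> \<le> L * \<bar>u x - c\<bar>" using L(2)[of "u x" c] U(2)[of x] U(2)[of x0] x0 c by simp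
    then have "\<bar>u x - c - f (u x)\<bar> \<le> ?K * \<bar>u x - c\<bar>" by (simp add: algebra_simps)
    then have "\<bar>?y' x\<bar> \<le> 2 * \<bar>\<phi> x\<bar> * (?K * \<bar>u x - c\<bar>)"
      unfolding abs_mult by (intro mult_mono) auto
    also have "\<dots> = ?K * (2 * \<bar>\<phi> x\<bar> * \<bar>u x - c\<bar>)" by simp
    also have "\<dots> \<le> ?K * ?y x"
      using L(1) sum_squares_bound[of "\<bar>\<phi> x\<bar>" "\<bar>u x - c\<bar>"] by (intro mult_left_mono) auto
    finally show ?thesis .
  qed
  have y0: "?y x0 = 0" using energy[of x0] x0 c by simp
  have d1: "((\<lambda>x. ?y x * exp (k * x)) has_real_derivative (?y' x + k * ?y x) * exp (k * x)) (at x)" for x k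
    by (rule derivative_eq_intros dy refl | simp add: algebra_simps)+
  have "?y x \<le> 0"
  proof (cases "x \<le> x0")
    case True
    have "?y x * exp (?K * x) \<le> ?y x0 * exp (?K * x0)"
    proof (rule DERIV_nonneg_imp_nondecreasing[OF True])
      fix t
      have "0 \<le> (?y' t + ?K * ?y t) * exp (?K * t)" using bd[of t] by (intro mult_nonneg_nonneg) (auto simp only: abs_le_iff exp_ge_zero)
      then show "\<exists>z. ((\<lambda>x. ?y x * exp (?K * x)) has_real_derivative z) (at t) \<and> 0 \<le> z" using d1 by blast
    qed
    then show ?thesis using y0 by (simp add: mult_le_0_iff)
  next
    case False
    have "?y x * exp ((-?K) * x) \<le> ?y x0 * exp ((-?K) * x0)"
    proof (rule DERIV_nonpos_imp_nonincreasing[of x0 x])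
      fix t
      have "(?y' t + (-?K) * ?y t) * exp ((-?K) * t) \<le> 0" using bd[of t] by (intro mult_nonpos_nonneg) (auto simp only: abs_le_iff exp_ge_zero)
      then show "\<exists>z. ((\<lambda>x. ?y x * exp ((-?K) * x)) has_real_derivative z) (at t) \<and> z \<le> 0" using d1 by blast
    qed (use False in auto)
    then show ?thesis using y0 by (simp add: mult_le_0_iff)
  qed
  then have "(u x - c)\<^sup>2 \<le> 0" using zero_le_power2[of "\<phi> x"] by linarith
  then show ?thesis by simp
qed

lemma u_ne: "u x \<noteq> 0" "u x \<noteq> 1"
proof -
  show "u x \<noteq> 0"
  proof
    assume "u x = 0"
    then have "u = (\<lambda>_. 0)" using constant_of_touching[of 0 x] f_zeros by auto
    then show False using u_at_top tendsto_const_iff[of "at_top :: real filter" "0::real" "1::real"] by simp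
  qed
  show "u x \<noteq> 1"
  proof
    assume "u x = 1"
    then have "u = (\<lambda>_. 1)" using constant_of_touching[of 1 x] f_zeros F1 by auto
    then show False using u_at_bot tendsto_const_iff[of "at_bot :: real filter" "1::real" "0::real"] by simp
  qed
qed

text \<open>
  A nonpositive value would force a zero of \<open>u\<close> further right, since \<open>u\<close> tends to \<open>1\<close>.
\<close>
lemma u_pos: "0 < u x"
proof (rule ccontr)
  assume "\<not> 0 < u x"
  then have 1: "u x \<le> 0" by simp
  have "\<forall>\<^sub>F y in at_top. 0 < u y \<and> x \<le> y"
    using order_tendstoD(1)[OF u_at_top, of 0] eventually_ge_at_top[of x] by (auto intro: eventually_conj)
  then obtain y where "0 < u y" "x \<le> y" using eventually_happens' trivial_limit_at_top_linorder by fast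
  then have "\<exists>z\<ge>x. z \<le> y \<and> u z = 0" using 1
    by (intro IVT') (auto intro: continuous_on_subset[OF continuous_u])
  then show False using u_ne by blast
qed

lemma u_less_1: "u x < 1"
proof (rule ccontr)
  assume "\<not> u x < 1"
  then have 1: "1 \<le> u x" by simp
  have "\<forall>\<^sub>F y in at_bot. u y < 1 \<and> y \<le> x"
    using order_tendstoD(2)[OF u_at_bot, of 1] eventually_le_at_bot[of x] by (auto intro: eventually_conj)
  then obtain y where "u y < 1" "y \<le> x" using eventually_happens' trivial_limit_at_bot_linorder by fast
  then have "\<exists>z\<ge>y. z \<le> x \<and> u z = 1" using 1
    by (intro IVT') (auto intro: continuous_on_subset[OF continuous_u])
  then show False using u_ne by blast
qed

lemma \<phi>_ne: "\<phi> x \<noteq> 0"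
  using energy[of x] F_ne[OF u_pos u_less_1] by auto

lemma \<phi>_pos: "0 < \<phi> x"
proof (rule ccontr)
  assume "\<not> 0 < \<phi> x"
  then have x: "\<phi> x < 0" using \<phi>_ne[of x] by simp
  have neg: "\<phi> y < 0" if "y \<ge> x" for y
  proof (rule ccontr)
    assume "\<not> \<phi> y < 0"
    then have "\<exists>z\<ge>x. z \<le> y \<and> \<phi> z = 0" using x that
      by (intro IVT') (auto intro: continuous_on_subset[OF continuous_\<phi>])
    then show False using \<phi>_ne by blast
  qed
  have "u y \<le> u x" if "y \<ge> x" for y
    by (rule DERIV_nonpos_imp_nonincreasing[OF that]) (use DERIV_u neg in \<open>meson less_imp_le\<close>)
  then have "1 \<le> u x"
    by (intro tendsto_upperbound[OF u_at_top]) (auto simp: eventually_at_top_linorder)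
  then show False using u_less_1[of x] by simp
qed

lemma u_mono: "x \<le> y \<Longrightarrow> u x \<le> u y"
  by (rule DERIV_nonneg_imp_nondecreasing) (use DERIV_u \<phi>_pos in \<open>meson less_imp_le\<close>)+

lemma \<phi>_at_top: "(\<phi> \<longlongrightarrow> 0) at_top" and \<phi>_at_bot: "(\<phi> \<longlongrightarrow> 0) at_bot"
proof -
  have eq: "\<phi> = (\<lambda>x. sqrt (- 2 * primitive f (u x)))"
    using energy \<phi>_pos by (metis less_imp_le real_sqrt_unique)
  have "((\<lambda>x. sqrt (- 2 * primitive f (u x))) \<longlongrightarrow> sqrt (- 2 * primitive f 1)) at_top"
    by (intro tendsto_intros filterlim_compose[OF F_tendsto u_at_top])
  then show "(\<phi> \<longlongrightarrow> 0) at_top" using eq F1 by simp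
  have "((\<lambda>x. sqrt (- 2 * primitive f (u x))) \<longlongrightarrow> sqrt (- 2 * primitive f 0)) at_bot"
    by (intro tendsto_intros filterlim_compose[OF F_tendsto u_at_bot])
  then show "(\<phi> \<longlongrightarrow> 0) at_bot" using eq by simp
qed

lemma profile_right_end:
  "\<exists>c>0. \<forall>\<^sub>F x in at_top. c * (1 - u x) \<le> \<phi> x \<and> c * \<phi> x \<le> f (u x)"
proof -
  have "\<exists>c>0. \<forall>\<^sub>F x in at_top. c * (1 - u x) \<le> \<phi> x \<and> c * \<phi> x \<le> f (1 - (1 - u x))"
  proof (rule exponential_end[where \<gamma> = "\<lambda>s. f (1 - s)" and \<mu> = "- deriv f 1"])
    have "((\<lambda>s::real. 1 - s) has_real_derivative -1) (at 0)"
      by (auto intro!: derivative_eq_intros)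
    from DERIV_chain2[OF _ this, of f "deriv f 1"] show "((\<lambda>s. f (1 - s)) has_real_derivative - deriv f 1) (at 0)"
      using DERIV_f[of 1] by simp
    show "((\<lambda>x. 1 - u x) \<longlongrightarrow> 0) at_top"
      using tendsto_diff[OF tendsto_const[of 1] u_at_top] by simp
  qed (use \<phi>_pos u_less_1 f_zeros f'_zeros \<phi>_at_top DERIV_\<phi> in \<open>auto intro!: derivative_eq_intros DERIV_u\<close>)
  then show ?thesis by simp
qed

lemma profile_left_end:
  "\<exists>c>0. \<forall>\<^sub>F x in at_bot. c * u x \<le> \<phi> x \<and> c * \<phi> x \<le> - f (u x)"
proof -
  have "\<exists>c>0. \<forall>\<^sub>F x in at_top. c * u (- x) \<le> \<phi> (- x) \<and> c * \<phi> (- x) \<le> - f (u (- x))"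
  proof (rule exponential_end[where \<gamma> = "\<lambda>s. - f s" and \<mu> = "- deriv f 0"])
    show "((\<lambda>x. u (- x)) has_real_derivative - \<phi> (- x)) (at x)" for x
      using DERIV_chain2[OF DERIV_u DERIV_minus[OF DERIV_ident]] by simp
    show "((\<lambda>x. \<phi> (- x)) has_real_derivative - (- f (u (- x)))) (at x)" for x
      using DERIV_chain2[OF DERIV_\<phi> DERIV_minus[OF DERIV_ident]] by simp
    show "((\<lambda>s. - f s) has_real_derivative - deriv f 0) (at 0)"
      by (intro DERIV_minus DERIV_f)
    show "((\<lambda>x. u (- x)) \<longlongrightarrow> 0) at_top" "((\<lambda>x. \<phi> (- x)) \<longlongrightarrow> 0) at_top"
      using u_at_bot \<phi>_at_bot by (simp_all add: filterlim_at_bot_mirror)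
  qed (use \<phi>_pos u_pos f_zeros f'_zeros in auto)
  then show ?thesis by (simp add: at_bot_mirror eventually_filtermap)
qed

end

section \<open>Estimates along the profile\<close>

text \<open>
  Where \<open>p' \<le> - c p\<close>, the derivative of \<open>1 / (c p)\<close> is at least \<open>1 / p\<close>. So the primitive of \<open>1 / p\<close> grows no faster
  than \<open>1 / (c p)\<close>, and the factor \<open>p\<close> compensates this growth.
\<close>
lemma weighted_primitive_reciprocal_at_top:
  fixes p :: "real \<Rightarrow> real"
  assumes dp: "\<And>x. (p has_real_derivative p' x) (at x)" and pos: "\<And>x. p x > 0"
    and c: "c > 0" and decay: "\<forall>\<^sub>F x in at_top. c * p x \<le> - p' x" and B: "\<And>x. p x \<le> B"
  shows "\<exists>M. \<forall>\<^sub>F x in at_top. p x * \<bar>primitive (\<lambda>s. 1 / p s) x\<bar> \<le> M"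
proof -
  let ?A = "primitive (\<lambda>s. 1 / p s)"
  obtain S' where S': "\<And>x. x \<ge> S' \<Longrightarrow> c * p x \<le> - p' x"
    using decay unfolding eventually_at_top_linorder by blast
  define S where "S = max S' 0"
  have cont: "continuous_on UNIV (\<lambda>s. 1 / p s)"
    by (intro continuous_intros DERIV_imp_continuous[OF dp]) (use pos in \<open>auto simp: less_imp_neq[OF pos, symmetric]\<close>)
  have mono: "?A x \<le> ?A y" if "x \<le> y" for x y
    by (rule primitive_mono_nonneg[OF cont _ that]) (use pos in \<open>simp add: less_imp_le\<close>)
  have "p x * \<bar>?A x\<bar> \<le> B * ?A S + 1 / c" if x: "x \<ge> S" for x
  proof -
    have "?A x - 1 / (c * p x) \<le> ?A S - 1 / (c * p S)"
    proof (rule DERIV_nonpos_imp_nonincreasing[OF x])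
      fix t assume t: "S \<le> t" "t \<le> x"
      have "((\<lambda>x. ?A x - 1 / (c * p x)) has_real_derivative (c * p t + p' t) / (c * (p t)\<^sup>2)) (at t)"
        by (rule derivative_eq_intros cont dp refl | use c pos[of t] in \<open>simp add: field_simps power2_eq_square\<close>)+
      moreover have "(c * p t + p' t) / (c * (p t)\<^sup>2) \<le> 0"
        using S'[of t] t c by (intro divide_nonpos_nonneg) (auto simp: S_def)
      ultimately show "\<exists>y. ((\<lambda>x. ?A x - 1 / (c * p x)) has_real_derivative y) (at t) \<and> y \<le> 0" by blast
    qed
    moreover have "1 / (c * p S) > 0" using c pos[of S] by simp
    ultimately have "?A x \<le> ?A S + 1 / (c * p x)" by linarith
    moreover have A0: "0 \<le> ?A x" "0 \<le> ?A S" using mono[of 0 x] mono[of 0 S] x by (auto simp: S_def)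
    ultimately have "p x * \<bar>?A x\<bar> \<le> p x * (?A S + 1 / (c * p x))" using pos[of x] by (intro mult_left_mono) auto
    also have "\<dots> = p x * ?A S + 1 / c" using pos[of x] c by (simp add: field_simps)
    also have "\<dots> \<le> B * ?A S + 1 / c" using B[of x] A0 by (simp add: mult_right_mono)
    finally show ?thesis .
  qed
  then show ?thesis unfolding eventually_at_top_linorder by blast
qed

lemma weighted_primitive_reciprocal_bounded:
  fixes p :: "real \<Rightarrow> real"
  assumes dp: "\<And>x. (p has_real_derivative p' x) (at x)" and pos: "\<And>x. p x > 0" and B: "\<And>x. p x \<le> B"
    and c: "c > 0" and right: "\<forall>\<^sub>F x in at_top. c * p x \<le> - p' x"
    and d: "d > 0" and left: "\<forall>\<^sub>F x in at_bot. d * p x \<le> p' x"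
  shows "\<exists>M>0. \<forall>x. p x * \<bar>primitive (\<lambda>s. 1 / p s) x\<bar> \<le> M"
proof -
  have cp: "continuous_on UNIV (\<lambda>s. 1 / p s)"
    by (intro continuous_intros DERIV_imp_continuous[OF dp]) (use pos in \<open>auto simp: less_imp_neq[OF pos, symmetric]\<close>)
  have cm: "continuous_on UNIV (\<lambda>s. 1 / p (- s))"
    by (rule continuous_on_compose2[OF cp]) (auto intro: continuous_intros)
  have dm: "((\<lambda>x. p (- x)) has_real_derivative - p' (- x)) (at x)" for x
    using DERIV_chain2[OF dp DERIV_minus[OF DERIV_ident]] by simp
  have "\<forall>\<^sub>F x in at_top. d * p (- x) \<le> - (- p' (- x))"
    using left by (simp add: at_bot_mirror eventually_filtermap)
  from weighted_primitive_reciprocal_at_top[OF dm pos d this B] obtain M2 where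
    M2: "\<forall>\<^sub>F x in at_top. p (- x) * \<bar>primitive (\<lambda>s. 1 / p (- s)) x\<bar> \<le> M2" by blast
  have "primitive (\<lambda>s. 1 / p (- s)) = (\<lambda>x. - primitive (\<lambda>s. 1 / p s) (- x))"
  proof (rule primitive_unique[OF _ _ cm])
    show "((\<lambda>x. - primitive (\<lambda>s. 1 / p s) (- x)) has_real_derivative 1 / p (- x)) (at x)" for x
      by (rule derivative_eq_intros cp refl | simp)+
  qed simp
  with M2 have "\<forall>\<^sub>F x in at_bot. p x * \<bar>primitive (\<lambda>s. 1 / p s) x\<bar> \<le> M2"
    by (simp add: at_bot_mirror eventually_filtermap)
  moreover obtain M1 where "\<forall>\<^sub>F x in at_top. p x * \<bar>primitive (\<lambda>s. 1 / p s) x\<bar> \<le> M1"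
    using weighted_primitive_reciprocal_at_top[OF dp pos c right B] by blast
  moreover have "continuous_on UNIV (\<lambda>x. p x * \<bar>primitive (\<lambda>s. 1 / p s) x\<bar>)"
    by (intro continuous_intros DERIV_imp_continuous[OF dp] DERIV_imp_continuous[OF DERIV_primitive[OF cp]])
  ultimately show ?thesis using bounded_above_of_ends by blast
qed

text \<open>
  The bound on \<open>\<integral> \<bar>v\<bar>\<close> behind the fixed point argument, for \<open>v'' + q v = h\<close> with \<open>q \<le> - c\<close> up to an
  integrable error \<open>\<psi>\<close>. Testing with the sign of \<open>v\<close> would give \<open>\<integral> - q \<bar>v\<bar> \<le> \<integral> \<bar>h\<bar> + 2 B\<close>, because the term with
  \<open>v'\<close> has a favourable sign. The sign is replaced by \<open>\<eta>(v) = v / sqrt (v\<^sup>2 + \<delta>\<^sup>2)\<close>, which is smooth and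
  nondecreasing and costs an error \<open>c \<delta>\<close> per unit length.
\<close>
lemma integral_abs_le_of_damping:
  fixes v v' q h \<psi> :: "real \<Rightarrow> real"
  assumes dv: "\<And>x. (v has_real_derivative v' x) (at x)"
    and dv': "\<And>x. (v' has_real_derivative h x - q x * v x) (at x)"
    and ch: "continuous_on UNIV h" and cq: "continuous_on UNIV q" and c\<psi>: "continuous_on UNIV \<psi>"
    and A: "\<And>x. \<bar>v x\<bar> \<le> A" and B: "\<And>x. \<bar>v' x\<bar> \<le> B"
    and q: "\<And>x. q x + c \<le> \<psi> x" and \<psi>: "\<And>x. 0 \<le> \<psi> x" and I\<psi>: "integral {-R..R} \<psi> \<le> K"
    and R: "0 \<le> R" and c: "0 \<le> c"
  shows "c * integral {-R..R} (\<lambda>x. \<bar>v x\<bar>) \<le> A * K + 2 * B + integral {-R..R} (\<lambda>x. \<bar>h x\<bar>)"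
proof (rule field_le_epsilon)
  fix e :: real assume e: "0 < e"
  (* The total smoothing error 2 R c \<delta> stays below e; the summand 1 covers c R = 0. *)
  define \<delta> where "\<delta> = e / (2 * c * R + 1)"
  have den: "2 * c * R + 1 > 0" using c R by (simp add: add_nonneg_pos)
  have \<delta>: "\<delta> > 0" using den e by (simp add: \<delta>_def)
  have \<delta>e: "2 * R * (c * \<delta>) \<le> e"
  proof -
    have "2 * R * (c * \<delta>) = e * ((2 * c * R) / (2 * c * R + 1))" by (simp add: \<delta>_def)
    also have "\<dots> \<le> e * 1" using den e by (intro mult_left_mono) auto
    finally show ?thesis by simp
  qed
  define r where "r t = sqrt (t\<^sup>2 + \<delta>\<^sup>2)" for t
  have r: "r t > 0" "\<bar>t\<bar> \<le> r t" "r t \<le> \<bar>t\<bar> + \<delta>" "(r t)\<^sup>2 = t\<^sup>2 + \<delta>\<^sup>2" for t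
  proof -
    show "r t > 0" using \<delta> by (simp add: r_def add_nonneg_pos)
    show "\<bar>t\<bar> \<le> r t" by (simp add: r_def real_le_rsqrt)
    show "r t \<le> \<bar>t\<bar> + \<delta>" unfolding r_def using \<delta> by (intro real_le_lsqrt) (auto simp: power2_sum)
    show "(r t)\<^sup>2 = t\<^sup>2 + \<delta>\<^sup>2" by (simp add: r_def)
  qed
  let ?\<eta> = "\<lambda>t. t / r t"
  have \<eta>1: "\<bar>?\<eta> t\<bar> \<le> 1" for t using r(1,2)[of t] by simp
  have \<eta>t: "\<bar>t\<bar> - \<delta> \<le> t * ?\<eta> t" "t * ?\<eta> t \<le> \<bar>t\<bar>" "0 \<le> t * ?\<eta> t" for t
  proof -
    have "(\<bar>t\<bar> - \<delta>) * r t \<le> t\<^sup>2"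
    proof (cases "\<bar>t\<bar> \<le> \<delta>")
      case True
      then have "(\<bar>t\<bar> - \<delta>) * r t \<le> 0" using r(1)[of t] by (intro mult_nonpos_nonneg) auto
      then show ?thesis using zero_le_power2[of t] by linarith
    next
      case False
      then have "(\<bar>t\<bar> - \<delta>) * r t \<le> (\<bar>t\<bar> - \<delta>) * (\<bar>t\<bar> + \<delta>)" using r(3)[of t] by (intro mult_left_mono) auto
      also have "\<dots> = t\<^sup>2 - \<delta>\<^sup>2" by (simp add: power2_eq_square algebra_simps)
      also have "\<dots> \<le> t\<^sup>2" by simp
      finally show ?thesis .
    qed
    then show "\<bar>t\<bar> - \<delta> \<le> t * ?\<eta> t" using r(1)[of t] by (simp add: field_simps power2_eq_square)
    have "t\<^sup>2 \<le> \<bar>t\<bar> * r t" using mult_left_mono[OF r(2)[of t], of "\<bar>t\<bar>"] by (simp add: power2_eq_square)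
    then show "t * ?\<eta> t \<le> \<bar>t\<bar>" using r(1)[of t] by (simp add: field_simps power2_eq_square)
    show "0 \<le> t * ?\<eta> t" using r(1)[of t] by simp
  qed
  have cv: "continuous_on UNIV v" by (rule DERIV_imp_continuous[OF dv])
  have cv': "continuous_on UNIV v'" by (rule DERIV_imp_continuous[OF dv'])
  have cr: "continuous_on UNIV (\<lambda>x. r (v x))" unfolding r_def by (intro continuous_intros cv)
  have c\<eta>: "continuous_on UNIV (\<lambda>x. v x / r (v x))"
    by (intro continuous_intros cv cr) (use r(1) in \<open>auto simp: less_imp_neq[OF r(1), symmetric]\<close>)
  have dr: "((\<lambda>x. r (v x)) has_real_derivative v x * v' x / r (v x)) (at x)" for x
  proof -
    have "0 < (v x)\<^sup>2 + \<delta>\<^sup>2" using \<delta> by (simp add: add_nonneg_pos)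
    moreover have "((\<lambda>x. (v x)\<^sup>2 + \<delta>\<^sup>2) has_real_derivative 2 * v x * v' x) (at x)"
      by (auto intro!: derivative_eq_intros dv)
    ultimately have *: "((\<lambda>x. sqrt ((v x)\<^sup>2 + \<delta>\<^sup>2)) has_real_derivative
        inverse (sqrt ((v x)\<^sup>2 + \<delta>\<^sup>2)) / 2 * (2 * v x * v' x)) (at x)"
      by (rule DERIV_chain2[OF DERIV_real_sqrt])
    have **: "inverse y / 2 * (2 * v x * v' x) = v x * v' x / y" for y
      by (simp only: inverse_eq_divide) simp
    from * show ?thesis unfolding r_def ** .
  qed
  have d\<eta>: "((\<lambda>x. v x / r (v x)) has_real_derivative v' x * \<delta>\<^sup>2 / (r (v x))^3) (at x)" for x
  proof -
    have "((\<lambda>x. v x / r (v x)) has_real_derivative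
        (v' x * r (v x) - v x * (v x * v' x / r (v x))) / (r (v x) * r (v x))) (at x)"
      by (rule DERIV_divide[OF dv dr]) (use r(1)[of "v x"] in simp)
    also have "(v' x * r (v x) - v x * (v x * v' x / r (v x))) / (r (v x) * r (v x))
        = v' x * ((r (v x))\<^sup>2 - (v x)\<^sup>2) / (r (v x))^3"
      using r(1)[of "v x"] by (simp add: field_simps power2_eq_square power3_eq_cube)
    finally show ?thesis by (simp add: r(4))
  qed
  let ?G = "\<lambda>x. v' x * (v x / r (v x))"
  let ?g = "\<lambda>x. (h x - q x * v x) * (v x / r (v x)) + (v' x)\<^sup>2 * \<delta>\<^sup>2 / (r (v x))^3"
  have "(?G has_real_derivative ?g x) (at x)" for x
    by (rule derivative_eq_intros dv' d\<eta> refl | simp add: power2_eq_square)+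
  then have "(?g has_integral (?G R - ?G (-R))) {-R..R}"
    using R by (intro has_integral_derivative) auto
  moreover have "\<bar>?G x\<bar> \<le> B" for x
  proof -
    have "\<bar>?G x\<bar> \<le> B * 1" unfolding abs_mult
      by (intro mult_mono B) (use \<eta>1[of "v x"] B[of x] in auto)
    then show ?thesis by simp
  qed
  then have "?G R - ?G (-R) \<le> 2 * B" using abs_le_iff[of "?G R" B] abs_le_iff[of "?G (-R)" B] by force
  ultimately have I1: "integral {-R..R} ?g \<le> 2 * B" by (simp add: integral_unique)
  have pt: "c * \<bar>v x\<bar> \<le> ?g x + \<bar>h x\<bar> + A * \<psi> x + c * \<delta>" for x
  proof -
    define E T where "E = v x / r (v x)" and "T = (v' x)\<^sup>2 * \<delta>\<^sup>2 / (r (v x))^3"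
    have E: "\<bar>E\<bar> \<le> 1" "\<bar>v x\<bar> - \<delta> \<le> v x * E" "v x * E \<le> \<bar>v x\<bar>" "0 \<le> v x * E"
      unfolding E_def using \<eta>1 \<eta>t by blast+
    have "0 \<le> T" using r(1)[of "v x"] by (simp add: T_def)
    moreover have "- \<bar>h x\<bar> \<le> h x * E"
    proof -
      have "\<bar>h x * E\<bar> \<le> \<bar>h x\<bar> * 1"
        unfolding abs_mult[of "h x"] by (intro mult_left_mono E) auto
      then show ?thesis by linarith
    qed
    moreover have "q x * (v x * E) \<le> (\<psi> x - c) * (v x * E)"
      using q[of x] E by (intro mult_right_mono) auto
    moreover have "\<psi> x * (v x * E) \<le> \<psi> x * A"
      using E(3) A[of x] \<psi>[of x] by (intro mult_left_mono) auto
    moreover have "c * (\<bar>v x\<bar> - \<delta>) \<le> c * (v x * E)" by (intro mult_left_mono E c)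
    ultimately show ?thesis unfolding E_def[symmetric] T_def[symmetric] by (simp add: algebra_simps)
  qed
  have cg: "continuous_on UNIV ?g"
    by (intro continuous_intros ch cq cv cv' cr c\<eta>) (use r(1) in \<open>auto simp: less_imp_neq[OF r(1), symmetric]\<close>)
  have "c * integral {-R..R} (\<lambda>x. \<bar>v x\<bar>) = integral {-R..R} (\<lambda>x. c * \<bar>v x\<bar>)" by simp
  also have "\<dots> \<le> integral {-R..R} (\<lambda>x. ?g x + \<bar>h x\<bar> + A * \<psi> x + c * \<delta>)"
    by (rule integral_le) (intro integrable_on_interval continuous_intros cv cg ch c\<psi> pt)+
  also have "\<dots> = integral {-R..R} ?g + integral {-R..R} (\<lambda>x. \<bar>h x\<bar>) + A * integral {-R..R} \<psi> + integral {-R..R} (\<lambda>x. c * \<delta>)"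
  proof (rule integral_unique, intro has_integral_add has_integral_mult_right)
  qed (rule integrable_integral, intro integrable_on_interval continuous_intros cg ch c\<psi>)+
  also have "\<dots> \<le> 2 * B + integral {-R..R} (\<lambda>x. \<bar>h x\<bar>) + A * K + e"
  proof -
    have "0 \<le> A" using A[of 0] by linarith
    then have "A * integral {-R..R} \<psi> \<le> A * K" by (rule mult_left_mono[OF I\<psi>])
    moreover have "integral {-R..R} (\<lambda>x. c * \<delta>) \<le> e" using \<delta>e R by (simp add: mult.commute mult.left_commute)
    ultimately show ?thesis using I1 by linarith
  qed
  finally show "c * integral {-R..R} (\<lambda>x. \<bar>v x\<bar>) \<le> A * K + 2 * B + integral {-R..R} (\<lambda>x. \<bar>h x\<bar>) + e"
    by simp
qed

context standing_wave
begin

lemma \<phi>_bounded: "\<exists>B>0. \<forall>x. \<phi> x \<le> B"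
  by (rule bounded_above_of_ends[OF continuous_\<phi>, of 1 1])
     (use order_tendstoD(2)[OF \<phi>_at_top, of 1] order_tendstoD(2)[OF \<phi>_at_bot, of 1]
      in \<open>auto elim: eventually_mono\<close>)

lemma distance_to_equilibria_le: "\<exists>C>0. \<forall>x. min (u x) (1 - u x) \<le> C * \<phi> x"
proof -
  obtain c d where c: "c > 0" "\<forall>\<^sub>F x in at_top. c * (1 - u x) \<le> \<phi> x \<and> c * \<phi> x \<le> f (u x)"
    and d: "d > 0" "\<forall>\<^sub>F x in at_bot. d * u x \<le> \<phi> x \<and> d * \<phi> x \<le> - f (u x)"
    using profile_right_end profile_left_end by blast
  have "\<exists>C>0. \<forall>x. min (u x) (1 - u x) / \<phi> x \<le> C"
  proof (rule bounded_above_of_ends)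
    show "continuous_on UNIV (\<lambda>x. min (u x) (1 - u x) / \<phi> x)"
      by (intro continuous_intros continuous_u continuous_\<phi>) (use \<phi>_ne in auto)
    show "\<forall>\<^sub>F x in at_top. min (u x) (1 - u x) / \<phi> x \<le> 1 / c" using c(2)
    proof eventually_elim
      case (elim x)
      have "c * min (u x) (1 - u x) \<le> c * (1 - u x)" using c(1) by (intro mult_left_mono) auto
      then have "c * min (u x) (1 - u x) \<le> \<phi> x" using elim by linarith
      then show ?case using c(1) \<phi>_pos[of x] by (simp add: field_simps)
    qed
    show "\<forall>\<^sub>F x in at_bot. min (u x) (1 - u x) / \<phi> x \<le> 1 / d" using d(2)
    proof eventually_elim
      case (elim x)
      have "d * min (u x) (1 - u x) \<le> d * u x" using d(1) by (intro mult_left_mono) auto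
      then have "d * min (u x) (1 - u x) \<le> \<phi> x" using elim by linarith
      then show ?case using d(1) \<phi>_pos[of x] by (simp add: field_simps)
    qed
  qed
  then show ?thesis using \<phi>_pos by (auto simp: divide_le_eq)
qed

lemma f_profile_le: "\<exists>C>0. \<forall>x. \<bar>f (u x)\<bar> \<le> C * \<phi> x"
proof -
  obtain C where C: "C > 0" "\<And>x. min (u x) (1 - u x) \<le> C * \<phi> x"
    using distance_to_equilibria_le by blast
  obtain L where L: "L \<ge> 0" "\<And>s t. \<bar>s\<bar> \<le> 1 \<Longrightarrow> \<bar>t\<bar> \<le> 1 \<Longrightarrow> \<bar>f s - f t\<bar> \<le> L * \<bar>s - t\<bar>"
    using f_lipschitz_bounded[of 1] by auto
  have "\<bar>f (u x)\<bar> \<le> (L * C + 1) * \<phi> x" for x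
  proof -
    have "\<bar>f (u x)\<bar> \<le> L * u x" "\<bar>f (u x)\<bar> \<le> L * (1 - u x)"
      using L(2)[of "u x" 0] L(2)[of "u x" 1] u_pos[of x] u_less_1[of x] f_zeros by auto
    then have "\<bar>f (u x)\<bar> \<le> L * min (u x) (1 - u x)" by (simp add: min_def)
    also have "\<dots> \<le> L * (C * \<phi> x)" by (intro mult_left_mono C L)
    also have "\<dots> \<le> (L * C + 1) * \<phi> x" using \<phi>_pos[of x] by (simp add: algebra_simps)
    finally show ?thesis .
  qed
  moreover have "L * C + 1 > 0" using L C by (simp add: add_nonneg_pos)
  ultimately show ?thesis by blast
qed

lemma weighted_primitive_bounded:
  "\<exists>M>0. \<forall>x. \<phi> x * \<bar>primitive (\<lambda>s. 1 / \<phi> s) x\<bar> \<le> M"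
proof -
  obtain c d where c: "c > 0" "\<forall>\<^sub>F x in at_top. c * (1 - u x) \<le> \<phi> x \<and> c * \<phi> x \<le> f (u x)"
    and d: "d > 0" "\<forall>\<^sub>F x in at_bot. d * u x \<le> \<phi> x \<and> d * \<phi> x \<le> - f (u x)"
    using profile_right_end profile_left_end by blast
  obtain B where B: "\<And>x. \<phi> x \<le> B" using \<phi>_bounded by blast
  show ?thesis
    by (rule weighted_primitive_reciprocal_bounded[OF DERIV_\<phi> \<phi>_pos B c(1) _ d(1)])
       (use c(2) d(2) in \<open>auto elim: eventually_mono\<close>)
qed

lemma f'_profile_bounded: "\<exists>Q>0. \<forall>x. \<bar>deriv f (u x)\<bar> \<le> Q"
proof -
  have "bounded (deriv f ` {0..1})"
    by (intro compact_imp_bounded compact_continuous_image continuous_on_subset[OF continuous_f']) auto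
  then obtain L where L: "\<forall>x\<in>{0..1}. \<bar>deriv f x\<bar> \<le> L"
    unfolding bounded_iff real_norm_def by blast
  have "\<bar>deriv f (u x)\<bar> \<le> \<bar>L\<bar> + 1" for x
    using L[rule_format, of "u x"] u_pos[of x] u_less_1[of x] by auto
  then show ?thesis by (intro exI[of _ "\<bar>L\<bar> + 1"]) auto
qed

lemma continuous_q: "continuous_on UNIV (\<lambda>x. deriv f (u x))"
  by (rule continuous_on_compose2[OF continuous_f' continuous_u]) auto

text \<open>
  The coefficient of the linearization is negative at both ends. Multiples of \<open>\<phi>\<close>, which is positive and has
  integral \<open>1\<close>, absorb its values in the middle.
\<close>
lemma spectral_gap_at_ends: "\<exists>c>0. \<exists>K>0. \<forall>x. deriv f (u x) + c \<le> K * \<phi> x"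
proof -
  define c where "c = min (- deriv f 0) (- deriv f 1) / 2"
  have c: "c > 0" "deriv f 0 + c < 0" "deriv f 1 + c < 0"
    using f'_zeros by (auto simp: c_def min_def)
  have f'_lim: "(deriv f \<longlongrightarrow> deriv f s) (nhds s)" for s
    using DERIV_isCont[OF DERIV_f'] by (simp add: continuous_at tendsto_at_iff_tendsto_nhds)
  have "\<exists>K>0. \<forall>x. (deriv f (u x) + c) / \<phi> x \<le> K"
  proof (rule bounded_above_of_ends)
    show "continuous_on UNIV (\<lambda>x. (deriv f (u x) + c) / \<phi> x)"
      by (intro continuous_intros continuous_q continuous_\<phi>) (use \<phi>_ne in auto)
    have "((\<lambda>x. deriv f (u x) + c) \<longlongrightarrow> deriv f 1 + c) at_top"
      by (intro tendsto_intros filterlim_compose[OF f'_lim u_at_top])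
    from order_tendstoD(2)[OF this c(3)]
    show "\<forall>\<^sub>F x in at_top. (deriv f (u x) + c) / \<phi> x \<le> 0"
      by eventually_elim (use \<phi>_pos in \<open>simp add: divide_nonpos_pos less_imp_le\<close>)
    have "((\<lambda>x. deriv f (u x) + c) \<longlongrightarrow> deriv f 0 + c) at_bot"
      by (intro tendsto_intros filterlim_compose[OF f'_lim u_at_bot])
    from order_tendstoD(2)[OF this c(2)]
    show "\<forall>\<^sub>F x in at_bot. (deriv f (u x) + c) / \<phi> x \<le> 0"
      by eventually_elim (use \<phi>_pos in \<open>simp add: divide_nonpos_pos less_imp_le\<close>)
  qed
  then show ?thesis using \<phi>_pos c(1) by (auto simp: divide_le_eq)
qed

lemma integral_\<phi>_le: "0 \<le> R \<Longrightarrow> integral {-R..R} \<phi> \<le> 1"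
  using integral_unique[OF has_integral_derivative[OF _ DERIV_u, of "-R" R]] u_pos[of "-R"] u_less_1[of R]
  by simp

end

section \<open>The linearized equation\<close>

context standing_wave
begin

text \<open>
  The integral of \<open>\<phi> h\<close> over \<open>(-\<infinity>, s]\<close>, written with a limit so that only integrals over bounded intervals occur.
\<close>
definition tail :: "(real \<Rightarrow> real) \<Rightarrow> real \<Rightarrow> real" where
  "tail h s = primitive (\<lambda>x. \<phi> x * h x) s - Lim at_bot (primitive (\<lambda>x. \<phi> x * h x))"

text \<open>
  The scalar product of \<open>\<phi>\<close> and \<open>h\<close> over the whole line.
\<close>
definition moment :: "(real \<Rightarrow> real) \<Rightarrow> real" where
  "moment h = Lim at_top (tail h)"

text \<open>
  The multiplier of the Lyapunov-Schmidt reduction: subtracting this multiple of \<open>\<phi>\<close> makes \<open>g\<close> orthogonal to \<open>\<phi>\<close>.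
\<close>
definition multiplier :: "(real \<Rightarrow> real) \<Rightarrow> real" where
  "multiplier g = moment g / moment \<phi>"

text \<open>
  Reduction of order: \<open>v = \<phi> w\<close> solves \<open>v'' + f'(u) v = h\<close> iff \<open>(\<phi>\<^sup>2 w')' = \<phi> h\<close>. The quotient is the \<open>w\<close> with
  \<open>w 0 = 0\<close>, which fixes the free multiple of \<open>\<phi>\<close> in \<open>v\<close>.
\<close>
definition quotient :: "(real \<Rightarrow> real) \<Rightarrow> real \<Rightarrow> real" where
  "quotient h = primitive (\<lambda>s. tail h s / (\<phi> s)\<^sup>2)"

definition projected :: "(real \<Rightarrow> real) \<Rightarrow> real \<Rightarrow> real" where
  "projected g x = g x - multiplier g * \<phi> x"

definition solve :: "(real \<Rightarrow> real) \<Rightarrow> real \<Rightarrow> real" where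
  "solve g x = \<phi> x * quotient (projected g) x"

text \<open>
  The derivative of \<open>solve g\<close>; note \<open>\<phi>' = - f(u)\<close>.
\<close>
definition solve' :: "(real \<Rightarrow> real) \<Rightarrow> real \<Rightarrow> real" where
  "solve' g x = tail (projected g) x / \<phi> x - f (u x) * quotient (projected g) x"

text \<open>
  Both \<open>m u + P\<close> and \<open>m u - P\<close> are nondecreasing, which gives the Lipschitz bound in terms of \<open>u\<close> and, by boundedness, the limits.
\<close>
lemma limits_weighted_primitive:
  assumes ch: "continuous_on UNIV h" and m: "\<And>x. \<bar>h x\<bar> \<le> m"
  defines "P \<equiv> primitive (\<lambda>x. \<phi> x * h x)"
  shows "\<bar>P t - P s\<bar> \<le> m * \<bar>u t - u s\<bar>" "\<exists>l. (P \<longlongrightarrow> l) at_bot" "\<exists>l. (P \<longlongrightarrow> l) at_top"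
proof -
  have m0: "0 \<le> m" using m[of 0] by linarith
  have c: "continuous_on UNIV (\<lambda>x. \<phi> x * h x)" by (intro continuous_intros continuous_\<phi> ch)
  have dP: "(P has_real_derivative \<phi> x * h x) (at x)" for x unfolding P_def by (rule DERIV_primitive[OF c])
  have b: "\<bar>\<phi> x * h x\<bar> \<le> m * \<phi> x" for x
    using mult_left_mono[OF m, of "\<phi> x" x] \<phi>_pos[of x] by (simp add: abs_mult mult.commute)
  have up: "m * u s + P s \<le> m * u t + P t" "m * u s - P s \<le> m * u t - P t" if "s \<le> t" for s t
  proof -
    show "m * u s + P s \<le> m * u t + P t"
    proof (rule DERIV_nonneg_imp_nondecreasing[OF that])
      fix x
      have "((\<lambda>x. m * u x + P x) has_real_derivative m * \<phi> x + \<phi> x * h x) (at x)"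
        by (auto intro!: derivative_eq_intros dP DERIV_u)
      moreover have "0 \<le> m * \<phi> x + \<phi> x * h x" using b[of x] by linarith
      ultimately show "\<exists>y. ((\<lambda>x. m * u x + P x) has_real_derivative y) (at x) \<and> 0 \<le> y" by blast
    qed
    show "m * u s - P s \<le> m * u t - P t"
    proof (rule DERIV_nonneg_imp_nondecreasing[OF that])
      fix x
      have "((\<lambda>x. m * u x - P x) has_real_derivative m * \<phi> x - \<phi> x * h x) (at x)"
        by (auto intro!: derivative_eq_intros dP DERIV_u)
      moreover have "0 \<le> m * \<phi> x - \<phi> x * h x" using b[of x] by linarith
      ultimately show "\<exists>y. ((\<lambda>x. m * u x - P x) has_real_derivative y) (at x) \<and> 0 \<le> y" by blast
    qed
  qed
  show 1: "\<bar>P t - P s\<bar> \<le> m * \<bar>u t - u s\<bar>" for s t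
  proof (cases "s \<le> t")
    case True
    then show ?thesis using up[of s t] u_mono[OF True] by (simp add: algebra_simps abs_le_iff)
  next
    case False
    then show ?thesis using up[of t s] u_mono[of t s] by (simp add: algebra_simps abs_le_iff)
  qed
  have "\<bar>m * u x + P x\<bar> \<le> 2 * m" for x
  proof -
    have "\<bar>P x - P 0\<bar> \<le> m * 1"
    proof (rule order_trans[OF 1 mult_left_mono[OF _ m0]])
      show "\<bar>u x - u 0\<bar> \<le> 1" using u_pos[of x] u_pos[of 0] u_less_1[of x] u_less_1[of 0] by linarith
    qed
    moreover have "P 0 = 0" by (simp add: P_def)
    moreover have "0 \<le> m * u x" "m * u x \<le> m * 1"
      using m0 u_pos[of x] u_less_1[of x] mult_left_mono[of "u x" 1 m] by auto
    ultimately show ?thesis by (simp add: abs_le_iff)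
  qed
  from monotone_bounded_limits[of "\<lambda>x. m * u x + P x", OF up(1) this]
  obtain l1 l2 where "((\<lambda>x. m * u x + P x) \<longlongrightarrow> l1) at_bot" "((\<lambda>x. m * u x + P x) \<longlongrightarrow> l2) at_top" by blast
  from tendsto_diff[OF this(1) tendsto_mult[OF tendsto_const u_at_bot, of m]]
    tendsto_diff[OF this(2) tendsto_mult[OF tendsto_const u_at_top, of m]]
  show "\<exists>l. (P \<longlongrightarrow> l) at_bot" "\<exists>l. (P \<longlongrightarrow> l) at_top" by auto
qed

context
  fixes h :: "real \<Rightarrow> real" and m :: real
  assumes ch: "continuous_on UNIV h" and m: "\<And>x. \<bar>h x\<bar> \<le> m"
begin

lemma DERIV_tail: "(tail h has_real_derivative \<phi> x * h x) (at x)"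
  unfolding tail_def[abs_def]
  by (auto intro!: derivative_eq_intros DERIV_primitive continuous_intros continuous_\<phi> ch)

lemma tail_at_bot: "(tail h \<longlongrightarrow> 0) at_bot"
proof -
  obtain l where l: "(primitive (\<lambda>x. \<phi> x * h x) \<longlongrightarrow> l) at_bot"
    using limits_weighted_primitive(2)[OF ch m] by blast
  then have "Lim at_bot (primitive (\<lambda>x. \<phi> x * h x)) = l" by (intro tendsto_Lim) auto
  then show ?thesis unfolding tail_def[abs_def] using tendsto_diff[OF l tendsto_const[of l]] by simp
qed

lemma tail_at_top: "(tail h \<longlongrightarrow> moment h) at_top"
proof -
  obtain l where "(primitive (\<lambda>x. \<phi> x * h x) \<longlongrightarrow> l) at_top"
    using limits_weighted_primitive(3)[OF ch m] by blast
  from tendsto_diff[OF this tendsto_const] have "\<exists>l. (tail h \<longlongrightarrow> l) at_top"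
    unfolding tail_def[abs_def] by blast
  then show ?thesis unfolding moment_def by (metis tendsto_Lim trivial_limit_at_top_linorder)
qed

lemma tail_lipschitz: "\<bar>tail h t - tail h s\<bar> \<le> m * \<bar>u t - u s\<bar>"
  using limits_weighted_primitive(1)[OF ch m, of t s] by (simp add: tail_def)

text \<open>
  The tail is controlled by the distance to either equilibrium: directly on the left, and on the right
  because the total moment is subtracted.
\<close>
lemma abs_tail_le: "\<bar>tail h s\<bar> \<le> m * u s"
  and abs_moment_diff_le: "\<bar>moment h - tail h s\<bar> \<le> m * (1 - u s)"
proof -
  have "((\<lambda>t. m * \<bar>u s - u t\<bar> - \<bar>tail h s - tail h t\<bar>) \<longlongrightarrow> m * \<bar>u s - 0\<bar> - \<bar>tail h s - 0\<bar>) at_bot"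
    by (intro tendsto_intros u_at_bot tail_at_bot)
  from tendsto_lowerbound[OF this, of 0] show "\<bar>tail h s\<bar> \<le> m * u s"
    using tail_lipschitz u_pos[of s] by simp
  have "((\<lambda>t. m * \<bar>u t - u s\<bar> - \<bar>tail h t - tail h s\<bar>) \<longlongrightarrow> m * \<bar>1 - u s\<bar> - \<bar>moment h - tail h s\<bar>) at_top"
    by (intro tendsto_intros u_at_top tail_at_top)
  from tendsto_lowerbound[OF this, of 0] show "\<bar>moment h - tail h s\<bar> \<le> m * (1 - u s)"
    using tail_lipschitz u_less_1[of s] by simp
qed

lemma abs_moment_le: "\<bar>moment h\<bar> \<le> m"
proof -
  have "((\<lambda>t. m * u t - \<bar>tail h t\<bar>) \<longlongrightarrow> m * 1 - \<bar>moment h\<bar>) at_top"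
    by (intro tendsto_intros u_at_top tail_at_top)
  from tendsto_lowerbound[OF this, of 0] show ?thesis using abs_tail_le by simp
qed

end

text \<open>
  This characterization yields the linearity that the contraction estimate needs.
\<close>
lemma tail_unique:
  assumes ch: "continuous_on UNIV h" and m: "\<And>x. \<bar>h x\<bar> \<le> m"
    and G: "\<And>x. (G has_real_derivative \<phi> x * h x) (at x)" "(G \<longlongrightarrow> 0) at_bot"
  shows "tail h = G"
proof -
  have "((\<lambda>x. tail h x - G x) has_real_derivative 0) (at x)" for x
    using DERIV_diff[OF DERIV_tail[OF ch m] G(1)] by simp
  then have "tail h x - G x = tail h 0 - G 0" for x by (intro DERIV_isconst_all) auto
  then have eq: "(\<lambda>x. tail h x - G x) = (\<lambda>_. tail h 0 - G 0)" by blast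
  have "((\<lambda>x. tail h x - G x) \<longlongrightarrow> 0) at_bot" using tendsto_diff[OF tail_at_bot[OF ch m] G(2)] by simp
  then have "tail h 0 - G 0 = 0" unfolding eq by (simp add: tendsto_const_iff)
  then show ?thesis using eq by (auto simp: fun_eq_iff)
qed

lemma tail_combination:
  assumes h: "continuous_on UNIV h" "\<And>x. \<bar>h x\<bar> \<le> m" and k: "continuous_on UNIV k" "\<And>x. \<bar>k x\<bar> \<le> n"
  shows "tail (\<lambda>x. h x - c * k x) = (\<lambda>x. tail h x - c * tail k x)"
    and "moment (\<lambda>x. h x - c * k x) = moment h - c * moment k"
proof -
  have b: "\<bar>h x - c * k x\<bar> \<le> m + \<bar>c\<bar> * n" for x
    using abs_triangle_ineq4[of "h x" "c * k x"] h(2)[of x] mult_left_mono[OF k(2), of "\<bar>c\<bar>" x] by (simp add: abs_mult)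
  have c: "continuous_on UNIV (\<lambda>x. h x - c * k x)" by (intro continuous_intros h k)
  show eq: "tail (\<lambda>x. h x - c * k x) = (\<lambda>x. tail h x - c * tail k x)"
  proof (rule tail_unique[OF c b])
    show "((\<lambda>x. tail h x - c * tail k x) has_real_derivative \<phi> x * (h x - c * k x)) (at x)" for x
      by (rule derivative_eq_intros DERIV_tail[OF h] DERIV_tail[OF k] refl | simp add: algebra_simps)+
    show "((\<lambda>x. tail h x - c * tail k x) \<longlongrightarrow> 0) at_bot"
      using tendsto_diff[OF tail_at_bot[OF h] tendsto_mult[OF tendsto_const tail_at_bot[OF k], of c]] by simp
  qed
  have "(tail (\<lambda>x. h x - c * k x) \<longlongrightarrow> moment h - c * moment k) at_top"
    unfolding eq by (intro tendsto_intros tail_at_top[OF h] tail_at_top[OF k])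
  with tail_at_top[OF c b] show "moment (\<lambda>x. h x - c * k x) = moment h - c * moment k"
    by (rule tendsto_unique[OF trivial_limit_at_top_linorder])
qed

lemma moment_\<phi>_pos: "moment \<phi> > 0"
proof -
  obtain B where B: "\<And>x. \<phi> x \<le> B" using \<phi>_bounded by blast
  have b: "\<bar>\<phi> x\<bar> \<le> B" for x using B[of x] \<phi>_pos[of x] by simp
  note tail = DERIV_tail[OF continuous_\<phi> b]
  have mono: "tail \<phi> x \<le> tail \<phi> y" if "x \<le> y" for x y
    by (rule DERIV_nonneg_imp_nondecreasing[OF that]) (use tail \<phi>_pos in \<open>meson less_imp_le mult_pos_pos\<close>)
  have "0 \<le> tail \<phi> 0"
    by (rule tendsto_upperbound[OF tail_at_bot[OF continuous_\<phi> b]])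
       (use mono in \<open>auto simp: eventually_at_bot_linorder\<close>)
  also have "tail \<phi> 0 < tail \<phi> 1"
    by (rule DERIV_pos_imp_increasing) (use tail \<phi>_pos in \<open>auto intro!: exI[of _ "\<phi> _ * \<phi> _"] mult_pos_pos\<close>)
  also have "tail \<phi> 1 \<le> moment \<phi>"
    by (rule tendsto_lowerbound[OF tail_at_top[OF continuous_\<phi> b]])
       (use mono in \<open>auto simp: eventually_at_top_linorder\<close>)
  finally show ?thesis .
qed

lemma projection:
  "\<exists>C>0. \<forall>g m. continuous_on UNIV g \<longrightarrow> (\<forall>x. \<bar>g x\<bar> \<le> m) \<longrightarrow>
     \<bar>multiplier g\<bar> \<le> C * m \<and> (\<forall>x. \<bar>projected g x\<bar> \<le> C * m) \<and> moment (projected g) = 0"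
proof -
  obtain B where B: "B > 0" "\<And>x. \<phi> x \<le> B" using \<phi>_bounded by blast
  have b: "\<bar>\<phi> x\<bar> \<le> B" for x using B(2)[of x] \<phi>_pos[of x] by simp
  define C where "C = (1 + B) / moment \<phi> + 1"
  have C: "C > 0" using B moment_\<phi>_pos by (auto simp: C_def intro!: add_pos_pos divide_pos_pos)
  have "\<bar>multiplier g\<bar> \<le> C * m \<and> (\<forall>x. \<bar>projected g x\<bar> \<le> C * m) \<and> moment (projected g) = 0"
    if cg: "continuous_on UNIV g" and m: "\<And>x. \<bar>g x\<bar> \<le> m" for g m
  proof (intro conjI allI)
    have m0: "0 \<le> m" using m[of 0] by linarith
    have mult: "\<bar>multiplier g\<bar> \<le> m / moment \<phi>"
      using abs_moment_le[OF cg m] moment_\<phi>_pos by (simp add: multiplier_def abs_divide divide_right_mono)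
    also have "\<dots> \<le> C * m"
      using B(1) moment_\<phi>_pos m0 by (simp add: C_def field_simps)
    finally show "\<bar>multiplier g\<bar> \<le> C * m" .
    fix x
    have "\<bar>projected g x\<bar> \<le> \<bar>g x\<bar> + \<bar>multiplier g\<bar> * \<bar>\<phi> x\<bar>"
      unfolding projected_def abs_mult[symmetric] by (rule abs_triangle_ineq4)
    also have "\<dots> \<le> m + m / moment \<phi> * B"
      by (intro add_mono m mult_mono mult b) (use m0 moment_\<phi>_pos in auto)
    also have "\<dots> \<le> C * m"
      using B(1) moment_\<phi>_pos m0 by (simp add: C_def field_simps)
    finally show "\<bar>projected g x\<bar> \<le> C * m" .
    show "moment (projected g) = 0"
      unfolding projected_def[abs_def] tail_combination(2)[OF cg m continuous_\<phi> b]
      using moment_\<phi>_pos by (simp add: multiplier_def)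
  qed
  then show ?thesis using C by blast
qed

lemma continuous_projected: "continuous_on UNIV g \<Longrightarrow> continuous_on UNIV (projected g)"
  unfolding projected_def[abs_def] by (intro continuous_intros continuous_\<phi>)

lemma continuous_quotient_integrand:
  assumes "continuous_on UNIV h" "\<And>x. \<bar>h x\<bar> \<le> m"
  shows "continuous_on UNIV (\<lambda>s. tail h s / (\<phi> s)\<^sup>2)"
  by (intro continuous_intros continuous_\<phi> DERIV_imp_continuous[OF DERIV_tail[OF assms]]) (use \<phi>_ne in auto)

text \<open>
  For \<open>h\<close> with moment \<open>0\<close> the tail is at most a multiple of \<open>min u (1 - u)\<close>, hence of \<open>\<phi>\<close>. Then \<open>w'\<close> is at most a
  multiple of \<open>1 / \<phi>\<close>, and \<open>\<phi>\<close> times the primitive of \<open>1 / \<phi>\<close> is bounded.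
\<close>
lemma solve_sup_bound:
  "\<exists>C>0. \<forall>g m. continuous_on UNIV g \<longrightarrow> (\<forall>x. \<bar>g x\<bar> \<le> m) \<longrightarrow>
     (\<forall>x. \<bar>solve g x\<bar> \<le> C * m \<and> \<bar>solve' g x\<bar> \<le> C * m)"
proof -
  obtain P where P: "P > 0" "\<And>g m. continuous_on UNIV g \<Longrightarrow> (\<forall>x. \<bar>g x\<bar> \<le> m) \<Longrightarrow>
     \<bar>multiplier g\<bar> \<le> P * m \<and> (\<forall>x. \<bar>projected g x\<bar> \<le> P * m) \<and> moment (projected g) = 0"
    using projection by blast
  obtain D where D: "D > 0" "\<And>x. min (u x) (1 - u x) \<le> D * \<phi> x" using distance_to_equilibria_le by blast
  obtain E where E: "E > 0" "\<And>x. \<bar>f (u x)\<bar> \<le> E * \<phi> x" using f_profile_le by blast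
  obtain M where M: "M > 0" "\<And>x. \<phi> x * \<bar>primitive (\<lambda>s. 1 / \<phi> s) x\<bar> \<le> M" using weighted_primitive_bounded by blast
  define C where "C = (M + E * M + 1) * D * P"
  have C: "C > 0" using P D E M by (auto simp: C_def intro!: mult_pos_pos add_pos_pos)
  have "\<bar>solve g x\<bar> \<le> C * m \<and> \<bar>solve' g x\<bar> \<le> C * m"
    if cg: "continuous_on UNIV g" and m: "\<And>x. \<bar>g x\<bar> \<le> m" for g m x
  proof -
    let ?h = "projected g"
    let ?A = "primitive (\<lambda>s. 1 / \<phi> s)"
    define n where "n = P * m"
    have m0: "0 \<le> m" using m[of 0] by linarith
    have n0: "0 \<le> n" using m0 P by (simp add: n_def)
    have ch: "continuous_on UNIV ?h" by (rule continuous_projected[OF cg])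
    have h: "\<bar>?h x\<bar> \<le> n" for x using P(2)[OF cg] m by (auto simp: n_def)
    have h0: "moment ?h = 0" using P(2)[OF cg] m by auto
    have tl: "\<bar>tail ?h s\<bar> \<le> n * D * \<phi> s" for s
    proof -
      have "\<bar>tail ?h s\<bar> \<le> n * min (u s) (1 - u s)"
        using abs_tail_le[OF ch h, of s] abs_moment_diff_le[OF ch h, of s] h0 by (simp add: min_def)
      also have "\<dots> \<le> n * (D * \<phi> s)" by (intro mult_left_mono D n0)
      finally show ?thesis by simp
    qed
    have ci: "continuous_on UNIV (\<lambda>s. tail ?h s / (\<phi> s)\<^sup>2)"
      by (rule continuous_quotient_integrand[OF ch h])
    have cA: "continuous_on UNIV (\<lambda>s. 1 / \<phi> s)" by (intro continuous_intros continuous_\<phi>) (use \<phi>_ne in auto)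
    have integrand: "\<bar>tail ?h s / (\<phi> s)\<^sup>2\<bar> \<le> n * D * (1 / \<phi> s)" for s
      using tl[of s] \<phi>_pos[of s] by (simp add: abs_divide field_simps power2_eq_square)
    have up: "n * D * ?A s + quotient ?h s \<le> n * D * ?A t + quotient ?h t"
      "n * D * ?A s - quotient ?h s \<le> n * D * ?A t - quotient ?h t" if "s \<le> t" for s t
    proof -
      have dq: "(quotient ?h has_real_derivative tail ?h x / (\<phi> x)\<^sup>2) (at x)" for x
        unfolding quotient_def by (rule DERIV_primitive[OF ci])
      show "n * D * ?A s + quotient ?h s \<le> n * D * ?A t + quotient ?h t"
      proof (rule DERIV_nonneg_imp_nondecreasing[OF that])
        fix x
        have "((\<lambda>x. n * D * ?A x + quotient ?h x) has_real_derivative n * D * (1 / \<phi> x) + tail ?h x / (\<phi> x)\<^sup>2) (at x)"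
          by (intro DERIV_add DERIV_cmult dq DERIV_primitive[OF cA])
        moreover have "0 \<le> n * D * (1 / \<phi> x) + tail ?h x / (\<phi> x)\<^sup>2" using integrand[of x] by linarith
        ultimately show "\<exists>y. ((\<lambda>x. n * D * ?A x + quotient ?h x) has_real_derivative y) (at x) \<and> 0 \<le> y" by blast
      qed
      show "n * D * ?A s - quotient ?h s \<le> n * D * ?A t - quotient ?h t"
      proof (rule DERIV_nonneg_imp_nondecreasing[OF that])
        fix x
        have "((\<lambda>x. n * D * ?A x - quotient ?h x) has_real_derivative n * D * (1 / \<phi> x) - tail ?h x / (\<phi> x)\<^sup>2) (at x)"
          by (intro DERIV_diff DERIV_cmult dq DERIV_primitive[OF cA])
        moreover have "0 \<le> n * D * (1 / \<phi> x) - tail ?h x / (\<phi> x)\<^sup>2" using integrand[of x] by linarith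
        ultimately show "\<exists>y. ((\<lambda>x. n * D * ?A x - quotient ?h x) has_real_derivative y) (at x) \<and> 0 \<le> y" by blast
      qed
    qed
    have "quotient ?h 0 = 0" by (simp add: quotient_def)
    then have "\<bar>quotient ?h x\<bar> \<le> \<bar>n * D * ?A x\<bar>"
      using up[of 0 x] up[of x 0] by (cases "0 \<le> x") (auto simp: abs_le_iff)
    then have q: "\<bar>quotient ?h x\<bar> \<le> n * D * \<bar>?A x\<bar>" using n0 D(1) by (simp add: abs_mult)
    have s1: "\<phi> x * \<bar>quotient ?h x\<bar> \<le> n * D * M"
    proof -
      have "\<phi> x * \<bar>quotient ?h x\<bar> \<le> \<phi> x * (n * D * \<bar>?A x\<bar>)" using \<phi>_pos[of x] by (intro mult_left_mono q) auto
      also have "\<dots> = n * D * (\<phi> x * \<bar>?A x\<bar>)" by simp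
      also have "\<dots> \<le> n * D * M" using n0 D(1) by (intro mult_left_mono M) auto
      finally show ?thesis .
    qed
    have "\<bar>solve g x\<bar> \<le> n * D * M"
      using s1 \<phi>_pos[of x] by (simp add: solve_def abs_mult)
    also have "\<dots> \<le> C * m"
    proof -
      have "C * m = n * D * M + (E * M + 1) * (n * D)" by (simp add: C_def n_def algebra_simps)
      moreover have "0 \<le> (E * M + 1) * (n * D)" using E M n0 D by (intro mult_nonneg_nonneg add_nonneg_nonneg) auto
      ultimately show ?thesis by linarith
    qed
    finally have 1: "\<bar>solve g x\<bar> \<le> C * m" .
    have "\<bar>f (u x) * quotient ?h x\<bar> \<le> E * \<phi> x * \<bar>quotient ?h x\<bar>"
      unfolding abs_mult by (intro mult_right_mono E) auto
    also have "\<dots> \<le> E * (n * D * M)" using mult_left_mono[OF s1, of E] E(1) by (simp add: mult.assoc)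
    finally have "\<bar>f (u x) * quotient ?h x\<bar> \<le> E * (n * D * M)" .
    moreover have "\<bar>tail ?h x / \<phi> x\<bar> \<le> n * D" using tl[of x] \<phi>_pos[of x] by (simp add: abs_divide field_simps)
    ultimately have "\<bar>solve' g x\<bar> \<le> n * D + E * (n * D * M)"
      unfolding solve'_def by (meson abs_triangle_ineq4 add_mono order_trans)
    also have "\<dots> \<le> C * m"
    proof -
      have "C * m = n * D + E * (n * D * M) + M * (n * D)" by (simp add: C_def n_def algebra_simps)
      moreover have "0 \<le> M * (n * D)" using M n0 D by (intro mult_nonneg_nonneg) auto
      ultimately show ?thesis by linarith
    qed
    finally show ?thesis using 1 by blast
  qed
  then show ?thesis using C by blast
qed

context
  fixes g :: "real \<Rightarrow> real" and m :: real
  assumes cg: "continuous_on UNIV g" and m: "\<And>x. \<bar>g x\<bar> \<le> m"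
begin

lemma projected_bounded: "\<exists>n. \<forall>x. \<bar>projected g x\<bar> \<le> n"
  using projection cg m by blast

lemma DERIV_quotient: "(quotient (projected g) has_real_derivative tail (projected g) x / (\<phi> x)\<^sup>2) (at x)"
proof -
  obtain n where n: "\<And>x. \<bar>projected g x\<bar> \<le> n" using projected_bounded by blast
  show ?thesis unfolding quotient_def
    by (rule DERIV_primitive[OF continuous_quotient_integrand[OF continuous_projected[OF cg] n]])
qed

lemma DERIV_solve: "(solve g has_real_derivative solve' g x) (at x)"
proof -
  have "(solve g has_real_derivative - f (u x) * quotient (projected g) x
      + tail (projected g) x / (\<phi> x)\<^sup>2 * \<phi> x) (at x)"
    unfolding solve_def[abs_def] by (rule DERIV_mult[OF DERIV_\<phi> DERIV_quotient])
  moreover have "tail (projected g) x / (\<phi> x)\<^sup>2 * \<phi> x = tail (projected g) x / \<phi> x"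
    using \<phi>_ne[of x] by (simp add: power2_eq_square)
  ultimately show ?thesis by (simp add: solve'_def)
qed

lemma DERIV_solve':
  "(solve' g has_real_derivative g x - multiplier g * \<phi> x - deriv f (u x) * solve g x) (at x)"
proof -
  let ?h = "projected g"
  obtain n where n: "\<And>x. \<bar>?h x\<bar> \<le> n" using projected_bounded by blast
  have dt: "(tail ?h has_real_derivative \<phi> x * ?h x) (at x)"
    by (rule DERIV_tail[OF continuous_projected[OF cg] n])
  have 1: "((\<lambda>x. tail ?h x / \<phi> x) has_real_derivative
      (\<phi> x * ?h x * \<phi> x - tail ?h x * (- f (u x))) / (\<phi> x * \<phi> x)) (at x)"
    by (rule DERIV_divide[OF dt DERIV_\<phi> \<phi>_ne])
  have 2: "((\<lambda>x. f (u x)) has_real_derivative deriv f (u x) * \<phi> x) (at x)"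
    by (rule DERIV_chain2[OF DERIV_f DERIV_u])
  have "(solve' g has_real_derivative (\<phi> x * ?h x * \<phi> x - tail ?h x * (- f (u x))) / (\<phi> x * \<phi> x)
     - (deriv f (u x) * \<phi> x * quotient ?h x + tail ?h x / (\<phi> x)\<^sup>2 * f (u x))) (at x)"
    unfolding solve'_def[abs_def] by (rule DERIV_diff[OF 1 DERIV_mult[OF 2 DERIV_quotient]])
  also have "(\<phi> x * ?h x * \<phi> x - tail ?h x * (- f (u x))) / (\<phi> x * \<phi> x)
     - (deriv f (u x) * \<phi> x * quotient ?h x + tail ?h x / (\<phi> x)\<^sup>2 * f (u x))
     = ?h x - deriv f (u x) * (\<phi> x * quotient ?h x)"
    using \<phi>_ne[of x] by (simp add: field_simps power2_eq_square)
  finally show ?thesis by (simp add: solve_def projected_def)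
qed

end

lemma solve_diff:
  assumes g: "continuous_on UNIV g" "\<And>x. \<bar>g x\<bar> \<le> m" and k: "continuous_on UNIV k" "\<And>x. \<bar>k x\<bar> \<le> n"
  shows "solve g x - solve k x = solve (\<lambda>x. g x - k x) x"
proof -
  obtain B where B: "\<And>x. \<phi> x \<le> B" using \<phi>_bounded by blast
  obtain M N where M: "\<And>x. \<bar>projected g x\<bar> \<le> M" and N: "\<And>x. \<bar>projected k x\<bar> \<le> N"
    using projected_bounded[OF g] projected_bounded[OF k] by blast
  have "multiplier (\<lambda>x. g x - k x) = multiplier g - multiplier k"
    using tail_combination(2)[OF g k, of 1] by (simp add: multiplier_def diff_divide_distrib)
  then have "projected (\<lambda>x. g x - k x) = (\<lambda>x. projected g x - 1 * projected k x)"
    by (simp add: fun_eq_iff projected_def left_diff_distrib)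
  then have t: "tail (projected (\<lambda>x. g x - k x)) = (\<lambda>x. tail (projected g) x - 1 * tail (projected k) x)"
    using tail_combination(1)[OF continuous_projected[OF g(1)] M continuous_projected[OF k(1)] N, of 1] by simp
  have "quotient (projected (\<lambda>x. g x - k x)) = (\<lambda>x. quotient (projected g) x - quotient (projected k) x)"
    unfolding quotient_def[of "projected (\<lambda>x. g x - k x)"]
  proof (rule primitive_unique)
    show "((\<lambda>x. quotient (projected g) x - quotient (projected k) x)
        has_real_derivative tail (projected (\<lambda>x. g x - k x)) x / (\<phi> x)\<^sup>2) (at x)" for x
      using DERIV_diff[OF DERIV_quotient[OF g] DERIV_quotient[OF k]] by (simp add: t diff_divide_distrib)
    show "continuous_on UNIV (\<lambda>s. tail (projected (\<lambda>x. g x - k x)) s / (\<phi> s)\<^sup>2)"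
      unfolding t diff_divide_distrib mult_1
      by (intro continuous_on_diff continuous_quotient_integrand[OF continuous_projected[OF g(1)] M]
          continuous_quotient_integrand[OF continuous_projected[OF k(1)] N])
  qed (simp add: quotient_def)
  then show ?thesis by (simp add: solve_def algebra_simps)
qed

lemma solve_L1_bound:
  "\<exists>C>0. \<forall>g m R. continuous_on UNIV g \<longrightarrow> (\<forall>x. \<bar>g x\<bar> \<le> m) \<longrightarrow> 0 \<le> R \<longrightarrow>
     integral {-R..R} (\<lambda>x. \<bar>g x\<bar>) \<le> m \<longrightarrow> integral {-R..R} (\<lambda>x. \<bar>solve g x\<bar>) \<le> C * m"
proof -
  obtain P where P: "P > 0" "\<And>g m. continuous_on UNIV g \<Longrightarrow> (\<forall>x. \<bar>g x\<bar> \<le> m) \<Longrightarrow>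
     \<bar>multiplier g\<bar> \<le> P * m \<and> (\<forall>x. \<bar>projected g x\<bar> \<le> P * m) \<and> moment (projected g) = 0"
    using projection by blast
  obtain S where S: "S > 0" "\<And>g m. continuous_on UNIV g \<Longrightarrow> (\<forall>x. \<bar>g x\<bar> \<le> m) \<Longrightarrow>
     (\<forall>x. \<bar>solve g x\<bar> \<le> S * m \<and> \<bar>solve' g x\<bar> \<le> S * m)" using solve_sup_bound by blast
  obtain c K where c: "c > 0" and K: "K > 0" "\<And>x. deriv f (u x) + c \<le> K * \<phi> x"
    using spectral_gap_at_ends by blast
  define C where "C = (S * K + 2 * S + 1 + P) / c"
  have C: "C > 0" using P S K c by (auto simp: C_def intro!: divide_pos_pos add_pos_pos mult_pos_pos)
  have "integral {-R..R} (\<lambda>x. \<bar>solve g x\<bar>) \<le> C * m"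
    if cg: "continuous_on UNIV g" and m: "\<forall>x. \<bar>g x\<bar> \<le> m" and R: "0 \<le> R"
      and I: "integral {-R..R} (\<lambda>x. \<bar>g x\<bar>) \<le> m" for g m R
  proof -
    have m0: "0 \<le> m" using m[rule_format, of 0] by linarith
    have mlt: "\<bar>multiplier g\<bar> \<le> P * m" using P(2)[OF cg m] by blast
    have "c * integral {-R..R} (\<lambda>x. \<bar>solve g x\<bar>) \<le>
        (S * m) * K + 2 * (S * m) + integral {-R..R} (\<lambda>x. \<bar>projected g x\<bar>)"
    proof (rule integral_abs_le_of_damping[where v' = "solve' g" and q = "\<lambda>x. deriv f (u x)" and \<psi> = "\<lambda>x. K * \<phi> x"])
      show "(solve g has_real_derivative solve' g x) (at x)" for x
        using DERIV_solve[OF cg] m by blast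
      show "(solve' g has_real_derivative projected g x - deriv f (u x) * solve g x) (at x)" for x
        unfolding projected_def using DERIV_solve'[OF cg] m by blast
      show "integral {- R..R} (\<lambda>x. K * \<phi> x) \<le> K"
        using mult_left_mono[OF integral_\<phi>_le[OF R], of K] K(1) by simp
    qed (use S(2)[OF cg m] K c R \<phi>_pos in \<open>auto intro!: continuous_projected cg continuous_q continuous_intros continuous_\<phi> simp: less_imp_le\<close>)
    also have "integral {-R..R} (\<lambda>x. \<bar>projected g x\<bar>) \<le> integral {-R..R} (\<lambda>x. \<bar>g x\<bar> + \<bar>multiplier g\<bar> * \<phi> x)"
    proof (rule integral_le)
      show "\<bar>projected g x\<bar> \<le> \<bar>g x\<bar> + \<bar>multiplier g\<bar> * \<phi> x" for x
        using abs_triangle_ineq4[of "g x" "multiplier g * \<phi> x"] \<phi>_pos[of x] by (simp add: projected_def abs_mult)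
    qed (intro integrable_on_interval continuous_intros continuous_projected cg continuous_\<phi>)+
    also have "\<dots> = integral {-R..R} (\<lambda>x. \<bar>g x\<bar>) + \<bar>multiplier g\<bar> * integral {-R..R} \<phi>"
      by (subst integral_add; (intro integrable_on_interval continuous_intros cg continuous_\<phi>)?) simp
    also have "\<dots> \<le> m + P * m * 1"
      by (intro add_mono I mult_mono mlt integral_\<phi>_le R)
         (use P m0 \<phi>_pos in \<open>auto intro!: integral_nonneg integrable_on_interval continuous_\<phi> simp: less_imp_le\<close>)
    finally have *: "c * integral {-R..R} (\<lambda>x. \<bar>solve g x\<bar>) \<le> (S * m) * K + 2 * (S * m) + (m + P * m * 1)"
      by simp
    have "c * integral {-R..R} (\<lambda>x. \<bar>solve g x\<bar>) \<le> c * (C * m)"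
    proof -
      have "c * (C * m) = (S * K + 2 * S + 1 + P) * m" using c by (simp add: C_def)
      then show ?thesis using * by (simp add: algebra_simps)
    qed
    then show ?thesis using c by simp
  qed
  then show ?thesis using C by blast
qed

end

section \<open>The balance that removes the multiplier\<close>

lemma tendsto_shift_at_top:
  fixes w :: "real \<Rightarrow> real"
  assumes "(w \<longlongrightarrow> l) at_top" shows "((\<lambda>z. w (z + h)) \<longlongrightarrow> l) at_top"
proof (rule filterlim_compose[OF assms])
  show "filterlim (\<lambda>z. z + h) at_top at_top"
    unfolding filterlim_at_top eventually_at_top_linorder
    by (metis add.commute add_le_cancel_left diff_add_cancel)
qed

lemma tendsto_shift_at_bot:
  fixes w :: "real \<Rightarrow> real"
  assumes "(w \<longlongrightarrow> l) at_bot" shows "((\<lambda>z. w (z + h)) \<longlongrightarrow> l) at_bot"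
proof (rule filterlim_compose[OF assms])
  show "filterlim (\<lambda>z. z + h) at_bot at_bot"
    unfolding filterlim_at_bot eventually_at_bot_linorder
    by (metis add.commute add_le_cancel_left diff_add_cancel)
qed

lemma primitive_increment_le:
  assumes cg: "continuous_on UNIV g" and h: "0 \<le> h" and b: "\<And>x. a - h \<le> x \<Longrightarrow> x \<le> a \<Longrightarrow> \<bar>g x\<bar> \<le> e"
  shows "\<bar>primitive g a - primitive g (a - h)\<bar> \<le> e * h"
  using field_differentiable_bound[of "{a - h..a}" "primitive g" g e a "a - h"] h b
    has_field_derivative_at_within[OF DERIV_primitive[OF cg]] by auto

lemma primitive_increment_tendsto_zero:
  assumes cg: "continuous_on UNIV g" and h: "0 \<le> h"
  shows "(g \<longlongrightarrow> 0) at_top \<Longrightarrow> ((\<lambda>z. primitive g z - primitive g (z - h)) \<longlongrightarrow> 0) at_top"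
    and "(g \<longlongrightarrow> 0) at_bot \<Longrightarrow> ((\<lambda>z. primitive g z - primitive g (z - h)) \<longlongrightarrow> 0) at_bot"
proof -
  have est: "\<bar>primitive g z - primitive g (z - h)\<bar> < e"
    if e: "e > 0" and b: "\<And>x. z - h \<le> x \<Longrightarrow> x \<le> z \<Longrightarrow> dist (g x) 0 < e / (h + 1)" for e z
  proof -
    have "\<bar>primitive g z - primitive g (z - h)\<bar> \<le> e / (h + 1) * h"
      by (rule primitive_increment_le[OF cg h]) (use b in \<open>auto simp: dist_real_def less_imp_le\<close>)
    also have "\<dots> < e" using e h by (simp add: field_simps)
    finally show ?thesis .
  qed
  have pos: "e / (h + 1) > 0" if "e > 0" for e :: real using h that by simp
  {
    assume l: "(g \<longlongrightarrow> 0) at_top"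
    show "((\<lambda>z. primitive g z - primitive g (z - h)) \<longlongrightarrow> 0) at_top"
    proof (rule tendstoI)
      fix e :: real assume e: "e > 0"
      obtain X where X: "\<And>x. x \<ge> X \<Longrightarrow> dist (g x) 0 < e / (h + 1)"
        using tendstoD[OF l pos[OF e]] unfolding eventually_at_top_linorder by blast
      show "\<forall>\<^sub>F z in at_top. dist (primitive g z - primitive g (z - h)) 0 < e"
        unfolding eventually_at_top_linorder dist_real_def diff_zero
        by (intro exI[of _ "X + h"] allI impI est e X) simp
    qed
  next
    assume l: "(g \<longlongrightarrow> 0) at_bot"
    show "((\<lambda>z. primitive g z - primitive g (z - h)) \<longlongrightarrow> 0) at_bot"
    proof (rule tendstoI)
      fix e :: real assume e: "e > 0"
      obtain X where X: "\<And>x. x \<le> X \<Longrightarrow> dist (g x) 0 < e / (h + 1)"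
        using tendstoD[OF l pos[OF e]] unfolding eventually_at_bot_linorder by blast
      show "\<forall>\<^sub>F z in at_bot. dist (primitive g z - primitive g (z - h)) 0 < e"
        unfolding eventually_at_bot_linorder dist_real_def diff_zero
        by (intro exI[of _ X] allI impI est e X) simp
    qed
  }
qed

text \<open>
  With \<open>g(s) = w(s) w'(s + n)\<close>, the integrand is the derivative of
  \<open>w(z) w(z + n) - (\<integral> g over [z - n, z]) - w(z)\<^sup>2\<close>. At an end where \<open>w\<close> tends to \<open>L\<close> and \<open>w'\<close> to \<open>0\<close>, this
  expression tends to \<open>L\<^sup>2 - 0 - L\<^sup>2\<close>.
\<close>
lemma second_diff_work_tendsto_zero:
  assumes dw: "\<And>x. (w has_real_derivative w' x) (at x)" and cw': "continuous_on UNIV w'"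
    and lim: "(w \<longlongrightarrow> l) at_bot" "(w \<longlongrightarrow> L) at_top" and lim': "(w' \<longlongrightarrow> 0) at_bot" "(w' \<longlongrightarrow> 0) at_top"
  shows "((\<lambda>R. integral {-R..R} (\<lambda>z. w' z * second_diff n w z)) \<longlongrightarrow> 0) at_top"
proof -
  define g where "g s = w s * w' (s + real n)" for s
  have cg: "continuous_on UNIV g"
    unfolding g_def[abs_def]
    by (intro continuous_intros DERIV_imp_continuous[OF dw] continuous_on_compose2[OF cw']) auto
  (* The candidate antiderivative; the primitive of g measures the window from z - n to z. *)
  define \<Psi> where "\<Psi> z = w z * w (z + real n) - (primitive g z - primitive g (z - real n)) - (w z)\<^sup>2" for z
  have d\<Psi>: "(\<Psi> has_real_derivative w' z * second_diff n w z) (at z)" for z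
  proof -
    have "((\<lambda>z. w (z + real n)) has_real_derivative w' (z + real n)) (at z)"
      using dw[of "z + real n"] by (simp add: DERIV_shift)
    then show ?thesis
      unfolding \<Psi>_def[abs_def]
      by (auto intro!: derivative_eq_intros dw cg simp: g_def second_diff_def algebra_simps)
  qed
  have gt: "(g \<longlongrightarrow> 0) at_top" "(g \<longlongrightarrow> 0) at_bot"
    unfolding g_def[abs_def]
    using tendsto_mult[OF lim(2) tendsto_shift_at_top[OF lim'(2)]]
      tendsto_mult[OF lim(1) tendsto_shift_at_bot[OF lim'(1)]] by auto
  have "(\<Psi> \<longlongrightarrow> L * L - 0 - L\<^sup>2) at_top"
    unfolding \<Psi>_def[abs_def]
    by (intro tendsto_intros lim tendsto_shift_at_top primitive_increment_tendsto_zero cg gt) simp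
  moreover have "(\<Psi> \<longlongrightarrow> l * l - 0 - l\<^sup>2) at_bot"
    unfolding \<Psi>_def[abs_def]
    by (intro tendsto_intros lim tendsto_shift_at_bot primitive_increment_tendsto_zero cg gt) simp
  ultimately have "((\<lambda>R. \<Psi> R - \<Psi> (- R)) \<longlongrightarrow> 0) at_top"
    using tendsto_diff[of \<Psi> 0 at_top "\<lambda>R. \<Psi> (- R)" 0] by (simp add: filterlim_at_bot_mirror power2_eq_square)
  moreover have "\<forall>\<^sub>F R in at_top. \<Psi> R - \<Psi> (- R) = integral {-R..R} (\<lambda>z. w' z * second_diff n w z)"
    using eventually_ge_at_top[of 0]
  proof eventually_elim
    case (elim R)
    then show ?case
      using integral_unique[OF has_integral_derivative[of "-R" R \<Psi>, OF _ d\<Psi>]] by simp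
  qed
  ultimately show ?thesis by (rule Lim_transform_eventually)
qed

text \<open>
  Tannery's theorem sums the preceding limits over the distances \<open>n\<close>; the integral bounds on the second differences provide the majorant.
\<close>
lemma nonlocal_work_tendsto_zero:
  assumes b: "summable (\<lambda>n. \<bar>b n\<bar>)"
    and dw: "\<And>x. (w has_real_derivative w' x) (at x)" and cw': "continuous_on UNIV w'"
    and lim: "(w \<longlongrightarrow> l) at_bot" "(w \<longlongrightarrow> L) at_top" and lim': "(w' \<longlongrightarrow> 0) at_bot" "(w' \<longlongrightarrow> 0) at_top"
    and U: "\<And>x. \<bar>w x\<bar> \<le> U" and V: "\<And>x. \<bar>w' x\<bar> \<le> V"
    and c: "\<And>n R. 0 \<le> R \<Longrightarrow> integral {-R..R} (\<lambda>z. \<bar>second_diff n w z\<bar>) \<le> c n"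
    and s: "summable (\<lambda>n. \<bar>b n\<bar> * c n)"
  shows "((\<lambda>R. integral {-R..R} (\<lambda>z. w' z * nonlocal b w z)) \<longlongrightarrow> 0) at_top"
proof -
  have cw: "continuous_on UNIV w" by (rule DERIV_imp_continuous[OF dw])
  have V0: "0 \<le> V" using V[of 0] by linarith
  let ?I = "\<lambda>n R. integral {-R..R} (\<lambda>z. w' z * second_diff n w z)"
  have cws: "continuous_on UNIV (\<lambda>z. w' z * second_diff n w z)" for n
    by (intro continuous_intros cw' continuous_second_diff cw)
  have bound: "\<bar>b n * ?I n R\<bar> \<le> V * (\<bar>b n\<bar> * c n)" if R: "0 \<le> R" for n R
  proof -
    have "\<bar>?I n R\<bar> \<le> integral {-R..R} (\<lambda>z. V * \<bar>second_diff n w z\<bar>)"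
    proof (unfold real_norm_def[symmetric], rule Henstock_Kurzweil_Integration.integral_norm_bound_integral)
      show "norm (w' z * second_diff n w z) \<le> V * norm (second_diff n w z)" for z
        unfolding real_norm_def abs_mult by (intro mult_right_mono V) auto
    qed (intro integrable_on_interval cws continuous_intros continuous_second_diff cw)+
    also have "\<dots> \<le> V * c n" using mult_left_mono[OF c[OF R] V0] by simp
    finally have "\<bar>b n\<bar> * \<bar>?I n R\<bar> \<le> \<bar>b n\<bar> * (V * c n)" by (intro mult_left_mono) auto
    then show ?thesis by (simp add: abs_mult mult.left_commute)
  qed
  have "((\<lambda>R. \<Sum>n. b n * ?I n R) \<longlongrightarrow> (\<Sum>n::nat. 0::real)) at_top"
  proof (rule tannerys_theorem[THEN conjunct2, THEN conjunct2])
    show "((\<lambda>R. b n * ?I n R) \<longlongrightarrow> 0) at_top" for n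
      using tendsto_mult[OF tendsto_const second_diff_work_tendsto_zero[OF dw cw' lim lim'], of "b n" n] by simp
    show "summable (\<lambda>n. V * (\<bar>b n\<bar> * c n))" by (rule summable_mult[OF s])
    show "\<forall>\<^sub>F (n, R) in at_top \<times>\<^sub>F at_top. norm (b n * ?I n R) \<le> V * (\<bar>b n\<bar> * c n)"
      unfolding eventually_prod_filter
      by (rule exI[of _ "\<lambda>_. True"], rule exI[of _ "\<lambda>R. 0 \<le> R"])
         (use bound eventually_ge_at_top[of "0::real"] in auto)
  qed simp
  moreover have "(\<Sum>n. b n * ?I n R) = integral {-R..R} (\<lambda>z. w' z * nonlocal b w z)" for R
  proof -
    have "(\<lambda>n. integral {-R..R} (\<lambda>z. b n * (w' z * second_diff n w z))) sums
        integral {-R..R} (\<lambda>z. \<Sum>n. b n * (w' z * second_diff n w z))"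
    proof (rule integral_series)
      show "continuous_on {-R..R} (\<lambda>z. b n * (w' z * second_diff n w z))" for n
        by (intro continuous_intros continuous_on_subset[OF cws]) auto
      show "\<bar>b n * (w' z * second_diff n w z)\<bar> \<le> \<bar>b n\<bar> * (V * (4 * U))" for n z
        unfolding abs_mult using V0 by (intro mult_left_mono mult_mono V abs_second_diff_le[OF U]) auto
      show "summable (\<lambda>n. \<bar>b n\<bar> * (V * (4 * U)))" by (rule summable_mult2[OF b])
    qed
    moreover have "(\<Sum>n. b n * (w' z * second_diff n w z)) = w' z * nonlocal b w z" for z
      unfolding nonlocal_def
      using suminf_mult[OF summable_rabs_cancel[OF summable_nonlocal[OF b U]], of "w' z"]
      by (simp add: mult.left_commute)
    ultimately show ?thesis by (simp add: sums_iff)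
  qed
  ultimately show ?thesis by simp
qed

lemma integral_derivative_square_le:
  assumes dv: "\<And>x. (v has_real_derivative v' x) (at x)" and dv': "\<And>x. (v' has_real_derivative v'' x) (at x)"
    and cv'': "continuous_on UNIV v''"
    and A: "\<And>x. \<bar>v x\<bar> \<le> A" and B: "\<And>x. \<bar>v' x\<bar> \<le> B" and D: "\<And>x. \<bar>v'' x\<bar> \<le> D"
    and I: "integral {-R..R} (\<lambda>x. \<bar>v x\<bar>) \<le> I" and R: "0 \<le> R"
  shows "integral {-R..R} (\<lambda>x. (v' x)\<^sup>2) \<le> 2 * (A * B) + D * I"
proof -
  have cv: "continuous_on UNIV v" by (rule DERIV_imp_continuous[OF dv])
  have cv': "continuous_on UNIV v'" by (rule DERIV_imp_continuous[OF dv'])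
  have D0: "0 \<le> D" using D[of 0] by linarith
  have "((\<lambda>x. v x * v' x) has_real_derivative (v' x)\<^sup>2 + v x * v'' x) (at x)" for x
    by (rule derivative_eq_intros dv dv' refl | simp add: power2_eq_square)+
  then have "((\<lambda>x. (v' x)\<^sup>2 + v x * v'' x) has_integral (v R * v' R - v (-R) * v' (-R))) {-R..R}"
    using R by (intro has_integral_derivative) auto
  moreover have "\<bar>v x * v' x\<bar> \<le> A * B" for x
    unfolding abs_mult by (intro mult_mono A B) (use A[of x] in auto)
  then have "v R * v' R - v (-R) * v' (-R) \<le> 2 * (A * B)"
    using abs_le_iff[of "v R * v' R" "A * B"] abs_le_iff[of "v (-R) * v' (-R)" "A * B"] by force
  ultimately have 1: "integral {-R..R} (\<lambda>x. (v' x)\<^sup>2 + v x * v'' x) \<le> 2 * (A * B)"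
    by (simp add: integral_unique)
  have "integral {-R..R} (\<lambda>x. (v' x)\<^sup>2) \<le> integral {-R..R} (\<lambda>x. ((v' x)\<^sup>2 + v x * v'' x) + D * \<bar>v x\<bar>)"
  proof (rule integral_le)
    fix x
    have "\<bar>v x * v'' x\<bar> \<le> \<bar>v x\<bar> * D" unfolding abs_mult by (intro mult_left_mono D) auto
    then show "(v' x)\<^sup>2 \<le> ((v' x)\<^sup>2 + v x * v'' x) + D * \<bar>v x\<bar>" by (simp add: mult.commute)
  qed (intro integrable_on_interval continuous_intros cv cv' cv'')+
  also have "\<dots> = integral {-R..R} (\<lambda>x. (v' x)\<^sup>2 + v x * v'' x) + D * integral {-R..R} (\<lambda>x. \<bar>v x\<bar>)"
  proof (rule integral_unique, rule has_integral_add[OF _ has_integral_mult_right])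
  qed (rule integrable_integral, intro integrable_on_interval continuous_intros cv cv' cv'')+
  also have "\<dots> \<le> 2 * (A * B) + D * I" by (intro add_mono 1 mult_left_mono I D0)
  finally show ?thesis .
qed

lemma integral_square_le:
  fixes v :: "real \<Rightarrow> real"
  assumes cv: "continuous_on UNIV v" and A: "\<And>x. \<bar>v x\<bar> \<le> A" and I: "integral {-R..R} (\<lambda>x. \<bar>v x\<bar>) \<le> I"
  shows "integral {-R..R} (\<lambda>x. (v x)\<^sup>2) \<le> A * I"
proof -
  have "integral {-R..R} (\<lambda>x. (v x)\<^sup>2) \<le> integral {-R..R} (\<lambda>x. A * \<bar>v x\<bar>)"
  proof (rule integral_le)
    show "(v x)\<^sup>2 \<le> A * \<bar>v x\<bar>" for x
      using mult_right_mono[OF A, of "\<bar>v x\<bar>" x] by (simp add: power2_eq_square)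
  qed (intro integrable_on_interval continuous_intros cv)+
  also have "\<dots> \<le> A * I" using mult_left_mono[OF I, of A] A[of 0] by auto
  finally show ?thesis .
qed

context standing_wave
begin

text \<open>
  Multiplying by \<open>w'\<close> and integrating over \<open>[-R, R]\<close> leaves \<open>\<mu> \<integral> \<phi> w'\<close> equal to the work of the coupling minus
  the change of the energy. Both tend to \<open>0\<close>, the latter because the two wells have equal depth, while the
  integral stays above \<open>\<kappa>\<close>.
\<close>
lemma multiplier_vanishes:
  assumes b: "summable (\<lambda>n. \<bar>b n\<bar>)"
    and dw: "\<And>x. (w has_real_derivative w' x) (at x)" and dw': "\<And>x. (w' has_real_derivative w'' x) (at x)"
    and eq: "\<And>x. w'' x = \<epsilon> * nonlocal b w x - f (w x) - \<mu> * \<phi> x"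
    and lim: "(w \<longlongrightarrow> 0) at_bot" "(w \<longlongrightarrow> 1) at_top" and lim': "(w' \<longlongrightarrow> 0) at_bot" "(w' \<longlongrightarrow> 0) at_top"
    and U: "\<And>x. \<bar>w x\<bar> \<le> U" and V: "\<And>x. \<bar>w' x\<bar> \<le> V"
    and c: "\<And>n R. 0 \<le> R \<Longrightarrow> integral {-R..R} (\<lambda>z. \<bar>second_diff n w z\<bar>) \<le> c n"
    and s: "summable (\<lambda>n. \<bar>b n\<bar> * c n)"
    and \<kappa>: "\<kappa> > 0" "\<And>R. 1 \<le> R \<Longrightarrow> \<kappa> \<le> integral {-R..R} (\<lambda>z. \<phi> z * w' z)"
  shows "\<mu> = 0"
proof -
  have cw: "continuous_on UNIV w" by (rule DERIV_imp_continuous[OF dw])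
  have cw': "continuous_on UNIV w'" by (rule DERIV_imp_continuous[OF dw'])
  have cN: "continuous_on UNIV (nonlocal b w)" by (rule continuous_nonlocal[OF b U cw])
  let ?E = "\<lambda>x. (w' x)\<^sup>2 / 2 + primitive f (w x)"
  have dE: "(?E has_real_derivative w' x * (\<epsilon> * nonlocal b w x - \<mu> * \<phi> x)) (at x)" for x
  proof -
    have "(?E has_real_derivative w' x * w'' x + f (w x) * w' x) (at x)"
      by (rule derivative_eq_intros dw dw' continuous_f refl | simp)+
    then show ?thesis unfolding eq by (simp add: algebra_simps)
  qed
  have Etop: "(?E \<longlongrightarrow> 0\<^sup>2 / 2 + primitive f 1) at_top"
    by (intro tendsto_intros lim' filterlim_compose[OF F_tendsto lim(2)]) simp
  have Ebot: "(?E \<longlongrightarrow> 0\<^sup>2 / 2 + primitive f 0) at_bot"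
    by (intro tendsto_intros lim' filterlim_compose[OF F_tendsto lim(1)]) simp
  have E: "((\<lambda>R. ?E R - ?E (- R)) \<longlongrightarrow> 0) at_top"
    using tendsto_diff[OF Etop, of "\<lambda>R. ?E (- R)" 0] Ebot F1 by (simp add: filterlim_at_bot_mirror)
  let ?N = "\<lambda>R. integral {-R..R} (\<lambda>z. w' z * nonlocal b w z)"
  have N: "(?N \<longlongrightarrow> 0) at_top"
    by (rule nonlocal_work_tendsto_zero[OF b dw cw' lim lim' U V c s])
  have "((\<lambda>R. \<bar>\<epsilon> * ?N R - (?E R - ?E (- R))\<bar>) \<longlongrightarrow> \<bar>\<epsilon> * 0 - 0\<bar>) at_top"
    by (intro tendsto_intros N E)
  moreover have "\<forall>\<^sub>F R in at_top. \<bar>\<mu>\<bar> * \<kappa> \<le> \<bar>\<epsilon> * ?N R - (?E R - ?E (- R))\<bar>"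
    using eventually_ge_at_top[of 1]
  proof eventually_elim
    case (elim R)
    let ?P = "integral {-R..R} (\<lambda>z. \<phi> z * w' z)"
    have "((\<lambda>x. \<epsilon> * (w' x * nonlocal b w x) - \<mu> * (\<phi> x * w' x)) has_integral \<epsilon> * ?N R - \<mu> * ?P) {-R..R}"
      by (intro has_integral_diff has_integral_mult_right integrable_integral integrable_on_interval
          continuous_intros cw' cN continuous_\<phi>)
    moreover have "((\<lambda>x. w' x * (\<epsilon> * nonlocal b w x - \<mu> * \<phi> x)) has_integral (?E R - ?E (-R))) {-R..R}"
      using elim by (intro has_integral_derivative dE) auto
    then have "((\<lambda>x. \<epsilon> * (w' x * nonlocal b w x) - \<mu> * (\<phi> x * w' x)) has_integral (?E R - ?E (-R))) {-R..R}"
      by (simp add: algebra_simps)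
    ultimately have "\<epsilon> * ?N R - \<mu> * ?P = ?E R - ?E (-R)" by (rule has_integral_unique)
    then have "\<epsilon> * ?N R - (?E R - ?E (- R)) = \<mu> * ?P" by linarith
    then have "\<bar>\<epsilon> * ?N R - (?E R - ?E (- R))\<bar> = \<bar>\<mu>\<bar> * \<bar>?P\<bar>" by (simp only: abs_mult)
    moreover have "\<bar>\<mu>\<bar> * \<kappa> \<le> \<bar>\<mu>\<bar> * \<bar>?P\<bar>" using \<kappa>(2)[OF elim] by (intro mult_left_mono) auto
    ultimately show ?case by simp
  qed
  ultimately have "\<bar>\<mu>\<bar> * \<kappa> \<le> \<bar>\<epsilon> * 0 - 0\<bar>"
    by (intro tendsto_lowerbound) auto
  then show ?thesis using \<kappa>(1) by (simp add: mult_le_0_iff)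
qed

text \<open>
  The nonlinear part of \<open>f\<close> at the front; it is Lipschitz with a constant proportional to the radius.
\<close>
definition remainder :: "real \<Rightarrow> real \<Rightarrow> real" where
  "remainder x s = f (u x + s) - f (u x) - deriv f (u x) * s"

lemma remainder_lipschitz:
  "\<exists>M>0. \<forall>r x s t. r \<le> 1 \<longrightarrow> \<bar>s\<bar> \<le> r \<longrightarrow> \<bar>t\<bar> \<le> r \<longrightarrow>
     \<bar>remainder x s - remainder x t\<bar> \<le> M * r * \<bar>s - t\<bar>"
proof -
  have "bounded (deriv (deriv f) ` {-1..2})"
    by (intro compact_imp_bounded compact_continuous_image continuous_on_subset[OF continuous_f'']) auto
  then obtain L where L: "\<forall>x\<in>{-1..2}. \<bar>deriv (deriv f) x\<bar> \<le> L"
    unfolding bounded_iff real_norm_def by blast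
  define M where "M = \<bar>L\<bar> + 1"
  have M: "M > 0" by (simp add: M_def)
  have f': "\<bar>deriv f s - deriv f t\<bar> \<le> M * \<bar>s - t\<bar>" if "s \<in> {-1..2}" "t \<in> {-1..2}" for s t
  proof (rule field_differentiable_bound[of "{-1..2}" "deriv f" "deriv (deriv f)" M s t, unfolded real_norm_def])
    show "\<bar>deriv (deriv f) z\<bar> \<le> M" if "z \<in> {-1..2}" for z
      using L[rule_format, OF that] by (simp add: M_def)
  qed (use that has_field_derivative_at_within[OF DERIV_f'] in auto)
  have "\<bar>remainder x s - remainder x t\<bar> \<le> M * r * \<bar>s - t\<bar>"
    if r: "r \<le> 1" "\<bar>s\<bar> \<le> r" "\<bar>t\<bar> \<le> r" for r x s t
  proof -
    have d: "(remainder x has_real_derivative deriv f (u x + y) - deriv f (u x)) (at y within {-r..r})" for y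
    proof -
      have "((\<lambda>s. f (u x + s)) has_real_derivative deriv f (u x + y)) (at y)"
        using DERIV_f[of "u x + y"] by (simp add: DERIV_shift add.commute[of "u x"])
      then have "(remainder x has_real_derivative deriv f (u x + y) - 0 - deriv f (u x) * 1) (at y)"
        unfolding remainder_def[abs_def] by (intro DERIV_diff DERIV_const DERIV_cmult DERIV_ident)
      then show ?thesis by (simp add: has_field_derivative_at_within)
    qed
    have b: "\<bar>deriv f (u x + y) - deriv f (u x)\<bar> \<le> M * r" if y: "y \<in> {-r..r}" for y
    proof -
      have "\<bar>deriv f (u x + y) - deriv f (u x)\<bar> \<le> M * \<bar>u x + y - u x\<bar>"
        by (rule f') (use u_pos[of x] u_less_1[of x] y r in auto)
      also have "\<dots> \<le> M * r" using y M by (intro mult_left_mono) auto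
      finally show ?thesis .
    qed
    show ?thesis
      using field_differentiable_bound[of "{-r..r}" "remainder x" "\<lambda>y. deriv f (u x + y) - deriv f (u x)" "M * r" s t]
        d b r by (auto simp: abs_le_iff)
  qed
  then show ?thesis using M by blast
qed

lemma remainder_0 [simp]: "remainder x 0 = 0"
  by (simp add: remainder_def)

end

section \<open>The contraction\<close>

text \<open>
  The integral bound is stated on bounded intervals, where uniform convergence preserves it. Together with
  the supremum bound it makes the correction square integrable.
\<close>
definition small_profile :: "real \<Rightarrow> (real \<Rightarrow> real) \<Rightarrow> bool" where
  "small_profile r v \<longleftrightarrow> continuous_on UNIV v \<and> (\<forall>x. \<bar>v x\<bar> \<le> r) \<and>
     (\<forall>R\<ge>0. integral {-R..R} (\<lambda>x. \<bar>v x\<bar>) \<le> r)"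

lemma complete_small_profiles: "complete {v. small_profile r (apply_bcontfun v)}"
proof -
  have "closed {v. small_profile r (apply_bcontfun v)}"
    unfolding closed_sequential_limits
  proof (intro allI impI, elim conjE)
    fix s :: "nat \<Rightarrow> real \<Rightarrow>\<^sub>C real" and l
    assume s: "\<forall>n. s n \<in> {v. small_profile r (apply_bcontfun v)}" and lim: "s \<longlonglongrightarrow> l"
    have d0: "(\<lambda>n. dist (s n) l) \<longlonglongrightarrow> 0" using lim by (rule tendsto_dist_iff[THEN iffD1])
    have sn: "continuous_on UNIV (apply_bcontfun (s n))" "\<bar>apply_bcontfun (s n) x\<bar> \<le> r"
      "0 \<le> R \<Longrightarrow> integral {-R..R} (\<lambda>x. \<bar>apply_bcontfun (s n) x\<bar>) \<le> r" for n x R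
      using s by (auto simp: small_profile_def)
    have near: "\<bar>apply_bcontfun l x\<bar> \<le> \<bar>apply_bcontfun (s n) x\<bar> + dist (s n) l" for n x
      using dist_bounded[of "s n" x l] by (simp add: dist_real_def)
    have "\<bar>apply_bcontfun l x\<bar> \<le> r" for x
    proof (rule LIMSEQ_le_const)
      show "(\<lambda>n. r + dist (s n) l) \<longlonglongrightarrow> r" using tendsto_add[OF tendsto_const d0] by simp
      show "\<exists>N. \<forall>n\<ge>N. \<bar>apply_bcontfun l x\<bar> \<le> r + dist (s n) l"
        using near[of x] sn(2)[of _ x] by (meson add_mono_thms_linordered_semiring(3) order_trans)
    qed
    moreover have "integral {-R..R} (\<lambda>x. \<bar>apply_bcontfun l x\<bar>) \<le> r" if R: "0 \<le> R" for R
    proof (rule LIMSEQ_le_const)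
      show "(\<lambda>n. r + 2 * R * dist (s n) l) \<longlonglongrightarrow> r"
        using tendsto_add[OF tendsto_const tendsto_mult[OF tendsto_const d0], of r "2 * R"] by simp
      have "integral {-R..R} (\<lambda>x. \<bar>apply_bcontfun l x\<bar>) \<le> r + 2 * R * dist (s n) l" for n
      proof -
        have "integral {-R..R} (\<lambda>x. \<bar>apply_bcontfun l x\<bar>) \<le>
            integral {-R..R} (\<lambda>x. \<bar>apply_bcontfun (s n) x\<bar> + dist (s n) l)"
          by (rule integral_le) (intro integrable_on_interval continuous_intros near continuous_on_apply_bcontfun)+
        also have "\<dots> = integral {-R..R} (\<lambda>x. \<bar>apply_bcontfun (s n) x\<bar>) + integral {-R..R} (\<lambda>x. dist (s n) l)"
          by (rule integral_add) (intro integrable_on_interval continuous_intros continuous_on_apply_bcontfun)+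
        also have "\<dots> \<le> r + 2 * R * dist (s n) l" using sn(3)[OF R, of n] R by simp
        finally show ?thesis .
      qed
      then show "\<exists>N. \<forall>n\<ge>N. integral {-R..R} (\<lambda>x. \<bar>apply_bcontfun l x\<bar>) \<le> r + 2 * R * dist (s n) l" by blast
    qed
    ultimately show "l \<in> {v. small_profile r (apply_bcontfun v)}" by (simp add: small_profile_def)
  qed
  then show ?thesis by (simp add: complete_eq_closed)
qed

locale coupled_wave = standing_wave +
  fixes b :: "nat \<Rightarrow> real"
  assumes b0: "summable (\<lambda>n. \<bar>b n\<bar>)" and b1: "summable (\<lambda>n. \<bar>b n\<bar> * real n)"
begin

definition coupling_mass :: real where "coupling_mass = (\<Sum>n. \<bar>b n\<bar>)"

text \<open>
  Bounds the supremum and the integral of \<open>\<bar>N u\<bar>\<close> at once; the summand \<open>1\<close> makes it positive.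
\<close>
definition front_bound :: real where "front_bound = 4 * coupling_mass + (\<Sum>n. \<bar>b n\<bar> * (2 * real n)) + 1"

definition forcing :: "real \<Rightarrow> (real \<Rightarrow> real) \<Rightarrow> real \<Rightarrow> real" where
  "forcing \<epsilon> v x = \<epsilon> * nonlocal b (\<lambda>x. u x + v x) x - remainder x (v x)"

lemma coupling_mass_nonneg: "0 \<le> coupling_mass"
  unfolding coupling_mass_def by (rule suminf_nonneg[OF b0]) simp

lemma summable_translation_bounds: "summable (\<lambda>n. \<bar>b n\<bar> * (2 * real n))"
  using summable_mult[OF b1, of 2] by (simp add: mult.left_commute)

lemma front_bound_pos: "0 < front_bound"
  unfolding front_bound_def using coupling_mass_nonneg suminf_nonneg[OF summable_translation_bounds] by (simp add: add_nonneg_pos)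

lemma abs_u_le: "\<bar>u x\<bar> \<le> 1"
  using u_pos[of x] u_less_1[of x] by simp

lemma integral_second_diff_u: "0 \<le> R \<Longrightarrow> integral {-R..R} (\<lambda>z. \<bar>second_diff n u z\<bar>) \<le> 2 * real n"
  by (rule integral_abs_second_diff_monotone_le[OF continuous_u u_mono])
     (use u_pos u_less_1 in \<open>auto simp: less_imp_le\<close>)

lemma nonlocal_u_bounds:
  "\<bar>nonlocal b u x\<bar> \<le> front_bound" "0 \<le> R \<Longrightarrow> integral {-R..R} (\<lambda>z. \<bar>nonlocal b u z\<bar>) \<le> front_bound"
proof -
  show "\<bar>nonlocal b u x\<bar> \<le> front_bound"
    using abs_nonlocal_le[OF b0, where u = u and U = 1 and z = x] abs_u_le suminf_nonneg[OF summable_translation_bounds] by (simp add: front_bound_def coupling_mass_def)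
  assume R: "0 \<le> R"
  show "integral {-R..R} (\<lambda>z. \<bar>nonlocal b u z\<bar>) \<le> front_bound"
    using integral_abs_nonlocal_le[OF b0 abs_u_le continuous_u integral_second_diff_u[OF R] summable_translation_bounds]
      coupling_mass_nonneg by (simp add: front_bound_def)
qed

lemma nonlocal_small_bounds:
  assumes v: "small_profile r v"
  shows "\<bar>nonlocal b v x\<bar> \<le> 4 * coupling_mass * r" "0 \<le> R \<Longrightarrow> integral {-R..R} (\<lambda>z. \<bar>nonlocal b v z\<bar>) \<le> 4 * coupling_mass * r"
proof -
  have cv: "continuous_on UNIV v" and s: "\<And>x. \<bar>v x\<bar> \<le> r" and I: "\<And>R. 0 \<le> R \<Longrightarrow> integral {-R..R} (\<lambda>x. \<bar>v x\<bar>) \<le> r"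
    using v by (auto simp: small_profile_def)
  show "\<bar>nonlocal b v x\<bar> \<le> 4 * coupling_mass * r"
    unfolding coupling_mass_def by (rule abs_nonlocal_le[OF b0 s])
  assume R: "0 \<le> R"
  have "integral {-R..R} (\<lambda>z. \<bar>nonlocal b v z\<bar>) \<le> (\<Sum>n. \<bar>b n\<bar> * (4 * r))"
    by (rule integral_abs_nonlocal_le[OF b0 s cv integral_abs_second_diff_le[OF cv I R] summable_mult2[OF b0]])
  also have "\<dots> = 4 * coupling_mass * r" using suminf_mult2[OF b0, of "4 * r"] by (simp add: coupling_mass_def)
  finally show "integral {-R..R} (\<lambda>z. \<bar>nonlocal b v z\<bar>) \<le> 4 * coupling_mass * r" .
qed

lemma continuous_forcing:
  assumes cv: "continuous_on UNIV v" and s: "\<And>x. \<bar>v x\<bar> \<le> r"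
  shows "continuous_on UNIV (forcing \<epsilon> v)"
proof -
  have "\<bar>u x + v x\<bar> \<le> 1 + r" for x using abs_u_le[of x] s[of x] by linarith
  then have "continuous_on UNIV (nonlocal b (\<lambda>x. u x + v x))"
    by (rule continuous_nonlocal[OF b0]) (intro continuous_intros continuous_u cv)
  moreover have "continuous_on UNIV (\<lambda>x. remainder x (v x))"
    unfolding remainder_def
    by (intro continuous_intros continuous_on_compose2[OF continuous_f] continuous_u cv continuous_q) auto
  ultimately show ?thesis unfolding forcing_def[abs_def] by (intro continuous_intros)
qed

lemma forcing_bounds:
  assumes M: "\<And>r x s t. r \<le> 1 \<Longrightarrow> \<bar>s\<bar> \<le> r \<Longrightarrow> \<bar>t\<bar> \<le> r \<Longrightarrow>
      \<bar>remainder x s - remainder x t\<bar> \<le> M * r * \<bar>s - t\<bar>" "0 \<le> M"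
    and v: "small_profile r v" and r: "r \<le> 1" and e: "0 \<le> \<epsilon>"
  defines "m \<equiv> \<epsilon> * front_bound + (\<epsilon> * (4 * coupling_mass) + M * r) * r"
  shows "\<bar>forcing \<epsilon> v x\<bar> \<le> m" "0 \<le> R \<Longrightarrow> integral {-R..R} (\<lambda>x. \<bar>forcing \<epsilon> v x\<bar>) \<le> m"
proof -
  have cv: "continuous_on UNIV v" and s: "\<And>x. \<bar>v x\<bar> \<le> r" and I: "\<And>R. 0 \<le> R \<Longrightarrow> integral {-R..R} (\<lambda>x. \<bar>v x\<bar>) \<le> r"
    using v by (auto simp: small_profile_def)
  have r0: "0 \<le> r" using s[of 0] by linarith
  have rem: "\<bar>remainder x (v x)\<bar> \<le> M * r * \<bar>v x\<bar>" for x
    using M(1)[of r "v x" 0 x] r s[of x] r0 by simp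
  have pt: "\<bar>forcing \<epsilon> v x\<bar> \<le> \<epsilon> * \<bar>nonlocal b u x\<bar> + \<epsilon> * \<bar>nonlocal b v x\<bar> + M * r * \<bar>v x\<bar>" for x
  proof -
    have "\<epsilon> * nonlocal b (\<lambda>x. u x + v x) x = \<epsilon> * nonlocal b u x + \<epsilon> * nonlocal b v x"
      using nonlocal_add[OF b0 abs_u_le s] by (simp add: distrib_left)
    moreover have "\<bar>\<epsilon> * nonlocal b w x\<bar> = \<epsilon> * \<bar>nonlocal b w x\<bar>" for w using e by (simp add: abs_mult)
    ultimately show ?thesis unfolding forcing_def using rem[of x] by (smt (verit))
  qed
  have Mr: "0 \<le> M * r" using M(2) r0 by simp
  show "\<bar>forcing \<epsilon> v x\<bar> \<le> m"
  proof -
    have "\<bar>forcing \<epsilon> v x\<bar> \<le> \<epsilon> * front_bound + \<epsilon> * (4 * coupling_mass * r) + M * r * r"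
      by (rule order_trans[OF pt])
         (intro add_mono mult_left_mono nonlocal_u_bounds nonlocal_small_bounds[OF v] s e Mr)
    also have "\<dots> = m" by (simp add: m_def algebra_simps)
    finally show ?thesis .
  qed
  assume R: "0 \<le> R"
  have cN: "continuous_on UNIV (nonlocal b v)" by (rule continuous_nonlocal[OF b0 s cv])
  have cNu: "continuous_on UNIV (nonlocal b u)" by (rule continuous_nonlocal[OF b0 abs_u_le continuous_u])
  have "integral {-R..R} (\<lambda>x. \<bar>forcing \<epsilon> v x\<bar>) \<le>
      integral {-R..R} (\<lambda>x. \<epsilon> * \<bar>nonlocal b u x\<bar> + \<epsilon> * \<bar>nonlocal b v x\<bar> + M * r * \<bar>v x\<bar>)"
    by (rule integral_le) (intro integrable_on_interval continuous_intros continuous_forcing[OF cv s] cN cNu cv pt)+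
  also have "\<dots> = \<epsilon> * integral {-R..R} (\<lambda>x. \<bar>nonlocal b u x\<bar>) + \<epsilon> * integral {-R..R} (\<lambda>x. \<bar>nonlocal b v x\<bar>)
      + M * r * integral {-R..R} (\<lambda>x. \<bar>v x\<bar>)"
  proof (rule integral_unique, intro has_integral_add has_integral_mult_right)
  qed (rule integrable_integral, intro integrable_on_interval continuous_intros cN cNu cv)+
  also have "\<dots> \<le> \<epsilon> * front_bound + \<epsilon> * (4 * coupling_mass * r) + M * r * r"
    by (intro add_mono mult_left_mono nonlocal_u_bounds nonlocal_small_bounds[OF v] I e Mr R)
  also have "\<dots> = m" by (simp add: m_def algebra_simps)
  finally show "integral {-R..R} (\<lambda>x. \<bar>forcing \<epsilon> v x\<bar>) \<le> m" .
qed

lemma forcing_lipschitz: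
  assumes M: "\<And>r x s t. r \<le> 1 \<Longrightarrow> \<bar>s\<bar> \<le> r \<Longrightarrow> \<bar>t\<bar> \<le> r \<Longrightarrow>
      \<bar>remainder x s - remainder x t\<bar> \<le> M * r * \<bar>s - t\<bar>" "0 \<le> M"
    and r: "r \<le> 1" and e: "0 \<le> \<epsilon>"
    and v: "\<And>x. \<bar>v x\<bar> \<le> r" and w: "\<And>x. \<bar>w x\<bar> \<le> r" and d: "\<And>x. \<bar>v x - w x\<bar> \<le> d"
  shows "\<bar>forcing \<epsilon> v x - forcing \<epsilon> w x\<bar> \<le> (\<epsilon> * (4 * coupling_mass) + M * r) * d"
proof -
  have r0: "0 \<le> r" using v[of 0] by linarith
  have "nonlocal b (\<lambda>x. (u x + w x) + (v x - w x)) x = nonlocal b (\<lambda>x. u x + w x) x + nonlocal b (\<lambda>x. v x - w x) x"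
  proof (rule nonlocal_add[OF b0 _ d])
    show "\<bar>u x + w x\<bar> \<le> 1 + r" for x using abs_u_le[of x] w[of x] by linarith
  qed
  then have eq: "forcing \<epsilon> v x - forcing \<epsilon> w x
      = \<epsilon> * nonlocal b (\<lambda>x. v x - w x) x - (remainder x (v x) - remainder x (w x))"
    by (simp add: forcing_def algebra_simps)
  have "\<bar>\<epsilon> * nonlocal b (\<lambda>x. v x - w x) x\<bar> \<le> \<epsilon> * (4 * coupling_mass * d)"
    using e mult_left_mono[OF abs_nonlocal_le[OF b0 d, where z = x] e] by (simp add: abs_mult coupling_mass_def)
  moreover have "\<bar>remainder x (v x) - remainder x (w x)\<bar> \<le> M * r * d"
    by (rule order_trans[OF M(1)[OF r v w] mult_left_mono[OF d]]) (use M r0 in simp)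
  ultimately have "\<bar>forcing \<epsilon> v x - forcing \<epsilon> w x\<bar> \<le> \<epsilon> * (4 * coupling_mass * d) + M * r * d"
    unfolding eq by linarith
  then show ?thesis by (simp add: algebra_simps)
qed

text \<open>
  The forcing of a profile of size \<open>r\<close> is at most \<open>\<epsilon> front_bound + q r\<close> with Lipschitz constant
  \<open>q = 4 \<epsilon> coupling_mass + M r\<close>. With \<open>K\<close> bounding the solution operator, the choice \<open>r = 2 K front_bound \<epsilon>\<close>
  gives each of \<open>K \<epsilon> front_bound\<close> and \<open>K q r\<close> half of the radius as soon as \<open>K q \<le> 1 / 2\<close>, which is also
  the contraction condition.
\<close>
lemma projected_solution:
  "\<exists>K M. K > 0 \<and> M > 0 \<and> (\<forall>\<epsilon> r. 0 < \<epsilon> \<longrightarrow> r = 2 * K * front_bound * \<epsilon> \<longrightarrow> r \<le> 1 \<longrightarrow> 2 * K * (\<epsilon> * (4 * coupling_mass) + M * r) \<le> 1 \<longrightarrow>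
     (\<exists>v. small_profile r v \<and> v = solve (forcing \<epsilon> v) \<and> (\<forall>x. \<bar>solve' (forcing \<epsilon> v) x\<bar> \<le> r) \<and>
        small_profile (r / K) (forcing \<epsilon> v)))"
proof -
  obtain S where S: "S > 0" "\<And>g m x. continuous_on UNIV g \<Longrightarrow> (\<forall>x. \<bar>g x\<bar> \<le> m) \<Longrightarrow>
     \<bar>solve g x\<bar> \<le> S * m \<and> \<bar>solve' g x\<bar> \<le> S * m" using solve_sup_bound by blast
  obtain L where L: "L > 0" "\<And>g m R. continuous_on UNIV g \<Longrightarrow> (\<forall>x. \<bar>g x\<bar> \<le> m) \<Longrightarrow> 0 \<le> R \<Longrightarrow>
     integral {-R..R} (\<lambda>x. \<bar>g x\<bar>) \<le> m \<Longrightarrow> integral {-R..R} (\<lambda>x. \<bar>solve g x\<bar>) \<le> L * m"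
    using solve_L1_bound by blast
  obtain M where M: "M > 0" "\<And>r x s t. r \<le> 1 \<Longrightarrow> \<bar>s\<bar> \<le> r \<Longrightarrow> \<bar>t\<bar> \<le> r \<Longrightarrow>
      \<bar>remainder x s - remainder x t\<bar> \<le> M * r * \<bar>s - t\<bar>" using remainder_lipschitz by blast
  define K where "K = max S L"
  have K: "K > 0" "S \<le> K" "L \<le> K" using S by (auto simp: K_def)
  have "\<exists>v. small_profile r v \<and> v = solve (forcing \<epsilon> v) \<and> (\<forall>x. \<bar>solve' (forcing \<epsilon> v) x\<bar> \<le> r) \<and>
        small_profile (r / K) (forcing \<epsilon> v)"
    if e: "0 < \<epsilon>" and r_def: "r = 2 * K * front_bound * \<epsilon>" and r1: "r \<le> 1"
      and small: "2 * K * (\<epsilon> * (4 * coupling_mass) + M * r) \<le> 1" for \<epsilon> r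
  proof -
    define q where "q = \<epsilon> * (4 * coupling_mass) + M * r"
    have r0: "0 < r" using e K front_bound_pos by (simp add: r_def)
    have Kq: "K * q \<le> 1 / 2" using small by (simp add: q_def)
    have q0: "0 \<le> q" using e coupling_mass_nonneg M r0 by (simp add: q_def)
    have m: "\<epsilon> * front_bound + q * r \<le> r / K"
    proof -
      have "K * (q * r) \<le> r / 2" using mult_right_mono[OF Kq, of r] r0 by (simp add: mult.assoc)
      moreover have "K * (\<epsilon> * front_bound) = r / 2" by (simp add: r_def)
      ultimately have "K * (\<epsilon> * front_bound + q * r) \<le> r" by (simp add: distrib_left)
      then show ?thesis using K by (simp add: field_simps)
    qed
    have M0: "0 \<le> M" and e0: "0 \<le> \<epsilon>" using M e by auto
    note fb = forcing_bounds[OF M(2) M0 _ r1 e0, folded q_def]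
    have force: "small_profile (r / K) (forcing \<epsilon> v)" if v: "small_profile r v" for v
      using v order_trans[OF fb(1)[OF _ _ _ v] m] order_trans[OF fb(2)[OF _ _ _ v] m] continuous_forcing[of v r]
      by (auto simp: small_profile_def)
    have solve: "small_profile r (solve g)" "\<bar>solve' g x\<bar> \<le> r" if g: "small_profile (r / K) g" for g x
    proof -
      have cg: "continuous_on UNIV g" and g1: "\<forall>x. \<bar>g x\<bar> \<le> r / K"
        and g2: "\<And>R. 0 \<le> R \<Longrightarrow> integral {-R..R} (\<lambda>x. \<bar>g x\<bar>) \<le> r / K" using g by (auto simp: small_profile_def)
      have le: "S * (r / K) \<le> r" "L * (r / K) \<le> r"
        using mult_right_mono[OF K(2), of "r / K"] mult_right_mono[OF K(3), of "r / K"] r0 K(1) by auto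
      show "\<bar>solve' g x\<bar> \<le> r" using S(2)[OF cg g1, of x] le by linarith
      have "\<bar>solve g x\<bar> \<le> r" for x using S(2)[OF cg g1, of x] le by linarith
      moreover have "integral {-R..R} (\<lambda>x. \<bar>solve g x\<bar>) \<le> r" if "0 \<le> R" for R
        using L(2)[OF cg g1 that g2[OF that]] le by linarith
      moreover have "continuous_on UNIV (solve g)"
        by (rule DERIV_imp_continuous[OF DERIV_solve[OF cg g1[rule_format]]])
      ultimately show "small_profile r (solve g)" by (simp add: small_profile_def)
    qed
    let ?X = "{v. small_profile r (apply_bcontfun v)}"
    define T where "T v = Bcontfun (solve (forcing \<epsilon> (apply_bcontfun v)))" for v
    have T: "apply_bcontfun (T v) = solve (forcing \<epsilon> (apply_bcontfun v))" if v: "v \<in> ?X" for v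
      unfolding T_def using solve(1)[OF force] v
      by (intro Bcontfun_inverse bcontfun_normI[of _ r]) (auto simp: small_profile_def)
    have "\<exists>!v\<in>?X. T v = v"
    proof (rule Banach_fix[OF complete_small_profiles, where c = "1 / 2"])
      have "(0 :: real \<Rightarrow>\<^sub>C real) \<in> ?X" using r0 by (simp add: small_profile_def zero_bcontfun.rep_eq)
      then show "?X \<noteq> {}" by blast
      show "T ` ?X \<subseteq> ?X" using T solve(1)[OF force] by auto
      fix v w assume v: "v \<in> ?X" and w: "w \<in> ?X"
      let ?v = "apply_bcontfun v" and ?w = "apply_bcontfun w"
      have fv: "continuous_on UNIV (forcing \<epsilon> ?v)" "\<And>x. \<bar>forcing \<epsilon> ?v x\<bar> \<le> r / K"
        and fw: "continuous_on UNIV (forcing \<epsilon> ?w)" "\<And>x. \<bar>forcing \<epsilon> ?w x\<bar> \<le> r / K"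
        using force v w by (auto simp: small_profile_def)
      have df: "\<forall>x. \<bar>forcing \<epsilon> ?v x - forcing \<epsilon> ?w x\<bar> \<le> q * dist v w"
        unfolding q_def using v w dist_bounded[of v _ w]
        by (intro allI forcing_lipschitz[OF M(2) M0 r1 e0]) (auto simp: small_profile_def dist_real_def)
      show "dist (T v) (T w) \<le> 1 / 2 * dist v w"
      proof (rule dist_bound)
        fix x
        have "dist (apply_bcontfun (T v) x) (apply_bcontfun (T w) x) = \<bar>solve (\<lambda>x. forcing \<epsilon> ?v x - forcing \<epsilon> ?w x) x\<bar>"
          unfolding T[OF v] T[OF w] dist_real_def by (subst solve_diff[OF fv fw]) (rule refl)
        also have "\<dots> \<le> S * (q * dist v w)"
          using S(2)[OF _ df] fv fw by (auto intro: continuous_intros)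
        also have "\<dots> \<le> K * (q * dist v w)" using K q0 by (intro mult_right_mono) auto
        also have "\<dots> \<le> 1 / 2 * dist v w" using mult_right_mono[OF Kq, of "dist v w"] by (simp add: mult.assoc)
        finally show "dist (apply_bcontfun (T v) x) (apply_bcontfun (T w) x) \<le> 1 / 2 * dist v w" .
      qed
    qed auto
    then obtain v where v: "v \<in> ?X" "T v = v" by blast
    then have "apply_bcontfun v = solve (forcing \<epsilon> (apply_bcontfun v))" using T[OF v(1)] by simp
    then show ?thesis using v(1) force solve(2) by blast
  qed
  then show ?thesis using K(1) M(1) by blast
qed

end

section \<open>Solutions near the front\<close>

lemma has_H2_norm_of_C2:
  assumes dv: "\<And>x. (v has_real_derivative v' x) (at x)" and dv': "\<And>x. (v' has_real_derivative v'' x) (at x)"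
    and cv'': "continuous_on UNIV v''"
    and I0: "\<And>R. 0 \<le> R \<Longrightarrow> integral {-R..R} (\<lambda>x. (v x)\<^sup>2) \<le> A\<^sub>0"
    and I1: "\<And>R. 0 \<le> R \<Longrightarrow> integral {-R..R} (\<lambda>x. (v' x)\<^sup>2) \<le> A\<^sub>1"
    and I2: "\<And>R. 0 \<le> R \<Longrightarrow> integral {-R..R} (\<lambda>x. (v'' x)\<^sup>2) \<le> A\<^sub>2"
  shows "\<exists>N. has_H2_norm v N \<and> N \<le> sqrt (A\<^sub>0 + A\<^sub>1 + A\<^sub>2)"
proof -
  have cv: "continuous_on UNIV v" by (rule DERIV_imp_continuous[OF dv])
  have cv': "continuous_on UNIV v'" by (rule DERIV_imp_continuous[OF dv'])
  have L2: "in_L2 w" "(L2_norm w)\<^sup>2 \<le> A"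
    if cw: "continuous_on UNIV w" and I: "\<And>R. 0 \<le> R \<Longrightarrow> integral {-R..R} (\<lambda>x. (w x)\<^sup>2) \<le> A" for w A
  proof -
    have c2: "continuous_on UNIV (\<lambda>x. (w x)\<^sup>2)" by (intro continuous_intros cw)
    show "in_L2 w"
      using integrable_of_integral_bound(1)[OF c2 _ I] borel_measurable_continuous_onI[OF cw]
      by (simp add: in_L2_def)
    have "0 \<le> (LBINT x. (w x)\<^sup>2)" by (rule Bochner_Integration.integral_nonneg) simp
    then show "(L2_norm w)\<^sup>2 \<le> A"
      using integrable_of_integral_bound(2)[OF c2 _ I] by (simp add: L2_norm_def)
  qed
  have "has_H2_norm v (sqrt ((L2_norm v)\<^sup>2 + (L2_norm v')\<^sup>2 + (L2_norm v'')\<^sup>2))"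
    unfolding has_H2_norm_def
    using has_weak_deriv_of_C1[OF dv cv'] has_weak_deriv_of_C1[OF dv' cv''] L2(1)[OF cv I0] L2(1)[OF cv' I1] L2(1)[OF cv'' I2]
    by blast
  moreover have "sqrt ((L2_norm v)\<^sup>2 + (L2_norm v')\<^sup>2 + (L2_norm v'')\<^sup>2) \<le> sqrt (A\<^sub>0 + A\<^sub>1 + A\<^sub>2)"
    by (intro real_sqrt_le_mono add_mono L2(2) cv I0 cv' I1 cv'' I2)
  ultimately show ?thesis by blast
qed

context standing_wave
begin

text \<open>
  The integral of \<open>\<phi>\<^sup>2\<close> over \<open>[-1, 1]\<close>, a positive lower bound for its integral over all longer intervals \<open>[-R, R]\<close>.
\<close>
definition core_mass :: real where
  "core_mass = primitive (\<lambda>x. (\<phi> x)\<^sup>2) 1 - primitive (\<lambda>x. (\<phi> x)\<^sup>2) (- 1)"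

lemma continuous_\<phi>_square: "continuous_on UNIV (\<lambda>x. (\<phi> x)\<^sup>2)"
  by (intro continuous_intros continuous_\<phi>)

lemma core_mass_pos: "core_mass > 0"
proof -
  have "primitive (\<lambda>x. (\<phi> x)\<^sup>2) (- 1) < primitive (\<lambda>x. (\<phi> x)\<^sup>2) 1"
  proof (rule DERIV_pos_imp_increasing[where f = "primitive (\<lambda>x. (\<phi> x)\<^sup>2)"])
    fix x
    have "0 < (\<phi> x)\<^sup>2" using \<phi>_ne[of x] by simp
    then show "\<exists>y. (primitive (\<lambda>x. (\<phi> x)\<^sup>2) has_real_derivative y) (at x) \<and> 0 < y"
      using DERIV_primitive[OF continuous_\<phi>_square] by blast
  qed simp
  then show ?thesis by (simp add: core_mass_def)
qed

lemma momentum_lower_bound: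
  assumes cv': "continuous_on UNIV v'" and v': "\<And>x. \<bar>v' x\<bar> \<le> r" and R: "1 \<le> R"
  shows "core_mass - r \<le> integral {-R..R} (\<lambda>z. \<phi> z * (\<phi> z + v' z))"
proof -
  let ?P = "primitive (\<lambda>x. (\<phi> x)\<^sup>2)"
  have r0: "0 \<le> r" using v'[of 0] by linarith
  have "core_mass \<le> ?P R - ?P (-R)"
    unfolding core_mass_def using R
    by (intro diff_mono primitive_mono_nonneg[OF continuous_\<phi>_square]) auto
  also have "\<dots> = integral {-R..R} (\<lambda>x. (\<phi> x)\<^sup>2)"
    using R by (subst integral_eq_primitive_diff[OF continuous_\<phi>_square]) auto
  finally have 1: "core_mass \<le> integral {-R..R} (\<lambda>x. (\<phi> x)\<^sup>2)" .
  have 2: "r * integral {-R..R} \<phi> \<le> r" using mult_left_mono[OF integral_\<phi>_le r0] R by simp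
  have "((\<lambda>x. (\<phi> x)\<^sup>2 - r * \<phi> x) has_integral integral {-R..R} (\<lambda>x. (\<phi> x)\<^sup>2) - r * integral {-R..R} \<phi>) {-R..R}"
    by (intro has_integral_diff has_integral_mult_right integrable_integral integrable_on_interval
        continuous_\<phi> continuous_\<phi>_square)
  then have "integral {-R..R} (\<lambda>x. (\<phi> x)\<^sup>2) - r * integral {-R..R} \<phi> = integral {-R..R} (\<lambda>x. (\<phi> x)\<^sup>2 - r * \<phi> x)"
    by (rule integral_unique[symmetric])
  also have "\<dots> \<le> integral {-R..R} (\<lambda>z. \<phi> z * (\<phi> z + v' z))"
  proof (rule integral_le)
    fix x
    have "\<phi> x * (- r) \<le> \<phi> x * v' x"
      using v'[of x] \<phi>_pos[of x] by (intro mult_left_mono) (auto simp: abs_le_iff)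
    then show "(\<phi> x)\<^sup>2 - r * \<phi> x \<le> \<phi> x * (\<phi> x + v' x)"
      by (simp add: power2_eq_square algebra_simps)
  qed (intro integrable_on_interval continuous_intros continuous_\<phi> cv')+
  finally show ?thesis using 1 2 by linarith
qed

end

context coupled_wave
begin

lemma integral_second_diff_sum:
  assumes v: "small_profile r v" and R: "0 \<le> R"
  shows "integral {-R..R} (\<lambda>z. \<bar>second_diff n (\<lambda>x. u x + v x) z\<bar>) \<le> 2 * real n + 4 * r"
proof -
  have cv: "continuous_on UNIV v" and I: "\<And>R. 0 \<le> R \<Longrightarrow> integral {-R..R} (\<lambda>x. \<bar>v x\<bar>) \<le> r"
    using v by (auto simp: small_profile_def)
  have "integral {-R..R} (\<lambda>z. \<bar>second_diff n (\<lambda>x. u x + v x) z\<bar>) \<le>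
      integral {-R..R} (\<lambda>z. \<bar>second_diff n u z\<bar> + \<bar>second_diff n v z\<bar>)"
  proof (rule integral_le)
    show "\<bar>second_diff n (\<lambda>x. u x + v x) z\<bar> \<le> \<bar>second_diff n u z\<bar> + \<bar>second_diff n v z\<bar>" for z
      unfolding second_diff_add by (rule abs_triangle_ineq)
  qed (intro integrable_on_interval continuous_intros continuous_second_diff continuous_u cv)+
  also have "\<dots> = integral {-R..R} (\<lambda>z. \<bar>second_diff n u z\<bar>) + integral {-R..R} (\<lambda>z. \<bar>second_diff n v z\<bar>)"
    by (rule integral_add) (intro integrable_on_interval continuous_intros continuous_second_diff continuous_u cv)+
  also have "\<dots> \<le> 2 * real n + 4 * r"
    by (intro add_mono integral_second_diff_u integral_abs_second_diff_le cv I R)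
  finally show ?thesis .
qed

text \<open>
  The correction is integrable with bounded derivatives, so it and its derivative vanish at infinity and the
  balance applies. The bound on \<open>r\<close> keeps \<open>u' = \<phi> + v'\<close> close enough to \<open>\<phi>\<close> for the integral of \<open>\<phi> u'\<close> to be
  positive.
\<close>
lemma fixed_point_is_solution:
  assumes v: "small_profile r v" and fp: "v = solve (forcing \<epsilon> v)"
    and v': "\<And>x. \<bar>solve' (forcing \<epsilon> v) x\<bar> \<le> r"
    and g: "small_profile k (forcing \<epsilon> v)"
    and r: "r \<le> core_mass / 2"
  shows "multiplier (forcing \<epsilon> v) = 0"
    and "(v has_real_derivative solve' (forcing \<epsilon> v) x) (at x)"
    and "(solve' (forcing \<epsilon> v) has_real_derivative forcing \<epsilon> v x - deriv f (u x) * v x) (at x)"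
proof -
  let ?g = "forcing \<epsilon> v" and ?v' = "solve' (forcing \<epsilon> v)"
  let ?\<mu> = "multiplier ?g"
  have cg: "continuous_on UNIV ?g" and gk: "\<And>x. \<bar>?g x\<bar> \<le> k" using g by (auto simp: small_profile_def)
  have cv: "continuous_on UNIV v" and vr: "\<And>x. \<bar>v x\<bar> \<le> r" and I: "\<And>R. 0 \<le> R \<Longrightarrow> integral {-R..R} (\<lambda>x. \<bar>v x\<bar>) \<le> r"
    using v by (auto simp: small_profile_def)
  have dv: "(v has_real_derivative ?v' x) (at x)" for x
    using DERIV_solve[OF cg gk, of x] fp by simp
  then show "(v has_real_derivative ?v' x) (at x)" .
  define v'' where "v'' x = ?g x - ?\<mu> * \<phi> x - deriv f (u x) * v x" for x
  have dv': "(?v' has_real_derivative v'' x) (at x)" for x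
    using DERIV_solve'[OF cg gk, of x] fp by (simp add: v''_def)
  have cv': "continuous_on UNIV ?v'" by (rule DERIV_imp_continuous[OF dv'])
  have cv'': "continuous_on UNIV v''"
    unfolding v''_def[abs_def] by (intro continuous_intros cg continuous_\<phi> continuous_q cv)
  obtain B where B: "\<And>x. \<phi> x \<le> B" using \<phi>_bounded by blast
  obtain Q where Q: "\<And>x. \<bar>deriv f (u x)\<bar> \<le> Q" using f'_profile_bounded by blast
  define D where "D = k + \<bar>?\<mu>\<bar> * B + Q * r"
  have D: "\<bar>v'' x\<bar> \<le> D" for x
  proof -
    have "\<bar>?\<mu> * \<phi> x\<bar> \<le> \<bar>?\<mu>\<bar> * B"
      unfolding abs_mult using B[of x] \<phi>_pos[of x] by (intro mult_left_mono) auto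
    moreover have "\<bar>deriv f (u x) * v x\<bar> \<le> Q * r"
      unfolding abs_mult using Q[of x] by (intro mult_mono Q vr) auto
    ultimately show ?thesis unfolding v''_def D_def using gk[of x] by linarith
  qed
  have v0: "(v \<longlongrightarrow> 0) at_top" "(v \<longlongrightarrow> 0) at_bot"
    by (rule tendsto_zero_at_top_of_integral_bound[OF dv v' integral_square_le[OF cv vr I]], assumption)
       (rule tendsto_zero_at_bot_of_integral_bound[OF dv v' integral_square_le[OF cv vr I]], assumption)
  have v'0: "(?v' \<longlongrightarrow> 0) at_top" "(?v' \<longlongrightarrow> 0) at_bot"
    by (rule tendsto_zero_at_top_of_integral_bound[OF dv' D integral_derivative_square_le[OF dv dv' cv'' vr v' D I]], assumption+)
       (rule tendsto_zero_at_bot_of_integral_bound[OF dv' D integral_derivative_square_le[OF dv dv' cv'' vr v' D I]], assumption+)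
  show "?\<mu> = 0"
  proof (rule multiplier_vanishes[where w = "\<lambda>x. u x + v x" and w' = "\<lambda>x. \<phi> x + ?v' x"
        and w'' = "\<lambda>x. - f (u x) + v'' x" and \<epsilon> = \<epsilon> and c = "\<lambda>n. 2 * real n + 4 * r" and \<kappa> = "core_mass / 2"
        and U = "1 + r", OF b0])
    obtain V where V: "\<And>x. \<phi> x \<le> V" using \<phi>_bounded by blast
    show "((\<lambda>x. u x + v x) has_real_derivative \<phi> x + ?v' x) (at x)" for x
      by (intro DERIV_add DERIV_u dv)
    show "((\<lambda>x. \<phi> x + ?v' x) has_real_derivative - f (u x) + v'' x) (at x)" for x
      by (intro DERIV_add DERIV_\<phi> dv')
    show "- f (u x) + v'' x = \<epsilon> * nonlocal b (\<lambda>x. u x + v x) x - f (u x + v x) - ?\<mu> * \<phi> x" for x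
      by (simp add: v''_def forcing_def remainder_def)
    show "((\<lambda>x. u x + v x) \<longlongrightarrow> 0) at_bot" "((\<lambda>x. u x + v x) \<longlongrightarrow> 1) at_top"
      using tendsto_add[OF u_at_bot v0(2)] tendsto_add[OF u_at_top v0(1)] by simp_all
    show "((\<lambda>x. \<phi> x + ?v' x) \<longlongrightarrow> 0) at_bot" "((\<lambda>x. \<phi> x + ?v' x) \<longlongrightarrow> 0) at_top"
      using tendsto_add[OF \<phi>_at_bot v'0(2)] tendsto_add[OF \<phi>_at_top v'0(1)] by simp_all
    show "\<bar>u x + v x\<bar> \<le> 1 + r" for x using abs_u_le[of x] vr[of x] by linarith
    show "\<bar>\<phi> x + ?v' x\<bar> \<le> B + r" for x using B[of x] \<phi>_pos[of x] v'[of x] by linarith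
    show "integral {-R..R} (\<lambda>z. \<bar>second_diff n (\<lambda>x. u x + v x) z\<bar>) \<le> 2 * real n + 4 * r" if "0 \<le> R" for n R
      by (rule integral_second_diff_sum[OF v that])
    show "summable (\<lambda>n. \<bar>b n\<bar> * (2 * real n + 4 * r))"
      using summable_add[OF summable_translation_bounds summable_mult2[OF b0, of "4 * r"]] by (simp add: distrib_left)
    show "core_mass / 2 > 0" using core_mass_pos by simp
    show "core_mass / 2 \<le> integral {-R..R} (\<lambda>z. \<phi> z * (\<phi> z + ?v' z))" if "1 \<le> R" for R
      using momentum_lower_bound[OF cv' v' that] r by linarith
  qed
  then show "(?v' has_real_derivative ?g x - deriv f (u x) * v x) (at x)"
    using dv'[of x] by (simp add: v''_def)
qed

theorem nearby_wave:
  "\<exists>\<epsilon>\<^sub>0 C. \<epsilon>\<^sub>0 > 0 \<and> C > 0 \<and> (\<forall>\<epsilon>\<in>{0<..<\<epsilon>\<^sub>0}. \<exists>w w' N. (\<forall>x. \<bar>w x\<bar> \<le> 2) \<and>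
     (\<forall>x. (w has_real_derivative w' x) (at x)) \<and>
     (\<forall>x. (w' has_real_derivative \<epsilon> * nonlocal b w x - f (w x)) (at x)) \<and>
     has_H2_norm (\<lambda>z. w z - u z) N \<and> N \<le> C * \<epsilon>)"
proof -
  obtain K M where K: "K > 0" and M: "M > 0" and sol: "\<And>\<epsilon> r. 0 < \<epsilon> \<Longrightarrow> r = 2 * K * front_bound * \<epsilon> \<Longrightarrow> r \<le> 1 \<Longrightarrow>
      2 * K * (\<epsilon> * (4 * coupling_mass) + M * r) \<le> 1 \<Longrightarrow>
     (\<exists>v. small_profile r v \<and> v = solve (forcing \<epsilon> v) \<and> (\<forall>x. \<bar>solve' (forcing \<epsilon> v) x\<bar> \<le> r) \<and>
        small_profile (r / K) (forcing \<epsilon> v))"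
    using projected_solution by blast
  obtain Q where Q: "Q > 0" "\<And>x. \<bar>deriv f (u x)\<bar> \<le> Q" using f'_profile_bounded by blast
  define P where "P = 1 / K + Q"
  have P: "P > 0" using K Q by (simp add: P_def add_pos_pos)
  (* With r = D2 \<epsilon> the requirements are \<epsilon> D1 \<le> 1 for the contraction, r \<le> 1, and \<epsilon> D3 \<le> 1 for r \<le> core_mass / 2. *)
  define D1 D2 D3 where "D1 = 2 * K * (4 * coupling_mass + 2 * K * M * front_bound)" and "D2 = 2 * K * front_bound"
    and "D3 = 2 * K * front_bound * (2 / core_mass)"
  have D: "D1 \<ge> 0" "D2 > 0" "D3 \<ge> 0"
    using K M front_bound_pos coupling_mass_nonneg core_mass_pos by (auto simp: D1_def D2_def D3_def)
  define \<epsilon>\<^sub>0 where "\<epsilon>\<^sub>0 = 1 / (D1 + D2 + D3)"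
  define C where "C = 2 * K * front_bound * sqrt (3 + P + P\<^sup>2)"
  have "\<epsilon>\<^sub>0 > 0" using D by (simp add: \<epsilon>\<^sub>0_def)
  moreover have "C > 0" using K front_bound_pos P by (auto simp: C_def intro!: mult_pos_pos add_pos_nonneg)
  moreover have "\<exists>w w' N. (\<forall>x. \<bar>w x\<bar> \<le> 2) \<and>
     (\<forall>x. (w has_real_derivative w' x) (at x)) \<and>
     (\<forall>x. (w' has_real_derivative \<epsilon> * nonlocal b w x - f (w x)) (at x)) \<and>
     has_H2_norm (\<lambda>z. w z - u z) N \<and> N \<le> C * \<epsilon>" if \<epsilon>: "\<epsilon> \<in> {0<..<\<epsilon>\<^sub>0}" for \<epsilon>
  proof -
    have e: "0 < \<epsilon>" using \<epsilon> by simp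
    have "\<epsilon> * (D1 + D2 + D3) < 1"
      using \<epsilon> D by (simp add: \<epsilon>\<^sub>0_def less_divide_eq)
    moreover have "0 \<le> \<epsilon> * D1" "0 \<le> \<epsilon> * D2" "0 \<le> \<epsilon> * D3" using e D by auto
    ultimately have s: "\<epsilon> * D1 \<le> 1" "\<epsilon> * D2 \<le> 1" "\<epsilon> * D3 \<le> 1" by (simp_all add: distrib_left)
    define r where "r = 2 * K * front_bound * \<epsilon>"
    have r0: "0 \<le> r" using K front_bound_pos e by (simp add: r_def)
    have r1: "r \<le> 1" using s(2) by (simp add: r_def D2_def mult.commute)
    have "2 * K * (\<epsilon> * (4 * coupling_mass) + M * r) \<le> 1" using s(1) by (simp add: r_def D1_def algebra_simps)
    from sol[OF e r_def r1 this] obtain v where v: "small_profile r v" "v = solve (forcing \<epsilon> v)"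
      and v': "\<And>x. \<bar>solve' (forcing \<epsilon> v) x\<bar> \<le> r" and g: "small_profile (r / K) (forcing \<epsilon> v)" by blast
    have "r * (2 / core_mass) \<le> 1" using s(3) by (simp add: r_def D3_def algebra_simps)
    then have rc: "r \<le> core_mass / 2" using core_mass_pos by (simp add: field_simps)
    let ?g = "forcing \<epsilon> v" and ?v' = "solve' (forcing \<epsilon> v)"
    note fp = fixed_point_is_solution[OF v v' g rc]
    have cg: "continuous_on UNIV ?g" and gk: "\<And>x. \<bar>?g x\<bar> \<le> r / K"
      and gI: "\<And>R. 0 \<le> R \<Longrightarrow> integral {-R..R} (\<lambda>x. \<bar>?g x\<bar>) \<le> r / K" using g by (auto simp: small_profile_def)
    have cv: "continuous_on UNIV v" and vr: "\<And>x. \<bar>v x\<bar> \<le> r" and I: "\<And>R. 0 \<le> R \<Longrightarrow> integral {-R..R} (\<lambda>x. \<bar>v x\<bar>) \<le> r"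
      using v by (auto simp: small_profile_def)
    define v'' where "v'' x = ?g x - deriv f (u x) * v x" for x
    have dv': "(?v' has_real_derivative v'' x) (at x)" for x using fp(3) by (simp add: v''_def)
    have cv'': "continuous_on UNIV v''"
      unfolding v''_def[abs_def] by (intro continuous_intros cg continuous_q cv)
    have pt: "\<bar>v'' x\<bar> \<le> \<bar>?g x\<bar> + Q * \<bar>v x\<bar>" for x
    proof -
      have "\<bar>deriv f (u x) * v x\<bar> \<le> Q * \<bar>v x\<bar>" unfolding abs_mult by (intro mult_right_mono Q) auto
      then show ?thesis unfolding v''_def by linarith
    qed
    have v''s: "\<bar>v'' x\<bar> \<le> P * r" for x
    proof -
      have "\<bar>v'' x\<bar> \<le> r / K + Q * r"
        using Q by (intro order_trans[OF pt] add_mono gk mult_left_mono vr) auto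
      then show ?thesis by (simp add: P_def algebra_simps)
    qed
    have v''I: "integral {-R..R} (\<lambda>x. \<bar>v'' x\<bar>) \<le> P * r" if R: "0 \<le> R" for R
    proof -
      have "integral {-R..R} (\<lambda>x. \<bar>v'' x\<bar>) \<le> integral {-R..R} (\<lambda>x. \<bar>?g x\<bar> + Q * \<bar>v x\<bar>)"
        by (rule integral_le) (intro integrable_on_interval continuous_intros cv'' cg cv pt)+
      also have "\<dots> = integral {-R..R} (\<lambda>x. \<bar>?g x\<bar>) + Q * integral {-R..R} (\<lambda>x. \<bar>v x\<bar>)"
      proof (rule integral_unique, intro has_integral_add has_integral_mult_right)
      qed (rule integrable_integral, intro integrable_on_interval continuous_intros cg cv)+
      also have "\<dots> \<le> r / K + Q * r"
        using Q by (intro add_mono gI mult_left_mono I R) auto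
      finally show ?thesis by (simp add: P_def algebra_simps)
    qed
    have "\<exists>N. has_H2_norm v N \<and> N \<le> sqrt (r * r + (2 * (r * r) + P * r * r) + P * r * (P * r))"
      by (rule has_H2_norm_of_C2[OF fp(2) dv' cv''])
         (intro integral_square_le cv vr I cv'' v''s v''I integral_derivative_square_le[OF fp(2) dv' cv'' vr v' v''s]; assumption)+
    moreover have "sqrt (r * r + (2 * (r * r) + P * r * r) + P * r * (P * r)) = C * \<epsilon>"
    proof -
      have "r * r + (2 * (r * r) + P * r * r) + P * r * (P * r) = r\<^sup>2 * (3 + P + P\<^sup>2)"
        by (simp add: power2_eq_square algebra_simps)
      then show ?thesis using r0 by (simp add: real_sqrt_mult C_def r_def)
    qed
    ultimately obtain N where N: "has_H2_norm v N" "N \<le> C * \<epsilon>" by auto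
    let ?w = "\<lambda>x. u x + v x" and ?w' = "\<lambda>x. \<phi> x + ?v' x"
    have "\<bar>?w x\<bar> \<le> 2" for x using abs_u_le[of x] vr[of x] r1 by linarith
    moreover have "(?w has_real_derivative ?w' x) (at x)" for x by (intro DERIV_add DERIV_u fp(2))
    moreover have "(?w' has_real_derivative \<epsilon> * nonlocal b ?w x - f (?w x)) (at x)" for x
    proof -
      have "(?w' has_real_derivative - f (u x) + v'' x) (at x)" by (intro DERIV_add DERIV_\<phi> dv')
      moreover have "- f (u x) + v'' x = \<epsilon> * nonlocal b ?w x - f (?w x)"
        by (simp add: v''_def forcing_def remainder_def)
      ultimately show ?thesis by simp
    qed
    ultimately show ?thesis using N
      by (intro exI[of _ ?w] exI[of _ ?w'] exI[of _ N]) simp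
  qed
  ultimately show ?thesis by blast
qed

end

theorem theorem1:
  fixes f :: "real \<Rightarrow> real" and a :: "int \<Rightarrow> real" and u\<^sub>0 :: "real \<Rightarrow> real"
  assumes H1: "bistable_balanced f"
    and H2: "coupling_coeffs a"
    and u0: "heteroclinic f u\<^sub>0"
  shows "\<exists>\<epsilon>\<^sub>0 C. \<epsilon>\<^sub>0 > 0 \<and> C > 0 \<and>
    (\<forall>\<epsilon>\<in>{0<..<\<epsilon>\<^sub>0}. \<exists>u N. nonlocal_solution f a \<epsilon> u \<and>
        has_H2_norm (\<lambda>z. u z - u\<^sub>0 z) N \<and> N \<le> C * \<epsilon>)"
proof -
  let ?b = "\<lambda>n. a (int n)"
  interpret coupled_wave f u\<^sub>0 ?b
    by unfold_locales (use H1 u0 coupling_summable[OF H2] coupling_first_moment[OF H2] in auto)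
  have sol: "nonlocal_solution f a \<epsilon> w"
    if w: "\<And>x. \<bar>w x\<bar> \<le> 2" and dw: "\<And>x. (w has_real_derivative w' x) (at x)"
      and dw': "\<And>x. (w' has_real_derivative \<epsilon> * nonlocal ?b w x - f (w x)) (at x)" for \<epsilon> w w'
  proof -
    have eq: "deriv w = w'" "deriv w' = (\<lambda>x. \<epsilon> * nonlocal ?b w x - f (w x))"
      using DERIV_imp_deriv[OF dw] DERIV_imp_deriv[OF dw'] by auto
    have cw: "continuous_on UNIV w" by (rule DERIV_imp_continuous[OF dw])
    have "continuous_on UNIV (\<lambda>x. \<epsilon> * nonlocal ?b w x - f (w x))"
      by (intro continuous_intros continuous_nonlocal[OF b0 w cw] continuous_on_compose2[OF continuous_f cw]) auto
    then have "C2 w"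
      unfolding C2_def eq using dw dw' by (auto simp: real_differentiable_def)
    moreover have "(\<lambda>k. a k * w (z - of_int k)) summable_on UNIV"
      "(\<Sum>\<^sub>\<infinity>k\<in>UNIV. a k * w (z - of_int k)) = nonlocal ?b w z" for z
      using coupling_has_sum_nonlocal[OF H2, where u = w and U = 2 and z = z] w
      by (auto intro: has_sum_imp_summable infsumI)
    ultimately show ?thesis unfolding nonlocal_solution_def eq by simp
  qed
  obtain \<epsilon>\<^sub>0 C where "\<epsilon>\<^sub>0 > 0" "C > 0" and near: "\<And>\<epsilon>. \<epsilon> \<in> {0<..<\<epsilon>\<^sub>0} \<Longrightarrow> \<exists>w w' N. (\<forall>x. \<bar>w x\<bar> \<le> 2) \<and>
     (\<forall>x. (w has_real_derivative w' x) (at x)) \<and>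
     (\<forall>x. (w' has_real_derivative \<epsilon> * nonlocal ?b w x - f (w x)) (at x)) \<and>
     has_H2_norm (\<lambda>z. w z - u\<^sub>0 z) N \<and> N \<le> C * \<epsilon>"
    using nearby_wave by blast
  moreover have "\<exists>u N. nonlocal_solution f a \<epsilon> u \<and> has_H2_norm (\<lambda>z. u z - u\<^sub>0 z) N \<and> N \<le> C * \<epsilon>"
    if "\<epsilon> \<in> {0<..<\<epsilon>\<^sub>0}" for \<epsilon>
    using near[OF that] sol by blast
  ultimately show ?thesis by blast
qed

end
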